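(* Let $X$ be a compact metric space, $\varepsilon>0$, and $c\in C(X\times X;[0,\infty))$ symmetric such that $k_c=\exp(-c/\varepsilon)$ is a positive definite universal kernel. For all $\mu_0,\mu_1\in\mathcal{P}(X)$ the variational problem $$\mathsf{d}_S(\mu_0,\mu_1)^2=\inf\left\{E((\mu_t)_t):(\mu_t)_{t\in[0,1]}\text{ admissible path from }\mu_0\text{ to }\mu_1\right\}$$ has a minimizer. Hence there exist Riemannian geodesics (energy-minimizing admissible paths) for the metric $\mathsf{d}_S$.
   Context: $\mathcal{P}(X)$: Radon probability measures. A kernel is universal if its reproducing kernel Hilbert space (RKHS) is dense in $C(X)$. For $\mu\in\mathcal{P}(X)$, $f_{\mu,\mu}\in C(X)$ is the unique function with $\int_X\exp\left(\frac1\varepsilon(f_{\mu,\mu}(x)+f_{\mu,\mu}(y)-c(x,y))\right)d\mu(x)=1$ for all $y\in X$; $a_\mu=\exp(f_{\mu,\mu}/\varepsilon)$; $k_\mu(x,y)=a_\mu(x)a_\mu(y)k_c(x,y)$; $K_\mu[\phi](y)=\int_X\phi(x)k_\mu(x,y)\,d\mu(x)$. $\mathcal{H}_c$ is the RKHS of $k_c$ and $B(\mu)=\int_X a_\mu(x)k_c(x,\cdot)\,d\mu(x)=\exp(-f_{\mu,\mu}/\varepsilon)\in\mathcal{H}_c$. For $\dot\beta\in\mathcal{H}_c$ with $\langle B(\mu),\dot\beta\rangle_{\mathcal{H}_c}=0$ (equivalently $\int a_\mu\dot\beta\,d\mu=0$), $$\tilde{\mathbf{g}}_\mu(\dot\beta,\dot\beta)=\frac\varepsilon2\left(\|\dot\beta\|_{\mathcal{H}_c}^2+2\left\langle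 a_\mu\dot\beta,(\mathrm{id}-K_\mu)^{-1}[a_\mu\dot\beta]\right\rangle_{L^2(X,\mu)}\right),$$ with $(\mathrm{id}-K_\mu)^{-1}$ taken on $L^2(X,\mu)/\mathbb{R}$ (quotient by constants), where $\mathrm{id}-K_\mu$ is boundedly invertible. A path $(\mu_t)_{t\in[0,1]}$ in $\mathcal{P}(X)$ is admissible if $(\beta_t)_t=(B(\mu_t))_t$ belongs to the Sobolev space $H^1((0,1);\mathcal{H}_c)$ of $\mathcal{H}_c$-valued functions ($L^2$ functions with distributional derivative $\dot\beta$ in $L^2$), and is continuous on $[0,1]$ (i.e. it is the continuous representative, including endpoints). For an admissible path, $\langle\beta_t,\dot\beta_t\rangle_{\mathcal{H}_c}=0$ for a.e. $t$, and its energy is $E((\mu_t)_t)=\int_0^1\tilde{\mathbf{g}}_{\mu_t}(\dot\beta_t,\dot\beta_t)\,dt$. *)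

theory Defs
  imports "HOL-Probability.Probability_Measure"
begin

section \<open>Radon probability measures and kernels\<close>

definition radon_prob :: "'a::topological_space measure \<Rightarrow> bool" where
  "radon_prob \<mu> \<longleftrightarrow> sets \<mu> = sets borel \<and> prob_space \<mu> \<and>
     (\<forall>A\<in>sets borel. emeasure \<mu> A = (SUP K\<in>{K. K \<subseteq> A \<and> compact K}. emeasure \<mu> K))"

definition pos_def_kernel :: "('a \<Rightarrow> 'a \<Rightarrow> real) \<Rightarrow> bool" where
  "pos_def_kernel k \<longleftrightarrow> (\<forall>x y. k x y = k y x) \<and>
     (\<forall>A w. finite A \<longrightarrow> 0 \<le> (\<Sum>x\<in>A. \<Sum>y\<in>A. w x * w y * k x y))"

text \<open>
  The reproducing kernel Hilbert space of \<open>k\<close> is a Hilbert space of functions. Since it depends on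
  the term \<open>k\<close>, it is represented by a Hilbert space type \<open>'h\<close> whose elements are identified with
  functions by an injective linear map \<open>incl\<close>: \<open>incl h\<close> is the function \<open>h\<close>. A pair \<open>('h, incl)\<close> with
  these properties is unique up to the unitary map that commutes with \<open>incl\<close>.
\<close>

definition is_rkhs ::
    "('a \<Rightarrow> 'a \<Rightarrow> real) \<Rightarrow> ('h::{real_inner,banach} \<Rightarrow> 'a \<Rightarrow> real) \<Rightarrow> bool" where
  "is_rkhs k incl \<longleftrightarrow>
     inj incl \<and>
     (\<forall>g h x. incl (g + h) x = incl g x + incl h x) \<and>
     (\<forall>r h x. incl (r *\<^sub>R h) x = r * incl h x) \<and>
     (\<forall>x. \<exists>\<kappa>. incl \<kappa> = k x \<and> (\<forall>h. incl h x = inner h \<kappa>))"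

text \<open>Density of the function space \<open>range incl\<close> in \<open>C(X)\<close> with the uniform norm.\<close>

definition universal :: "('h \<Rightarrow> 'a::topological_space \<Rightarrow> real) \<Rightarrow> bool" where
  "universal incl \<longleftrightarrow>
     (\<forall>h. continuous_on UNIV (incl h)) \<and>
     (\<forall>f. continuous_on UNIV f \<longrightarrow> (\<forall>\<delta>>0. \<exists>h. \<forall>x. \<bar>incl h x - f x\<bar> < \<delta>))"

definition k_c :: "real \<Rightarrow> ('a \<Rightarrow> 'a \<Rightarrow> real) \<Rightarrow> 'a \<Rightarrow> 'a \<Rightarrow> real" where
  "k_c \<epsilon> c x y = exp (- c x y / \<epsilon>)"

section \<open>Self-transport potential and the operator \<open>K\<^sub>\<mu>\<close>\<close>

definition f_pot :: "real \<Rightarrow> ('a::topological_space \<Rightarrow> 'a \<Rightarrow> real) \<Rightarrow> 'a measure \<Rightarrow> 'a \<Rightarrow> real" where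
  "f_pot \<epsilon> c \<mu> = (THE f. continuous_on UNIV f \<and>
     (\<forall>y. (\<integral>x. exp (1 / \<epsilon> * (f x + f y - c x y)) \<partial>\<mu>) = 1))"

definition a_fun :: "real \<Rightarrow> ('a::topological_space \<Rightarrow> 'a \<Rightarrow> real) \<Rightarrow> 'a measure \<Rightarrow> 'a \<Rightarrow> real" where
  "a_fun \<epsilon> c \<mu> x = exp (f_pot \<epsilon> c \<mu> x / \<epsilon>)"

definition k_mu :: "real \<Rightarrow> ('a::topological_space \<Rightarrow> 'a \<Rightarrow> real) \<Rightarrow> 'a measure \<Rightarrow> 'a \<Rightarrow> 'a \<Rightarrow> real" where
  "k_mu \<epsilon> c \<mu> x y = a_fun \<epsilon> c \<mu> x * a_fun \<epsilon> c \<mu> y * k_c \<epsilon> c x y"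

definition K_op ::
    "real \<Rightarrow> ('a::topological_space \<Rightarrow> 'a \<Rightarrow> real) \<Rightarrow> 'a measure \<Rightarrow> ('a \<Rightarrow> real) \<Rightarrow> 'a \<Rightarrow> real" where
  "K_op \<epsilon> c \<mu> \<phi> y = (\<integral>x. \<phi> x * k_mu \<epsilon> c \<mu> x y \<partial>\<mu>)"

definition L2_fun :: "'a measure \<Rightarrow> ('a \<Rightarrow> real) set" where
  "L2_fun \<mu> = {\<phi>. \<phi> \<in> borel_measurable \<mu> \<and> integrable \<mu> (\<lambda>x. (\<phi> x)\<^sup>2)}"

text \<open>
  The value of \<open>(id - K\<^sub>\<mu>)\<^sup>-\<^sup>1\<close> at the class of \<open>\<psi>\<close> in \<open>L\<^sup>2(X,\<mu>)/\<real>\<close>, as the set of all its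
  representatives. As \<open>id - K\<^sub>\<mu>\<close> is invertible on the quotient, these agree up to an additive
  constant \<open>\<mu>\<close>-almost everywhere.
\<close>

definition id_minus_K_inv ::
    "real \<Rightarrow> ('a::topological_space \<Rightarrow> 'a \<Rightarrow> real) \<Rightarrow> 'a measure \<Rightarrow> ('a \<Rightarrow> real) \<Rightarrow> ('a \<Rightarrow> real) set" where
  "id_minus_K_inv \<epsilon> c \<mu> \<psi> =
     {u \<in> L2_fun \<mu>. \<exists>r. AE x in \<mu>. u x - K_op \<epsilon> c \<mu> u x = \<psi> x + r}"

section \<open>The embedding \<open>B\<close> and the metric tensor\<close>

text \<open>\<open>inv incl (k_c \<epsilon> c x)\<close> is the function \<open>k\<^sub>c(x,\<cdot>)\<close> as an element of the RKHS; the integral is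
  the Bochner integral in the RKHS.\<close>

definition B_emb ::
    "real \<Rightarrow> ('a::topological_space \<Rightarrow> 'a \<Rightarrow> real) \<Rightarrow>
      ('h::{real_inner,banach,second_countable_topology} \<Rightarrow> 'a \<Rightarrow> real) \<Rightarrow> 'a measure \<Rightarrow> 'h" where
  "B_emb \<epsilon> c incl \<mu> = (\<integral>x. a_fun \<epsilon> c \<mu> x *\<^sub>R inv incl (k_c \<epsilon> c x) \<partial>\<mu>)"

text \<open>
  Meant for tangent vectors \<open>b\<close> with \<open>inner (B_emb \<epsilon> c incl \<mu>) b = 0\<close>: then \<open>a\<^sub>\<mu> b\<close> has \<open>\<mu>\<close>-mean zero
  and the pairing does not depend on the representative that is chosen.
\<close>

definition g_tensor ::
    "real \<Rightarrow> ('a::topological_space \<Rightarrow> 'a \<Rightarrow> real) \<Rightarrow>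
      ('h::{real_inner,banach,second_countable_topology} \<Rightarrow> 'a \<Rightarrow> real) \<Rightarrow> 'a measure \<Rightarrow> 'h \<Rightarrow> real" where
  "g_tensor \<epsilon> c incl \<mu> b =
     (let \<psi> = (\<lambda>x. a_fun \<epsilon> c \<mu> x * incl b x);
          u = (SOME u. u \<in> id_minus_K_inv \<epsilon> c \<mu> \<psi>)
      in \<epsilon> / 2 * ((norm b)\<^sup>2 + 2 * (\<integral>x. \<psi> x * u x \<partial>\<mu>)))"

section \<open>Sobolev paths in a Hilbert space\<close>

definition test_function :: "(real \<Rightarrow> real) \<Rightarrow> bool" where
  "test_function \<phi> \<longleftrightarrow>
     (\<forall>n t. (deriv ^^ n) \<phi> differentiable (at t)) \<and>
     (\<exists>K. compact K \<and> K \<subseteq> {0<..<1} \<and> (\<forall>t. t \<notin> K \<longrightarrow> \<phi> t = 0))"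

definition L2_path :: "(real \<Rightarrow> 'h::{real_inner,banach,second_countable_topology}) \<Rightarrow> bool" where
  "L2_path u \<longleftrightarrow> set_borel_measurable lborel {0<..<1} u \<and>
     set_integrable lborel {0<..<1} (\<lambda>t. (norm (u t))\<^sup>2)"

definition is_weak_deriv ::
    "(real \<Rightarrow> 'h::{real_inner,banach,second_countable_topology}) \<Rightarrow> (real \<Rightarrow> 'h) \<Rightarrow> bool" where
  "is_weak_deriv u v \<longleftrightarrow>
     (\<forall>\<phi>. test_function \<phi> \<longrightarrow>
        (LINT t:{0<..<1}|lborel. deriv \<phi> t *\<^sub>R u t) = - (LINT t:{0<..<1}|lborel. \<phi> t *\<^sub>R v t))"

definition H1_path :: "(real \<Rightarrow> 'h::{real_inner,banach,second_countable_topology}) \<Rightarrow> bool" where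
  "H1_path u \<longleftrightarrow> L2_path u \<and> (\<exists>v. L2_path v \<and> is_weak_deriv u v)"

text \<open>Determined only up to almost everywhere equality on the open unit interval.\<close>

definition weak_deriv ::
    "(real \<Rightarrow> 'h::{real_inner,banach,second_countable_topology}) \<Rightarrow> real \<Rightarrow> 'h" where
  "weak_deriv u = (SOME v. L2_path v \<and> is_weak_deriv u v)"

section \<open>Admissible paths, energy and distance\<close>

definition admissible_path ::
    "real \<Rightarrow> ('a::topological_space \<Rightarrow> 'a \<Rightarrow> real) \<Rightarrow>
      ('h::{real_inner,banach,second_countable_topology} \<Rightarrow> 'a \<Rightarrow> real) \<Rightarrow>
      (real \<Rightarrow> 'a measure) \<Rightarrow> bool" where
  "admissible_path \<epsilon> c incl \<gamma> \<longleftrightarrow>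
     (\<forall>t\<in>{0..1}. radon_prob (\<gamma> t)) \<and>
     H1_path (\<lambda>t. B_emb \<epsilon> c incl (\<gamma> t)) \<and>
     continuous_on {0..1} (\<lambda>t. B_emb \<epsilon> c incl (\<gamma> t))"

definition paths_between ::
    "real \<Rightarrow> ('a::topological_space \<Rightarrow> 'a \<Rightarrow> real) \<Rightarrow>
      ('h::{real_inner,banach,second_countable_topology} \<Rightarrow> 'a \<Rightarrow> real) \<Rightarrow>
      'a measure \<Rightarrow> 'a measure \<Rightarrow> (real \<Rightarrow> 'a measure) set" where
  "paths_between \<epsilon> c incl \<mu>0 \<mu>1 = {\<gamma>. admissible_path \<epsilon> c incl \<gamma> \<and> \<gamma> 0 = \<mu>0 \<and> \<gamma> 1 = \<mu>1}"

text \<open>The integrand is nonnegative almost everywhere, so \<open>ennreal\<close> does not truncate it.\<close>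

definition energy ::
    "real \<Rightarrow> ('a::topological_space \<Rightarrow> 'a \<Rightarrow> real) \<Rightarrow>
      ('h::{real_inner,banach,second_countable_topology} \<Rightarrow> 'a \<Rightarrow> real) \<Rightarrow>
      (real \<Rightarrow> 'a measure) \<Rightarrow> ennreal" where
  "energy \<epsilon> c incl \<gamma> =
     (\<integral>\<^sup>+t\<in>{0<..<1}. ennreal (g_tensor \<epsilon> c incl (\<gamma> t) (weak_deriv (\<lambda>s. B_emb \<epsilon> c incl (\<gamma> s)) t)) \<partial>lborel)"

definition d_S ::
    "real \<Rightarrow> ('a::topological_space \<Rightarrow> 'a \<Rightarrow> real) \<Rightarrow>
      ('h::{real_inner,banach,second_countable_topology} \<Rightarrow> 'a \<Rightarrow> real) \<Rightarrow>
      'a measure \<Rightarrow> 'a measure \<Rightarrow> real" where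
  "d_S \<epsilon> c incl \<mu>0 \<mu>1 = sqrt (enn2real (INF \<gamma>\<in>paths_between \<epsilon> c incl \<mu>0 \<mu>1. energy \<epsilon> c incl \<gamma>))"

end

theory Submission
  imports Defs "HOL-Library.Diagonal_Subsequence"
begin

text \<open>
  Write \<open>\<beta> = B \<mu> = 1 / a\<^sub>\<mu>\<close>. The image of \<open>B\<close> is the unit sphere of the cone dual to the nonnegative
  functions of the RKHS: given \<open>\<beta>\<close> in it, the functional \<open>\<langle>\<cdot>, \<beta>\<rangle>\<close> is integration against a measure \<open>\<alpha>\<close>
  (Riesz), and \<open>\<mu> = \<beta> \<alpha>\<close>; conversely the potential of \<open>\<mu>\<close> is found by maximizing
  \<open>\<integral> ln \<beta> d\<mu> - \<parallel>\<beta>\<parallel>\<^sup>2 / 2\<close> over the cone. Hence limits and normalized segments of paths lift back to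
  paths of measures. On the sphere uniform convergence of functions implies convergence in norm, so a
  minimizing sequence, being uniformly Hoelder continuous, converges uniformly along a subsequence.

  Conjugating \<open>K\<^sub>\<mu>\<close> by \<open>b \<mapsto> a\<^sub>\<mu> b\<close> gives an operator \<open>M\<close> on the RKHS with \<open>0 \<le> M \<le> 1\<close> and a spectral
  gap on the complement of \<open>\<beta>\<close>, and the metric tensor becomes the increasing limit of
  \<open>\<epsilon>/2 (\<parallel>b\<parallel>\<^sup>2 + 2 \<Sum>\<^sub>j \<langle>b, M\<^sup>j b\<rangle>)\<close>, \<open>1 \<le> j \<le> N\<close>. Each of these forms is convex in \<open>b\<close> and uniformly
  continuous in \<open>\<beta>\<close>, so Mazur's lemma and Fatou's lemma give lower semicontinuity of the energy.
\<close>

section \<open>Riesz representation on a compact metric space\<close>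

text \<open>Three obstacles shape the proof. The tensor contains a chosen representative and is
  evaluated along measures known only through \<open>B\<close>, so no measurability of the energy
  integrand is at hand. Estimates run through the truncated Neumann sums, which are jointly
  continuous; the integrand itself enters only through almost everywhere comparisons and through
  Fatou's lemma with a limit whose measurability is never asked for. Second, base point and velocity
  vary together along a minimizing sequence. The base point is frozen first, at a cost controlled by
  the squared velocity, since the operators \<open>M\<close> converge in operator norm; only then is
  convexity in the velocity used. Third, all constants have to be uniform in the measure. The norm
  of \<beta> is 1 because its square is the integral of \<beta>/\<beta>; as the kernel is at most 1,
  also \<beta> \<le> 1, so the conjugated kernel is bounded below by the minimum of the cost kernel.
  This gives one spectral gap for all measures, while Harnack's inequality gives one positive lower
  bound for all \<beta>.\<close>

locale positive_functional =
  fixes L :: "('a::metric_space \<Rightarrow> real) \<Rightarrow> real"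
  assumes compact_space: "compact (UNIV :: 'a set)"
    and L_add: "\<And>f g. continuous_on UNIV f \<Longrightarrow> continuous_on UNIV g \<Longrightarrow> L (\<lambda>x. f x + g x) = L f + L g"
    and L_scale: "\<And>f r. continuous_on UNIV f \<Longrightarrow> L (\<lambda>x. r * f x) = r * L f"
    and L_nonneg: "\<And>f. continuous_on UNIV f \<Longrightarrow> (\<And>x. 0 \<le> f x) \<Longrightarrow> 0 \<le> L f"
begin

lemma L_diff:
  assumes "continuous_on UNIV f" "continuous_on UNIV g"
  shows "L (\<lambda>x. f x - g x) = L f - L g"
proof -
  have "L (\<lambda>x. f x + (-1) * g x) = L f + (-1) * L g"
    using L_add[of f "\<lambda>x. (-1) * g x"] L_scale[OF assms(2), of "-1"] assms by (auto intro!: continuous_intros)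
  then show ?thesis by simp
qed

lemma L_mono:
  assumes "continuous_on UNIV f" "continuous_on UNIV g" "\<And>x. f x \<le> g x"
  shows "L f \<le> L g"
  using L_nonneg[of "\<lambda>x. g x - f x"] L_diff[of g f] assms by (auto intro!: continuous_intros)

lemma L_zero: "L (\<lambda>x. 0) = 0"
  using L_scale[of "\<lambda>x. 0" 0] by simp

lemma L_sum:
  fixes n :: nat
  assumes "\<And>i. i < n \<Longrightarrow> continuous_on UNIV (f i)"
  shows "L (\<lambda>x. \<Sum>i<n. f i x) = (\<Sum>i<n. L (f i))"
  using assms
proof (induction n)
  case 0
  then show ?case by (simp add: L_zero)
next
  case (Suc n)
  then show ?case
    by (simp add: lessThan_Suc) (subst L_add; auto intro!: continuous_intros simp: add.commute)
qed

text \<open>Functions take the place of sets in a Daniell-style cover: their sum dominates the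
  indicator of \<open>A\<close>. The outer measure then comes from \<open>L\<close> directly,
  without a premeasure on open sets.\<close>

definition covers :: "'a set \<Rightarrow> (nat \<Rightarrow> 'a \<Rightarrow> real) set" where
  "covers A = {f. (\<forall>i. continuous_on UNIV (f i) \<and> (\<forall>x. 0 \<le> f i x)) \<and> (\<forall>x\<in>A. 1 \<le> (\<Sum>i. ennreal (f i x)))}"

definition cost :: "(nat \<Rightarrow> 'a \<Rightarrow> real) \<Rightarrow> ennreal" where
  "cost f = (\<Sum>i. ennreal (L (f i)))"

definition outer :: "'a set \<Rightarrow> ennreal" where
  "outer A = (INF f\<in>covers A. cost f)"

lemma coversD:
  assumes "f \<in> covers A"
  shows "continuous_on UNIV (f i)" "0 \<le> f i x" "0 \<le> L (f i)" "x \<in> A \<Longrightarrow> 1 \<le> (\<Sum>i. ennreal (f i x))"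
  using assms by (auto simp: covers_def intro!: L_nonneg)

lemma outer_le_cost: "f \<in> covers A \<Longrightarrow> outer A \<le> cost f"
  unfolding outer_def by (rule INF_lower)

text \<open>Dini's argument: by compactness finitely many \<open>f i\<close> already dominate \<open>g - \<delta>\<close>.\<close>

lemma L_le_cost:
  assumes g: "continuous_on UNIV g"
    and f: "\<And>i. continuous_on UNIV (f i)" "\<And>i x. 0 \<le> f i x"
    and le: "\<And>x. ennreal (g x) \<le> (\<Sum>i. ennreal (f i x))"
  shows "ennreal (L g) \<le> cost f"
proof (rule ennreal_le_epsilon)
  fix e :: real assume e: "0 < e"
  define d where "d = e / (L (\<lambda>x. 1) + 1)"
  have L1: "0 \<le> L (\<lambda>x. 1)" by (rule L_nonneg) auto
  have d: "d > 0" using e L1 by (auto simp: d_def)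
  define U where "U n = {x. g x < (\<Sum>i<n. f i x) + d}" for n
  have op: "open (U n)" for n
    unfolding U_def by (intro open_Collect_less continuous_intros g f)
  have mono: "U n \<subseteq> U m" if "n \<le> m" for n m
  proof -
    have "(\<Sum>i<n. f i x) \<le> (\<Sum>i<m. f i x)" for x
      using that f by (intro sum_mono2) auto
    then show ?thesis unfolding U_def by (auto intro: less_le_trans)
  qed
  have cov: "x \<in> (\<Union>n. U n)" for x
  proof (cases "g x < d")
    case True
    then have "x \<in> U 0" by (auto simp: U_def)
    then show ?thesis by blast
  next
    case False
    have "ennreal (g x - d) < ennreal (g x)" using False d by (intro ennreal_lessI) auto
    also have "\<dots> \<le> (SUP n. \<Sum>i<n. ennreal (f i x))" using le by (simp add: suminf_eq_SUP)
    finally obtain n where "ennreal (g x - d) < (\<Sum>i<n. ennreal (f i x))"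
      by (auto simp: less_SUP_iff)
    also have "\<dots> = ennreal (\<Sum>i<n. f i x)" using f by (simp add: sum_ennreal)
    finally have "g x - d < (\<Sum>i<n. f i x)" using False
      by (subst (asm) ennreal_less_iff) auto
    then have "x \<in> U n" by (auto simp: U_def)
    then show ?thesis by blast
  qed
  obtain N where N: "finite N" "UNIV \<subseteq> (\<Union>n\<in>N. U n)"
    by (rule compactE_image[OF compact_space, of UNIV U]) (use op cov in auto)
  define n where "n = Max (insert 0 N)"
  have "x \<in> U n" for x
  proof -
    obtain k where "k \<in> N" "x \<in> U k" using N(2) by blast
    moreover have "k \<le> n" unfolding n_def using N(1) \<open>k \<in> N\<close> by (intro Max_ge) auto
    ultimately show ?thesis using mono by blast
  qed
  then have "g x \<le> (\<Sum>i<n. f i x) + d * 1" for x by (auto simp: U_def intro: less_imp_le)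
  then have "L g \<le> L (\<lambda>x. (\<Sum>i<n. f i x) + d * 1)"
    using g f by (intro L_mono) (auto intro!: continuous_intros)
  also have "\<dots> = (\<Sum>i<n. L (f i)) + d * L (\<lambda>x. 1)"
    using f by (subst L_add) (auto intro!: continuous_intros simp: L_sum L_scale simp del: mult_1_right)
  also have "d * L (\<lambda>x. 1) \<le> e" using L1 e by (auto simp: d_def field_simps)
  finally have "ennreal (L g) \<le> ennreal ((\<Sum>i<n. L (f i)) + e)" by (intro ennreal_leI) auto
  also have "\<dots> = (\<Sum>i<n. ennreal (L (f i))) + ennreal e"
    using f e by (subst ennreal_plus) (auto intro!: sum_nonneg L_nonneg sum_ennreal[symmetric])
  also have "\<dots> \<le> cost f + ennreal e" unfolding cost_def
    by (intro add_mono sum_le_suminf) auto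
  finally show "ennreal (L g) \<le> cost f + ennreal e" .
qed

lemma cover_single:
  assumes "continuous_on UNIV h" "\<And>x. 0 \<le> h x" "\<And>x. x \<in> A \<Longrightarrow> 1 \<le> h x"
  shows "outer A \<le> ennreal (L h)"
proof -
  define f where "f i = (if i = (0::nat) then h else (\<lambda>x. 0))" for i
  have s: "(\<Sum>i. ennreal (f i x)) = ennreal (h x)" for x
    using suminf_finite[of "{0}" "\<lambda>i. ennreal (f i x)"] by (auto simp: f_def)
  have c: "cost f = ennreal (L h)"
    unfolding cost_def
    using suminf_finite[of "{0}" "\<lambda>i. ennreal (L (f i))"] by (auto simp: f_def L_zero)
  have "f \<in> covers A" using assms by (auto simp: covers_def s) (auto simp: f_def)
  from outer_le_cost[OF this] c show ?thesis by simp
qed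

lemma outer_finite: "outer A < \<infinity>"
  using cover_single[of "\<lambda>x. 1" A] by (auto simp: le_less_trans)

lemma outer_approx:
  assumes "e > 0"
  obtains f where "f \<in> covers A" "cost f \<le> outer A + ennreal e"
proof -
  have "outer A < outer A + ennreal e"
    using outer_finite[of A] assms by (simp add: ennreal_add_left_cancel_less[of _ 0, simplified])
  then obtain f where "f \<in> covers A" "cost f < outer A + ennreal e"
    unfolding outer_def by (subst (asm) INF_less_iff) auto
  then show ?thesis using that by (auto intro: less_imp_le)
qed

lemma outer_empty: "outer {} = 0"
  using cover_single[of "\<lambda>x. 0" "{}"] by (auto simp: L_zero)

lemma outer_mono: "A \<subseteq> B \<Longrightarrow> outer A \<le> outer B"
  unfolding outer_def by (intro INF_superset_mono) (auto simp: covers_def)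

text \<open>Countable subadditivity and the telescoping cover in \<open>outer_split\<close> both
  produce doubly indexed families; \<open>prod_decode\<close> flattens them.\<close>

lemma double_cover:
  assumes f: "\<And>i n. continuous_on UNIV (f i n)" "\<And>i n x. 0 \<le> f i n x"
    and cov: "\<And>x. x \<in> A \<Longrightarrow> 1 \<le> (\<Sum>i. \<Sum>n. ennreal (f i n x))"
  shows "outer A \<le> (\<Sum>i. \<Sum>n. ennreal (L (f i n)))"
proof -
  define F where "F k = (case prod_decode k of (i, n) \<Rightarrow> f i n)" for k
  have 1: "(\<Sum>k. ennreal (F k x)) = (\<Sum>i. \<Sum>n. ennreal (f i n x))" for x
    using suminf_ennreal_2dimen[of "\<lambda>i. \<Sum>n. ennreal (f i n x)" "\<lambda>(i,n). ennreal (f i n x)"]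
    by (auto simp: F_def comp_def split_def)
  have 2: "cost F = (\<Sum>i. \<Sum>n. ennreal (L (f i n)))"
    unfolding cost_def
    using suminf_ennreal_2dimen[of "\<lambda>i. \<Sum>n. ennreal (L (f i n))" "\<lambda>(i,n). ennreal (L (f i n))"]
    by (auto simp: F_def comp_def split_def)
  have "F \<in> covers A" unfolding covers_def using f cov by (auto simp: 1) (auto simp: F_def split_def)
  from outer_le_cost[OF this] 2 show ?thesis by simp
qed

lemma outer_countably_subadditive: "outer (\<Union>i. A i) \<le> (\<Sum>i. outer (A i))"
proof (rule ennreal_le_epsilon)
  fix e :: real assume e: "0 < e"
  have "\<forall>i. \<exists>f. f \<in> covers (A i) \<and> cost f \<le> outer (A i) + ennreal (e * (1/2) ^ Suc i)"
    using outer_approx e by (metis half_gt_zero_iff mult_pos_pos zero_less_divide_1_iff zero_less_numeral zero_less_power)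
  then obtain f where f: "\<And>i. f i \<in> covers (A i)"
    and c: "\<And>i. cost (f i) \<le> outer (A i) + ennreal (e * (1/2) ^ Suc i)" by metis
  have "outer (\<Union>i. A i) \<le> (\<Sum>i. \<Sum>n. ennreal (L (f i n)))"
  proof (rule double_cover)
    fix x assume "x \<in> (\<Union>i. A i)"
    then obtain j where "x \<in> A j" by blast
    then have "1 \<le> (\<Sum>n. ennreal (f j n x))" using coversD(4)[OF f] by blast
    also have "\<dots> \<le> (\<Sum>i. \<Sum>n. ennreal (f i n x))"
      using sum_le_suminf[of "\<lambda>i. \<Sum>n. ennreal (f i n x)" "{j}"] by auto
    finally show "1 \<le> (\<Sum>i. \<Sum>n. ennreal (f i n x))" .
  qed (use coversD[OF f] in auto)
  also have "\<dots> \<le> (\<Sum>i. outer (A i) + ennreal (e * (1/2) ^ Suc i))"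
    using c by (intro suminf_le) (auto simp: cost_def)
  also have "\<dots> = (\<Sum>i. outer (A i)) + (\<Sum>i. ennreal (e * (1/2) ^ Suc i))"
    by (intro suminf_add[symmetric]) auto
  also have "(\<Sum>i. ennreal (e * (1/2) ^ Suc i)) = ennreal e"
  proof (rule suminf_ennreal_eq)
    show "(\<lambda>i. e * (1/2) ^ Suc i) sums e"
      using sums_mult[OF power_half_series, of e] by simp
  qed (use e in auto)
  finally show "outer (\<Union>i. A i) \<le> (\<Sum>i. outer (A i)) + ennreal e" .
qed

text \<open>This is Caratheodory's inequality for the set where \<open>g\<close> is positive. The
  cutoffs \<open>G n\<close> increase to its indicator. The increments
  \<open>f i * (G (n+1) - G n)\<close> telescope to a cover of the part inside, of cost
  \<open>s i = lim (a i)\<close>. The remainders \<open>f i * (1 - G (N i))\<close> cover the part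
  outside, where all \<open>G n\<close> vanish. Choosing \<open>N i\<close> so late that
  \<open>a i (N i)\<close> is within \<open>e / 2^(i+1)\<close> of \<open>s i\<close> makes the two
  costs add up to \<open>cost f + e\<close>.\<close>

lemma outer_split:
  fixes g :: "'a \<Rightarrow> real"
  assumes g: "continuous_on UNIV g" "\<And>x. 0 \<le> g x"
    and f: "f \<in> covers A"
  shows "outer (A \<inter> {x. 0 < g x}) + outer (A - {x. 0 < g x}) \<le> cost f"
proof (rule ennreal_le_epsilon)
  fix e :: real assume e: "0 < e"
  note fc = coversD[OF f]
  define G where "G n x = min 1 (real n * g x)" for n x
  have Gc: "continuous_on UNIV (G n)" for n
    unfolding G_def by (intro continuous_intros g)
  have G01: "0 \<le> G n x" "G n x \<le> 1" for n x using g by (auto simp: G_def)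
  have Gm: "G n x \<le> G (Suc n) x" for n x
    unfolding G_def using g(2)[of x] by (auto simp: min_def algebra_simps)
  have Glim: "(\<lambda>n. G n x) \<longlonglongrightarrow> 1" if "0 < g x" for x
  proof -
    obtain N where N: "real N * g x > 1" using reals_Archimedean3[of "g x"] \<open>0 < g x\<close> by blast
    have "G n x = 1" if "n \<ge> N" for n
    proof -
      have "real N * g x \<le> real n * g x" using that \<open>0 < g x\<close> by (intro mult_right_mono) auto
      then show ?thesis using N by (auto simp: G_def)
    qed
    then have "eventually (\<lambda>n. G n x = 1) sequentially" by (auto simp: eventually_sequentially)
    then show ?thesis by (rule tendsto_eventually)
  qed
  define a where "a i n = L (\<lambda>x. f i x * G n x)" for i n
  have fGc: "continuous_on UNIV (\<lambda>x. f i x * G n x)" for i n by (intro continuous_intros fc Gc)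
  have am: "incseq (a i)" for i
    unfolding a_def by (intro incseq_SucI L_mono fGc mult_left_mono Gm fc)
  have ab: "a i n \<le> L (f i)" for i n
    unfolding a_def using fc G01 by (intro L_mono fGc) (auto intro: mult_left_le)
  have a0: "a i 0 = 0" for i by (simp add: a_def G_def L_zero g(2))
  have "\<exists>l. a i \<longlonglongrightarrow> l \<and> (\<forall>n. a i n \<le> l)" for i
    using incseq_convergent[OF am, of i "L (f i)"] ab by metis
  then obtain s where s: "\<And>i. a i \<longlonglongrightarrow> s i" "\<And>i n. a i n \<le> s i" by metis
  have s0: "0 \<le> s i" for i using s(2)[of i 0] a0 by simp
  have "outer (A \<inter> {x. 0 < g x}) \<le> (\<Sum>i. \<Sum>n. ennreal (L (\<lambda>x. f i x * (G (Suc n) x - G n x))))"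
  proof (rule double_cover)
    fix x assume x: "x \<in> A \<inter> {x. 0 < g x}"
    have "(\<Sum>n. ennreal (f i x * (G (Suc n) x - G n x))) = ennreal (f i x)" for i
    proof (rule suminf_ennreal_eq)
      have "(\<lambda>n. G (Suc n) x - G n x) sums (1 - G 0 x)"
        using x by (intro telescope_sums Glim) auto
      then have "(\<lambda>n. G (Suc n) x - G n x) sums 1" by (simp add: G_def g(2))
      from sums_mult[OF this, of "f i x"]
      show "(\<lambda>n. f i x * (G (Suc n) x - G n x)) sums f i x" by simp
    qed (use fc Gm in \<open>auto intro!: mult_nonneg_nonneg\<close>)
    then show "1 \<le> (\<Sum>i. \<Sum>n. ennreal (f i x * (G (Suc n) x - G n x)))" using fc(4)[of x] x by simp
  qed (use fc Gm Gc in \<open>auto intro!: mult_nonneg_nonneg continuous_intros\<close>)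
  also have "\<dots> = (\<Sum>i. ennreal (s i))"
  proof (intro suminf_cong suminf_ennreal_eq)
    fix i
    have "L (\<lambda>x. f i x * (G (Suc n) x - G n x)) = a i (Suc n) - a i n" for n
      unfolding a_def by (simp add: right_diff_distrib L_diff fGc)
    then show "(\<lambda>n. L (\<lambda>x. f i x * (G (Suc n) x - G n x))) sums s i"
      using telescope_sums[OF s(1)[of i]] by (simp add: a0)
    fix n show "0 \<le> L (\<lambda>x. f i x * (G (Suc n) x - G n x))"
      by (intro L_nonneg continuous_intros fc Gc mult_nonneg_nonneg) (use Gm in auto)
  qed
  finally have 1: "outer (A \<inter> {x. 0 < g x}) \<le> (\<Sum>i. ennreal (s i))" .
  have "\<exists>n. s i \<le> a i n + e * (1/2) ^ Suc i" for i
  proof -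
    have "s i - e * (1/2) ^ Suc i < s i" using e by simp
    then have "eventually (\<lambda>n. s i - e * (1/2) ^ Suc i < a i n) sequentially"
      using order_tendstoD(1)[OF s(1)] by blast
    then obtain n where "s i - e * (1/2) ^ Suc i < a i n" by (auto simp: eventually_sequentially)
    then show ?thesis by (intro exI[of _ n]) auto
  qed
  then obtain N where N: "\<And>i. s i \<le> a i (N i) + e * (1/2) ^ Suc i" by metis
  define h where "h i x = f i x - f i x * G (N i) x" for i x
  have hc: "continuous_on UNIV (h i)" for i unfolding h_def by (intro continuous_intros fc Gc)
  have h0: "0 \<le> h i x" for i x unfolding h_def using fc(2) G01 by (simp add: mult_left_le)
  have "h \<in> covers (A - {x. 0 < g x})"
    unfolding covers_def
  proof (intro CollectI conjI allI ballI hc h0)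
    fix x assume x: "x \<in> A - {x. 0 < g x}"
    then have "g x = 0" using g(2)[of x] by auto
    then have "h i x = f i x" for i by (simp add: h_def G_def)
    then show "1 \<le> (\<Sum>i. ennreal (h i x))" using fc(4) x by auto
  qed
  then have "outer (A - {x. 0 < g x}) \<le> cost h" by (rule outer_le_cost)
  with 1 have "outer (A \<inter> {x. 0 < g x}) + outer (A - {x. 0 < g x}) \<le> (\<Sum>i. ennreal (s i)) + cost h"
    by (rule add_mono)
  also have "\<dots> = (\<Sum>i. ennreal (s i) + ennreal (L (h i)))"
    unfolding cost_def by (intro suminf_add) auto
  also have "\<dots> \<le> (\<Sum>i. ennreal (L (f i)) + ennreal (e * (1/2) ^ Suc i))"
  proof (intro suminf_le)
    fix i
    have "L (h i) = L (f i) - a i (N i)" unfolding h_def a_def by (rule L_diff[OF fc(1) fGc])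
    then have "s i + L (h i) \<le> L (f i) + e * (1/2) ^ Suc i" using N[of i] by simp
    then have "ennreal (s i + L (h i)) \<le> ennreal (L (f i) + e * (1/2) ^ Suc i)" by (rule ennreal_leI)
    then show "ennreal (s i) + ennreal (L (h i)) \<le> ennreal (L (f i)) + ennreal (e * (1/2) ^ Suc i)"
      using s0 fc(3) e by (simp add: ennreal_plus L_nonneg hc h0)
  qed auto
  also have "\<dots> = cost f + (\<Sum>i. ennreal (e * (1/2) ^ Suc i))"
    unfolding cost_def by (intro suminf_add[symmetric]) auto
  also have "(\<Sum>i. ennreal (e * (1/2) ^ Suc i)) = ennreal e"
  proof (rule suminf_ennreal_eq)
    show "(\<lambda>i. e * (1/2) ^ Suc i) sums e"
      using sums_mult[OF power_half_series, of e] by simp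
  qed (use e in auto)
  finally show "outer (A \<inter> {x. 0 < g x}) + outer (A - {x. 0 < g x}) \<le> cost f + ennreal e" .
qed

section \<open>Caratheodory's construction of the representing measure\<close>

lemma outer_measure_space_outer: "outer_measure_space UNIV outer"
  unfolding outer_measure_space_def positive_def increasing_def countably_subadditive_def
  using outer_empty outer_mono outer_countably_subadditive by auto

text \<open>In a metric space an open set is the positivity set of the distance to its complement,
  so \<open>outer_split\<close> applies. The whole space is treated apart because
  \<open>infdist\<close> to the empty set is 0.\<close>

lemma open_in_lambda_system:
  assumes "open U"
  shows "U \<in> lambda_system UNIV UNIV outer"
proof -
  obtain g :: "'a \<Rightarrow> real" where g: "continuous_on UNIV g" "\<And>x. 0 \<le> g x" "U = {x. 0 < g x}"
  proof (cases "U = UNIV")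
    case True
    then show ?thesis using that[of "\<lambda>x. 1"] by auto
  next
    case False
    then have ne: "- U \<noteq> {}" by auto
    have "x \<in> U \<longleftrightarrow> 0 < infdist x (- U)" for x
      using in_closed_iff_infdist_zero[of "- U" x] assms ne infdist_nonneg[of x "-U"]
      by (auto simp: closed_Compl order_less_le)
    then have "U = {x. 0 < infdist x (- U)}" by blast
    then show ?thesis
      by (intro that[of "\<lambda>x. infdist x (- U)"] infdist_nonneg continuous_intros)
  qed
  interpret sigma_algebra "UNIV :: 'a set" UNIV using sigma_algebra_Pow[of UNIV] by simp
  show ?thesis
    unfolding lambda_system_eq
  proof (intro CollectI conjI ballI antisym UNIV_I)
    fix A :: "'a set"
    show "outer (A \<inter> U) + outer (A - U) \<le> outer A"
    proof (subst (3) outer_def, rule INF_greatest)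
      fix f assume "f \<in> covers A"
      then show "outer (A \<inter> U) + outer (A - U) \<le> cost f" unfolding g(3) by (rule outer_split[OF g(1,2)])
    qed
    have "subadditive UNIV outer"
      using countably_subadditive_subadditive outer_measure_space_outer
      unfolding outer_measure_space_def by blast
    then show "outer A \<le> outer (A \<inter> U) + outer (A - U)"
      unfolding subadditive_def by (metis Int_Diff_Un Int_Diff_disjoint UNIV_I)
  qed
qed

definition M :: "'a measure" where "M = measure_of UNIV (sets borel) outer"

lemma sets_M [measurable_cong, simp]: "sets M = sets borel"
  unfolding M_def by (simp add: sets_measure_of_conv sets.sigma_sets_eq[of borel, simplified])

lemma space_M [simp]: "space M = UNIV"
  unfolding M_def by (simp add: space_measure_of_conv)

lemma emeasure_M: "A \<in> sets borel \<Longrightarrow> emeasure M A = outer A"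
proof -
  assume A: "A \<in> sets borel"
  interpret sigma_algebra "UNIV :: 'a set" UNIV using sigma_algebra_Pow[of UNIV] by simp
  have ms: "measure_space UNIV (lambda_system UNIV UNIV outer) outer"
    by (rule caratheodory_lemma[OF outer_measure_space_outer])
  then have sa: "sigma_algebra UNIV (lambda_system UNIV UNIV outer)"
    by (simp add: measure_space_def)
  have sub: "sets (borel :: 'a measure) \<subseteq> lambda_system UNIV UNIV outer"
  proof -
    have "sets (borel :: 'a measure) = sigma_sets UNIV {S. open S}"
      unfolding borel_def by (rule sets_measure_of) simp
    then show ?thesis
      using sigma_algebra.sigma_sets_subset[OF sa, of "{S. open S}"] open_in_lambda_system by blast
  qed
  have "measure_space UNIV (sets (borel :: 'a measure)) outer"
    by (rule measure_down[OF ms _ sub]) (metis sets.sigma_algebra_axioms space_borel)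
  then show ?thesis
    unfolding M_def using A
    by (intro emeasure_measure_of_sigma) (auto simp: measure_space_def)
qed

lemma finite_measure_M: "finite_measure M"
  by (rule finite_measureI) (use outer_finite[of UNIV] in \<open>simp add: emeasure_M\<close>)

lemma measure_M_space: "measure M UNIV = L (\<lambda>x. 1)"
proof -
  have 0: "0 \<le> L (\<lambda>x. 1)" by (rule L_nonneg) auto
  have "outer UNIV = ennreal (L (\<lambda>x. 1))"
  proof (rule antisym)
    show "outer UNIV \<le> ennreal (L (\<lambda>x. 1))" by (rule cover_single) auto
    show "ennreal (L (\<lambda>x. 1)) \<le> outer UNIV"
      unfolding outer_def
    proof (rule INF_greatest)
      fix f assume f: "f \<in> covers UNIV"
      show "ennreal (L (\<lambda>x. 1)) \<le> cost f"
      proof (rule L_le_cost)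
        show "ennreal 1 \<le> (\<Sum>i. ennreal (f i x))" for x using coversD(4)[OF f, of x] by simp
      qed (use coversD(1,2)[OF f] in simp_all)
    qed
  qed
  then show ?thesis using 0 by (simp add: measure_def emeasure_M)
qed

lemma integrable_M:
  fixes f :: "'a \<Rightarrow> real"
  assumes "continuous_on UNIV f"
  shows "integrable M f"
proof -
  interpret finite_measure M by (rule finite_measure_M)
  have "bounded (f ` UNIV)" using assms compact_space by (intro compact_imp_bounded compact_continuous_image) auto
  then obtain B where "\<And>x. norm (f x) \<le> B" by (auto simp: bounded_iff)
  moreover have "f \<in> borel_measurable M"
    using borel_measurable_continuous_onI[OF assms] by simp
  ultimately show ?thesis by (intro integrable_const_bound[of _ B]) auto
qed

section \<open>Integrals of continuous functions against the representing measure\<close>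

lemma layer_sum: "0 \<le> (y::real) \<Longrightarrow> (\<Sum>j<n. min 1 (max 0 (y - real j))) = min y (real n)"
  by (induction n) (auto simp: min_def max_def)

lemma layer_bound: "0 \<le> (y::real) \<Longrightarrow> min y (real n) \<le> 1 + (\<Sum>j<n. of_bool (real (Suc j) \<le> y))"
proof (induction n)
  case (Suc n)
  show ?case
  proof (cases "y \<le> real n")
    case True
    then show ?thesis using Suc by (auto simp: min_def split: if_splits)
  next
    case False
    then have "(\<Sum>j<n. of_bool (real (Suc j) \<le> y)) = (\<Sum>j<n. (1::real))"
      by (intro sum.cong) auto
    then show ?thesis by (auto simp: min_def)
  qed
qed auto

text \<open>A layer-cake estimate: \<open>n * f\<close> is the sum of the continuous layers
  \<open>l j\<close>, and \<open>l j\<close> equals 1 on \<open>A j\<close>, so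
  \<open>cover_single\<close> bounds the measure of \<open>A j\<close> by \<open>L (l j)\<close>.
  Rounding \<open>n * f\<close> to the level sets costs at most 1, hence total mass over
  \<open>n\<close> after division.\<close>

lemma integral_M_le:
  assumes f: "continuous_on UNIV f" "\<And>x. 0 \<le> f x" "\<And>x. f x \<le> 1"
  shows "integral\<^sup>L M f \<le> L f"
proof (rule field_le_epsilon)
  interpret finite_measure M by (rule finite_measure_M)
  fix e :: real assume e: "0 < e"
  define c where "c = L (\<lambda>x. 1)"
  have c: "0 \<le> c" unfolding c_def by (rule L_nonneg) auto
  obtain n where n: "n > 0" "c < e * real n"
    using reals_Archimedean3[OF e] by (metis c mult.commute mult_zero_left not_gr_zero of_nat_0 order_le_less_trans linorder_not_le)
  define l where "l j x = min 1 (max 0 (real n * f x - real j))" for j :: nat and x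
  have lc: "continuous_on UNIV (l j)" for j unfolding l_def by (intro continuous_intros f)
  have fm[measurable]: "f \<in> borel_measurable borel" using f by (intro borel_measurable_continuous_onI)
  define A where "A j = {x. real (Suc j) \<le> real n * f x}" for j
  have [measurable]: "A j \<in> sets borel" for j unfolding A_def by measurable
  have mA: "measure M (A j) \<le> L (l j)" for j
  proof -
    have "emeasure M (A j) \<le> ennreal (L (l j))"
      using cover_single[of "l j" "A j"] lc[of j] by (auto simp: emeasure_M l_def A_def)
    moreover have "0 \<le> L (l j)" by (rule L_nonneg[OF lc]) (auto simp: l_def)
    ultimately show ?thesis by (simp add: emeasure_eq_measure)
  qed
  have nf: "min (real n * f x) (real n) = real n * f x" for x
    using f(3)[of x] n by (auto simp: min_def)
  have "real n * integral\<^sup>L M f = (\<integral>x. real n * f x \<partial>M)" by simp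
  also have "\<dots> \<le> (\<integral>x. 1 + (\<Sum>j<n. indicator (A j) x) \<partial>M)"
  proof (rule integral_mono)
    show "integrable M (\<lambda>x. real n * f x)" using integrable_M[OF f(1)] by auto
    show "integrable M (\<lambda>x. 1 + (\<Sum>j<n. indicator (A j) x) :: real)"
      by (intro Bochner_Integration.integrable_add Bochner_Integration.integrable_sum) (auto simp: emeasure_eq_measure)
    show "real n * f x \<le> 1 + (\<Sum>j<n. indicator (A j) x)" for x
      using layer_bound[of "real n * f x" n] f(2)[of x] nf[of x]
      by (simp add: A_def indicator_def of_bool_def)
  qed
  also have "\<dots> = c + (\<Sum>j<n. measure M (A j))"
    by (subst Bochner_Integration.integral_add) (auto simp: Bochner_Integration.integral_sum emeasure_eq_measure c_def measure_M_space)
  also have "\<dots> \<le> c + (\<Sum>j<n. L (l j))" using mA by (intro add_left_mono sum_mono) auto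
  also have "(\<Sum>j<n. L (l j)) = L (\<lambda>x. \<Sum>j<n. l j x)" using lc by (intro L_sum[symmetric])
  also have "(\<lambda>x. \<Sum>j<n. l j x) = (\<lambda>x. real n * f x)"
    unfolding l_def using layer_sum f(2) nf by (intro ext) (simp add: mult_nonneg_nonneg)
  also have "L \<dots> = real n * L f" by (rule L_scale[OF f(1)])
  also have "c + real n * L f \<le> real n * (L f + e)" using n by (simp add: algebra_simps)
  finally show "integral\<^sup>L M f \<le> L f + e" using n by simp
qed

text \<open>The reverse inequality is \<open>integral_M_le\<close> for \<open>1 - f\<close>, since
  total mass and \<open>L 1\<close> agree.\<close>

lemma integral_M_01:
  assumes f: "continuous_on UNIV f" "\<And>x. 0 \<le> f x" "\<And>x. f x \<le> 1"
  shows "integral\<^sup>L M f = L f"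
proof -
  interpret finite_measure M by (rule finite_measure_M)
  have "(\<integral>x. 1 - f x \<partial>M) \<le> L (\<lambda>x. 1 - f x)"
    by (rule integral_M_le) (use f in \<open>auto intro!: continuous_intros\<close>)
  also have "L (\<lambda>x. 1 - f x) = L (\<lambda>x. 1) - L f" by (rule L_diff) (use f in auto)
  also have "(\<integral>x. 1 - f x \<partial>M) = L (\<lambda>x. 1) - integral\<^sup>L M f"
    using integrable_M[OF f(1)] by (simp add: measure_M_space)
  finally show ?thesis using integral_M_le[OF f] by simp
qed

lemma integral_M:
  assumes f: "continuous_on UNIV f"
  shows "integral\<^sup>L M f = L f"
proof -
  interpret finite_measure M by (rule finite_measure_M)
  have "bounded (f ` UNIV)" using assms compact_space by (intro compact_imp_bounded compact_continuous_image) auto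
  then obtain B where B: "B > 0" "\<And>x. \<bar>f x\<bar> \<le> B" by (auto simp: bounded_pos)
  define g where "g x = (1 / (2*B)) * f x + (1/2) * 1" for x
  have gc: "continuous_on UNIV g" unfolding g_def by (intro continuous_intros f)
  have "L g = (1 / (2*B)) * L f + (1/2) * L (\<lambda>x. 1)"
    unfolding g_def using f L_scale[of "\<lambda>x. 1" "1/2"]
    by (subst L_add) (auto intro!: continuous_intros simp: L_scale simp del: mult_1_right times_divide_eq_left)
  moreover have "integral\<^sup>L M g = (1 / (2*B)) * integral\<^sup>L M f + (1/2) * L (\<lambda>x. 1)"
    unfolding g_def using integrable_M[OF f] by (simp add: measure_M_space)
  moreover have "integral\<^sup>L M g = L g"
  proof (rule integral_M_01[OF gc])
    fix x show "0 \<le> g x" "g x \<le> 1" using B(1) B(2)[of x] by (auto simp: g_def field_simps)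
  qed
  ultimately show ?thesis using B(1) by simp
qed

end

theorem Riesz_representation_compact:
  fixes L :: "('a::metric_space \<Rightarrow> real) \<Rightarrow> real"
  assumes "compact (UNIV :: 'a set)"
    and "\<And>f g. continuous_on UNIV f \<Longrightarrow> continuous_on UNIV g \<Longrightarrow> L (\<lambda>x. f x + g x) = L f + L g"
    and "\<And>f r. continuous_on UNIV f \<Longrightarrow> L (\<lambda>x. r * f x) = r * L f"
    and "\<And>f. continuous_on UNIV f \<Longrightarrow> (\<And>x. 0 \<le> f x) \<Longrightarrow> 0 \<le> L f"
  obtains M where "sets M = sets borel" "finite_measure M"
    "\<And>f. continuous_on UNIV f \<Longrightarrow> integral\<^sup>L M f = L f"
proof -
  interpret positive_functional L by unfold_locales (fact assms)+
  show ?thesis using that[OF sets_M finite_measure_M integral_M] .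
qed

section \<open>Smooth cutoff functions\<close>

text \<open>The powers in the denominator are included because differentiation produces them: the
  family is closed under derivatives up to linear combinations.\<close>

definition exp_flat :: "nat \<Rightarrow> real \<Rightarrow> real" where
  "exp_flat i x = (if 0 < x then exp (- 1 / x) / x ^ i else 0)"

lemma exp_flat_tendsto_0: "(exp_flat i \<longlongrightarrow> 0) (at 0)"
proof -
  have "((\<lambda>x. (inverse x) ^ i / exp (inverse x)) \<longlongrightarrow> (0::real)) (at_right 0)"
    by (rule filterlim_compose[OF tendsto_power_div_exp_0 filterlim_inverse_at_top_right])
  moreover have "eventually (\<lambda>x. (inverse x) ^ i / exp (inverse x) = exp_flat i x) (at_right 0)"
    by (rule eventually_at_rightI[of 0 1])
      (auto simp: exp_flat_def exp_minus field_simps)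
  ultimately have "(exp_flat i \<longlongrightarrow> 0) (at_right 0)"
    by (rule Lim_transform_eventually)
  moreover have "(exp_flat i \<longlongrightarrow> 0) (at_left 0)"
    by (rule tendsto_eventually, rule eventually_at_leftI[of "-1"]) (auto simp: exp_flat_def)
  ultimately show ?thesis by (simp add: filterlim_at_split)
qed

lemma exp_flat_deriv:
  "(exp_flat i has_real_derivative exp_flat (i + 2) x - real i * exp_flat (i + 1) x) (at x)"
proof (cases x "0::real" rule: linorder_cases)
  case less
  have "eventually (\<lambda>y. exp_flat i y = 0) (nhds x)"
    using eventually_nhds_in_open[of "{..<0}" x] less by (auto elim!: eventually_mono simp: exp_flat_def)
  then show ?thesis
    using less by (subst DERIV_cong_ev[OF refl _ refl, of _ "\<lambda>_. 0"]) (auto simp: exp_flat_def)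
next
  case equal
  \<comment> \<open>At 0 the difference quotient of \<open>exp_flat i\<close> is
    \<open>exp_flat (Suc i)\<close> itself, so differentiability there reduces to the limit already
    computed.\<close>
  have "((\<lambda>y. (exp_flat i y - exp_flat i 0) / (y - 0)) \<longlongrightarrow> 0) (at 0)"
  proof (rule Lim_transform_eventually[OF exp_flat_tendsto_0[of "Suc i"]])
    show "\<forall>\<^sub>F y in at 0. exp_flat (Suc i) y = (exp_flat i y - exp_flat i 0) / (y - 0)"
      by (auto simp: eventually_at_filter exp_flat_def)
  qed
  then show ?thesis using equal by (auto simp: has_field_derivative_iff exp_flat_def)
next
  case greater
  have ev: "eventually (\<lambda>y. exp_flat i y = exp (- 1 / y) / y ^ i) (nhds x)"
    using eventually_nhds_in_open[of "{0<..}" x] greater by (auto elim!: eventually_mono simp: exp_flat_def)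
  have "((\<lambda>y. exp (- 1 / y) / y ^ i) has_real_derivative
      exp_flat (i + 2) x - real i * exp_flat (i + 1) x) (at x)"
    using greater
    apply (auto intro!: derivative_eq_intros simp: exp_flat_def)
    apply (cases i)
     apply (auto simp: field_simps power2_eq_square)
    done
  then show ?thesis by (subst DERIV_cong_ev[OF refl ev refl])
qed

text \<open>A class of functions stable under differentiation, so that the differentiability of all
  iterates \<open>deriv ^^ n\<close> demanded by \<open>test_function\<close> follows by induction
  on \<open>n\<close>.\<close>

inductive_set bumps :: "real \<Rightarrow> real \<Rightarrow> (real \<Rightarrow> real) set" for p q where
  prod: "(\<lambda>x. exp_flat i (x - p) * exp_flat j (q - x)) \<in> bumps p q"
| add: "f \<in> bumps p q \<Longrightarrow> g \<in> bumps p q \<Longrightarrow> (\<lambda>x. f x + g x) \<in> bumps p q"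
| scale: "f \<in> bumps p q \<Longrightarrow> (\<lambda>x. r * f x) \<in> bumps p q"

lemma bumps_deriv:
  "f \<in> bumps p q \<Longrightarrow> \<exists>f'\<in>bumps p q. \<forall>x. (f has_real_derivative f' x) (at x)"
proof (induction rule: bumps.induct)
  case (prod i j)
  let ?e = "\<lambda>k l x. exp_flat k (x - p) * exp_flat l (q - x)"
  let ?f = "\<lambda>x. (?e (i + 2) j x + (- real i) * ?e (i + 1) j x) +
      ((-1) * ?e i (j + 2) x + real j * ?e i (j + 1) x)"
  have "?f \<in> bumps p q" by (intro bumps.intros)
  moreover have "((\<lambda>x. ?e i j x) has_real_derivative ?f x) (at x)" for x
  proof -
    have d1: "((\<lambda>x. x - p) has_real_derivative 1) (at x)" and d2: "((\<lambda>x. q - x) has_real_derivative -1) (at x)"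
      by (auto intro!: derivative_eq_intros)
    have 1: "((\<lambda>x. exp_flat i (x - p)) has_real_derivative
        exp_flat (i + 2) (x - p) - real i * exp_flat (i + 1) (x - p)) (at x)"
      using DERIV_chain2[OF exp_flat_deriv d1] by simp
    have 2: "((\<lambda>x. exp_flat j (q - x)) has_real_derivative
        - (exp_flat (j + 2) (q - x) - real j * exp_flat (j + 1) (q - x))) (at x)"
      using DERIV_chain2[OF exp_flat_deriv d2] by simp
    show ?thesis by (rule DERIV_cong[OF DERIV_mult[OF 1 2]]) (simp add: algebra_simps)
  qed
  ultimately show ?case by (intro bexI[of _ ?f] allI)
next
  case (add f g)
  then obtain f' g' where fg: "f' \<in> bumps p q" "\<And>x. (f has_real_derivative f' x) (at x)"
    "g' \<in> bumps p q" "\<And>x. (g has_real_derivative g' x) (at x)" by blast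
  show ?case
    by (rule bexI[of _ "\<lambda>x. f' x + g' x"]) (auto intro!: DERIV_add bumps.add fg)
next
  case (scale f r)
  then obtain f' where f: "f' \<in> bumps p q" "\<And>x. (f has_real_derivative f' x) (at x)" by blast
  show ?case
    by (rule bexI[of _ "\<lambda>x. r * f' x"]) (auto intro!: DERIV_cmult bumps.scale f)
qed

lemma bumps_deriv_funpow: "f \<in> bumps p q \<Longrightarrow> (deriv ^^ n) f \<in> bumps p q"
proof (induction n)
  case (Suc n)
  then obtain f' where "f' \<in> bumps p q" "\<forall>x. ((deriv ^^ n) f has_real_derivative f' x) (at x)"
    using bumps_deriv by blast
  then show ?case using DERIV_imp_deriv by (metis (no_types) ext funpow.simps(2) o_apply)
qed auto

lemma bumps_differentiable: "f \<in> bumps p q \<Longrightarrow> (deriv ^^ n) f differentiable (at t)"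
  using bumps_deriv[OF bumps_deriv_funpow] real_differentiable_def by metis

text \<open>\<open>G\<close> is a smooth ramp from 0 to 1 on the interval from \<open>p\<close> to
  \<open>q\<close>, and its derivative \<open>\<eta>\<close> is a mollifier of mass 1 supported
  there.\<close>

definition step_on :: "real \<Rightarrow> real \<Rightarrow> (real \<Rightarrow> real) \<Rightarrow> (real \<Rightarrow> real) \<Rightarrow> bool" where
  "step_on p q G \<eta> \<longleftrightarrow> (\<forall>x. (G has_real_derivative \<eta> x) (at x)) \<and> (\<forall>x. 0 \<le> \<eta> x) \<and>
     (\<forall>x\<le>p. \<eta> x = 0) \<and> (\<forall>x\<ge>q. \<eta> x = 0) \<and> \<eta> \<in> bumps p q \<and>
     (\<forall>x\<le>p. G x = 0) \<and> (\<forall>x\<ge>q. G x = 1) \<and>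
     (\<forall>x. 0 \<le> G x) \<and> (\<forall>x. G x \<le> 1) \<and> continuous_on UNIV \<eta>"

lemma step_onD:
  assumes "step_on p q G \<eta>"
  shows "(G has_real_derivative \<eta> x) (at x)" "0 \<le> \<eta> x" "x \<le> p \<Longrightarrow> \<eta> x = 0" "q \<le> x \<Longrightarrow> \<eta> x = 0"
    "\<eta> \<in> bumps p q" "x \<le> p \<Longrightarrow> G x = 0" "q \<le> x \<Longrightarrow> G x = 1" "0 \<le> G x" "G x \<le> 1" "continuous_on UNIV \<eta>"
  using assms by (auto simp: step_on_def)

lemma smooth_step:
  assumes "p < (q::real)"
  shows "\<exists>G \<eta>. step_on p q G \<eta>"
proof -
  define h where "h x = exp_flat 0 (x - p) * exp_flat 0 (q - x)" for x
  have hb: "h \<in> bumps p q" unfolding h_def by (rule bumps.prod)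
  have hc: "isCont h x" for x using bumps_deriv[OF hb] DERIV_isCont by blast
  obtain F where F: "\<And>x. (F has_real_derivative h x) (at x)"
    using einterval_antiderivative[of "-\<infinity>" "\<infinity>" h] hc
    by (auto simp: has_real_derivative_iff_has_vector_derivative)
  have Fc: "continuous_on S F" for S
    using F DERIV_isCont continuous_at_imp_continuous_on by blast
  have h0: "0 \<le> h x" for x by (auto simp: h_def exp_flat_def)
  have hp: "0 < h x" if "p < x" "x < q" for x using that by (auto simp: h_def exp_flat_def)
  have hz: "h x = 0" if "x \<le> p \<or> q \<le> x" for x using that by (auto simp: h_def exp_flat_def)
  have mono: "F x \<le> F y" if "x \<le> y" for x y
    by (rule DERIV_nonneg_imp_nondecreasing[OF that]) (use F h0 in blast)
  have lt: "F p < F q"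
    by (rule DERIV_pos_imp_increasing_open[OF assms]) (use F hp Fc in blast)+
  have cl: "F x = F p" if "x \<le> p" for x
  proof (cases "x = p")
    case False
    then have "x < p" using that by simp
    then show ?thesis
      using DERIV_isconst_end[of x p F, OF _ Fc] F hz by (metis less_imp_le)
  qed auto
  have cr: "F x = F q" if "q \<le> x" for x
  proof (cases "x = q")
    case False
    then have "q < x" using that by simp
    then show ?thesis
      using DERIV_isconst_end[of q x F, OF _ Fc] F hz by (metis less_imp_le)
  qed auto
  define G where "G x = (F x - F p) / (F q - F p)" for x
  define e where "e x = 1 / (F q - F p) * h x" for x
  show ?thesis
    unfolding step_on_def
  proof (rule exI[of _ G], rule exI[of _ e], intro conjI allI impI)
    show "(G has_real_derivative e x) (at x)" for x
      unfolding G_def e_def using lt by (auto intro!: derivative_eq_intros F)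
    show "e \<in> bumps p q" unfolding e_def by (intro bumps.scale hb)
    show "continuous_on UNIV e" unfolding e_def
      by (intro continuous_intros continuous_at_imp_continuous_on ballI hc)
    have "F p \<le> F x" "F x \<le> F q" for x
      using mono[of p x] mono[of x q] cl[of x] cr[of x] assms lt by (metis le_cases less_imp_le order_refl)+
    then show "0 \<le> G x" "G x \<le> 1" for x
      using lt by (simp_all add: G_def divide_simps)
    show "0 \<le> e x" for x using lt h0[of x] by (simp add: e_def)
    show "e x = 0" if "x \<le> p" for x using hz that by (simp add: e_def)
    show "e x = 0" if "q \<le> x" for x using hz that by (simp add: e_def)
    show "G x = 0" if "x \<le> p" for x using cl[OF that] by (simp add: G_def)
    show "G x = 1" if "q \<le> x" for x using cr[OF that] lt by (simp add: G_def)
  qed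
qed

text \<open>The difference of an early and a late ramp is a plateau of height 1 with compact support
  in the open unit interval, an approximate indicator that is admissible as a test function.\<close>

lemma test_function_step_diff:
  assumes G': "step_on p q G \<eta>" and H': "step_on r s H \<theta>"
    and ord: "0 < p" "p < q" "q < r" "r < s" "s < 1"
  shows "test_function (\<lambda>x. G x - H x)" "deriv (\<lambda>x. G x - H x) = (\<lambda>x. \<eta> x - \<theta> x)"
proof -
  note G = step_onD[OF G'] and H = step_onD[OF H']
  have D: "((\<lambda>x. G x - H x) has_real_derivative \<eta> x - \<theta> x) (at x)" for x
    by (intro derivative_intros G H)
  show 1: "deriv (\<lambda>x. G x - H x) = (\<lambda>x. \<eta> x - \<theta> x)"
    using D DERIV_imp_deriv by blast
  have 2: "(deriv ^^ n) (\<lambda>x. \<eta> x - \<theta> x) = (\<lambda>x. (deriv ^^ n) \<eta> x - (deriv ^^ n) \<theta> x)" for n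
  proof (induction n)
    case (Suc n)
    have "deriv (\<lambda>x. (deriv ^^ n) \<eta> x - (deriv ^^ n) \<theta> x) = (\<lambda>x. deriv ((deriv ^^ n) \<eta>) x - deriv ((deriv ^^ n) \<theta>) x)"
    proof
      fix x
      have "(deriv ^^ n) \<eta> field_differentiable at x" "(deriv ^^ n) \<theta> field_differentiable at x"
        using bumps_deriv[OF bumps_deriv_funpow[OF G(5)]] bumps_deriv[OF bumps_deriv_funpow[OF H(5)]]
        unfolding field_differentiable_def by blast+
      then show "deriv (\<lambda>x. (deriv ^^ n) \<eta> x - (deriv ^^ n) \<theta> x) x = deriv ((deriv ^^ n) \<eta>) x - deriv ((deriv ^^ n) \<theta>) x"
        by (rule deriv_diff)
    qed
    then show ?case by (simp add: Suc)
  qed auto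
  have sm: "(deriv ^^ n) (\<lambda>x. G x - H x) differentiable (at t)" for n t
  proof (cases n)
    case 0
    then show ?thesis using D real_differentiable_def by (metis eq_id_iff funpow_0)
  next
    case (Suc m)
    have "(deriv ^^ n) (\<lambda>x. G x - H x) = (\<lambda>x. (deriv ^^ m) \<eta> x - (deriv ^^ m) \<theta> x)"
      unfolding Suc funpow_Suc_right o_def 1 2 ..
    then show ?thesis
      using bumps_differentiable[OF G(5)] bumps_differentiable[OF H(5)] by (auto intro!: differentiable_diff)
  qed
  have "G x - H x = 0" if "x \<notin> {p..s}" for x
    using that ord G(6,7)[of x] H(6,7)[of x] by (cases "x < p") auto
  then show "test_function (\<lambda>x. G x - H x)"
    unfolding test_function_def using sm ord by (auto intro!: exI[of _ "{p..s}"])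
qed

section \<open>Square-integrable derivatives\<close>

text \<open>Extension by zero fixes a representative that is Borel on the whole line, so set
  integrals over the unit interval become plain integrals and intervals can be cut without domain
  conditions.\<close>

definition L2_zero :: "(real \<Rightarrow> 'h::{real_inner,banach,second_countable_topology}) \<Rightarrow> bool" where
  "L2_zero w \<longleftrightarrow> w \<in> borel_measurable borel \<and> (\<forall>r. r \<notin> {0<..<1} \<longrightarrow> w r = 0) \<and>
     integrable lborel (\<lambda>r. (norm (w r))\<^sup>2)"

definition primitive :: "(real \<Rightarrow> 'h::{real_inner,banach,second_countable_topology}) \<Rightarrow> (real \<Rightarrow> 'h) \<Rightarrow> bool" where
  "primitive u w \<longleftrightarrow> (\<forall>s t. 0 \<le> s \<longrightarrow> s \<le> t \<longrightarrow> t \<le> 1 \<longrightarrow>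
     u t - u s = (\<integral>r. indicator {s<..<t} r *\<^sub>R w r \<partial>lborel))"

lemma L2_zero_of_L2_path:
  assumes "L2_path v"
  shows "L2_zero (\<lambda>r. indicator {0<..<1} r *\<^sub>R v r)"
proof -
  have "(\<lambda>r. (norm (indicator {0<..<1} r *\<^sub>R v r))\<^sup>2) = (\<lambda>r. indicator {0<..<1} r *\<^sub>R (norm (v r))\<^sup>2)"
    by (auto simp: indicator_def)
  then show ?thesis
    using assms unfolding L2_path_def L2_zero_def set_borel_measurable_def set_integrable_def by auto
qed

lemma L2_path_of_L2_zero:
  assumes "L2_zero w"
  shows "L2_path w"
proof -
  have "(\<lambda>r. indicator {0<..<1} r *\<^sub>R w r) = w" "(\<lambda>r. indicator {0<..<1} r *\<^sub>R (norm (w r))\<^sup>2) = (\<lambda>r. (norm (w r))\<^sup>2)"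
    using assms by (auto simp: L2_zero_def indicator_def fun_eq_iff)
  then show ?thesis
    using assms unfolding L2_path_def L2_zero_def set_borel_measurable_def set_integrable_def by auto
qed

lemma L2_zero_integrable:
  assumes "L2_zero w"
  shows "integrable lborel w"
proof (rule Bochner_Integration.integrable_bound)
  show "integrable lborel (\<lambda>r. indicator {0..1::real} r + (norm (w r))\<^sup>2)"
    using assms by (auto simp: L2_zero_def)
  show "w \<in> borel_measurable lborel" using assms by (auto simp: L2_zero_def)
  have "norm (w r) \<le> indicator {0..1} r + (norm (w r))\<^sup>2" for r
  proof (cases "r \<in> {0<..<1}")
    case True
    have "0 \<le> (norm (w r) - 1)\<^sup>2 + (norm (w r))\<^sup>2 + 1" by simp
    then show ?thesis using True by (simp add: power2_eq_square algebra_simps)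
  qed (use assms in \<open>auto simp: L2_zero_def\<close>)
  then show "AE x in lborel. norm (w x) \<le> norm (indicator {0..1} x + (norm (w x))\<^sup>2)"
    by (simp add: abs_of_nonneg)
qed

lemma L2_zero_measurable [measurable_dest]: "L2_zero w \<Longrightarrow> w \<in> borel_measurable borel"
  by (simp add: L2_zero_def)

text \<open>Expand the nonnegative integral of \<open>(norm (w r) - m)\<^sup>2\<close>, where
  \<open>m\<close> is the mean of the norm over the interval.\<close>

lemma Cauchy_Schwarz_interval:
  assumes w: "L2_zero w" and st: "s \<le> t"
  shows "(\<integral>r. indicator {s<..<t} r * norm (w r) \<partial>lborel)\<^sup>2
      \<le> (t - s) * (\<integral>r. indicator {s<..<t} r * (norm (w r))\<^sup>2 \<partial>lborel)"
proof (cases "s = t")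
  case False
  then have st: "s < t" using st by simp
  define I where "I = (\<integral>r. indicator {s<..<t} r * norm (w r) \<partial>lborel)"
  define V where "V = (\<integral>r. indicator {s<..<t} r * (norm (w r))\<^sup>2 \<partial>lborel)"
  define m where "m = I / (t - s)"
  have mI: "m * (t - s) = I" using st by (simp add: m_def)
  have i1: "integrable lborel (\<lambda>r. indicator {s<..<t} r * norm (w r))"
    using integrable_mult_indicator[of "{s<..<t}" lborel "\<lambda>r. norm (w r)"] L2_zero_integrable[OF w] by auto
  have i2: "integrable lborel (\<lambda>r. indicator {s<..<t} r * (norm (w r))\<^sup>2)"
    using integrable_mult_indicator[of "{s<..<t}" lborel "\<lambda>r. (norm (w r))\<^sup>2"] w by (auto simp: L2_zero_def)
  have i3: "integrable lborel (indicat_real {s<..<t})"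
    using st by (intro integrable_real_indicator) auto
  have "0 \<le> (\<integral>r. indicator {s<..<t} r * (norm (w r) - m)\<^sup>2 \<partial>lborel)" by (rule integral_nonneg_AE) auto
  also have "(\<lambda>r. indicator {s<..<t} r * (norm (w r) - m)\<^sup>2) =
      (\<lambda>r. indicator {s<..<t} r * (norm (w r))\<^sup>2 - (2 * m) * (indicator {s<..<t} r * norm (w r)) + m\<^sup>2 * indicator {s<..<t} r)"
    by (auto simp: fun_eq_iff power2_eq_square algebra_simps)
  also have "(\<integral>r. \<dots> r \<partial>lborel) = V - 2 * m * I + m\<^sup>2 * (t - s)"
    using i1 i2 i3 st by (simp add: V_def I_def)
  also have "V - 2 * m * I + m\<^sup>2 * (t - s) = V - m * I"
    unfolding mI[symmetric] by (simp add: power2_eq_square algebra_simps)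
  finally have "(m * I) * (t - s) \<le> V * (t - s)" using st by (intro mult_right_mono) auto
  moreover have "(m * I) * (t - s) = I\<^sup>2" using mI by (simp add: power2_eq_square mult.commute mult.left_commute)
  ultimately have "I\<^sup>2 \<le> (t - s) * V" by (simp add: mult.commute)
  then show ?thesis unfolding I_def V_def .
qed simp

text \<open>Open intervals are stable under intersection and generate the Borel sets, so Dynkin's
  theorem extends the vanishing of the integral to all Borel sets, which forces \<open>w = 0\<close>
  almost everywhere.\<close>

lemma AE_zero_of_interval_integrals:
  fixes w :: "real \<Rightarrow> 'h::{real_inner,banach,second_countable_topology}"
  assumes w: "integrable lborel w"
    and z: "\<And>s t. s < t \<Longrightarrow> (\<integral>r. indicator {s<..<t} r *\<^sub>R w r \<partial>lborel) = 0"
  shows "AE r in lborel. w r = 0"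
proof (rule sigma_finite_measure.density_zero[OF sigma_finite_lborel w])
  fix A :: "real set" assume "A \<in> sets lborel"
  have sb: "sets (borel :: real measure) = sigma_sets UNIV (range (\<lambda>(a::real, b). {a<..<b}))"
  proof -
    have "(\<lambda>(a::real, b). box a b) = (\<lambda>(a, b). {a<..<b})" by (auto simp: fun_eq_iff)
    moreover have "sets (borel :: real measure) = sigma_sets UNIV (range (\<lambda>(a::real, b). box a b))"
      by (subst borel_eq_box) (rule sets_measure_of, simp)
    ultimately show ?thesis by argo
  qed
  from \<open>A \<in> sets lborel\<close> have A: "A \<in> sigma_sets UNIV (range (\<lambda>(a::real, b). {a<..<b}))"
    by (simp add: sb)
  have meas: "B \<in> sets borel" if "B \<in> sigma_sets UNIV (range (\<lambda>(a::real, b). {a<..<b}))" for B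
    using that by (simp add: sb)
  have istab: "Int_stable (range (\<lambda>(a::real, b). {a<..<b}))"
    unfolding Int_stable_def
  proof clarify
    fix a b c d :: real
    show "{a<..<b} \<inter> {c<..<d} \<in> range (\<lambda>(a, b). {a<..<b})"
      by (rule range_eqI[of _ _ "(max a c, min b d)"]) auto
  qed
  have int: "integrable lborel (\<lambda>r. indicator B r *\<^sub>R w r)" if "B \<in> sets borel" for B
    using integrable_mult_indicator[of B lborel w] that w by auto
  \<comment> \<open>The whole line is a limit of intervals; this value is what the complement case
    of the induction needs.\<close>
  have tot: "(\<integral>r. w r \<partial>lborel) = 0"
  proof -
    have "(\<lambda>n. \<integral>r. indicator {- real n<..<real n} r *\<^sub>R w r \<partial>lborel) \<longlonglongrightarrow> (\<integral>r. w r \<partial>lborel)"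
    proof (rule integral_dominated_convergence[of _ _ _ "\<lambda>r. norm (w r)"])
      show "AE r in lborel. (\<lambda>n. indicator {- real n<..<real n} r *\<^sub>R w r) \<longlonglongrightarrow> w r"
      proof (rule AE_I2, rule tendsto_eventually)
        fix r :: real
        obtain N where "\<bar>r\<bar> < real N" using reals_Archimedean2 by blast
        then have "indicator {- real n<..<real n} r *\<^sub>R w r = w r" if "n \<ge> N" for n
          using that by (auto simp: indicator_def)
        then show "\<forall>\<^sub>F n in sequentially. indicator {- real n<..<real n} r *\<^sub>R w r = w r"
          by (auto simp: eventually_sequentially)
      qed
    qed (use w in \<open>auto simp: indicator_def\<close>)
    moreover have "(\<integral>r. indicator {- real n<..<real n} r *\<^sub>R w r \<partial>lborel) = 0" for n
      using z[of "- real n" "real n"] by (cases "n = 0") auto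
    ultimately show ?thesis by (simp add: LIMSEQ_const_iff)
  qed
  show "set_lebesgue_integral lborel A w = 0"
    using istab subset_UNIV[of "range (\<lambda>(a::real, b). {a<..<b})", folded Pow_UNIV] A unfolding set_lebesgue_integral_def
  proof (induction rule: sigma_sets_induct_disjoint)
    case (basic A)
    then obtain a b where "A = {a<..<b}" by auto
    then show ?case using z[of a b] by (cases "a < b") auto
  next
    case (compl A)
    have "(\<lambda>r. indicator (UNIV - A) r *\<^sub>R w r) = (\<lambda>r. w r - indicator A r *\<^sub>R w r)"
      by (auto simp: fun_eq_iff indicator_def)
    then show ?case using compl int[OF meas] w tot by simp
  next
    case (union A)
    have "(LINT r:(\<Union>i. A i)|lborel. w r) = (\<Sum>i. (LINT r:(A i)|lborel. w r))"
    proof (rule lebesgue_integral_countable_add)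
      show "A i \<in> sets lborel" for i using union(2) meas by auto
      show "i \<noteq> j \<Longrightarrow> A i \<inter> A j = {}" for i j using union(1) by (auto simp: disjoint_family_on_def)
      show "set_integrable lborel (\<Union>i. A i) w"
        unfolding set_integrable_def by (rule int) (use union(2) meas in auto)
    qed
    then show ?case using union(3) by (simp add: set_lebesgue_integral_def)
  qed auto
qed

section \<open>From weak derivatives to integrated increments\<close>

lemma mollify:
  fixes u :: "real \<Rightarrow> 'h::{real_inner,banach,second_countable_topology}"
  assumes step: "step_on p q G \<eta>"
    and pq: "0 \<le> p" "p < q" "q \<le> 1"
    and u: "continuous_on {0..1} u" and e: "\<And>r. r \<in> {p..q} \<Longrightarrow> norm (u r - z) \<le> e"
  shows "norm ((LINT r:{0<..<1}|lborel. \<eta> r *\<^sub>R u r) - z) \<le> e"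
    and "integrable lborel (\<lambda>r. indicator {0<..<1} r *\<^sub>R \<eta> r *\<^sub>R u r)"
proof -
  have Gpq: "G p = 0" "G q = 1" using step by (auto simp: step_on_def)
  note G = step_onD[OF step]
  have "has_bochner_integral lborel (\<lambda>x. \<eta> x * indicator {p..q} x) (G q - G p)"
    by (rule has_bochner_integral_FTC_Icc_real) (use pq G(1) G(10)[THEN continuous_on_interior] in auto)
  moreover have "(\<lambda>x. \<eta> x * indicator {p..q} x) = \<eta>"
  proof
    show "\<eta> x * indicator {p..q} x = \<eta> x" for x
      using G(3)[of x] G(4)[of x] by (cases "x \<le> p"; cases "q \<le> x") auto
  qed
  ultimately have hb: "integrable lborel \<eta>" "integral\<^sup>L lborel \<eta> = 1"
    using Gpq by (auto simp: has_bochner_integral_iff)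
  have [measurable]: "\<eta> \<in> borel_measurable borel" using G(10) by (rule borel_measurable_continuous_onI)
  have [measurable]: "(\<lambda>r. indicator {0<..<1} r *\<^sub>R u r) \<in> borel_measurable borel"
    by (rule borel_measurable_continuous_on_indicator) (auto intro: continuous_on_subset[OF u])
  have eq: "indicator {0<..<1} r *\<^sub>R \<eta> r *\<^sub>R u r = \<eta> r *\<^sub>R (indicator {0<..<1} r *\<^sub>R u r)" for r
    by (auto simp: indicator_def)
  have ptw: "norm (\<eta> r *\<^sub>R (indicator {0<..<1} r *\<^sub>R u r) - \<eta> r *\<^sub>R z) \<le> e * \<eta> r" for r
  proof (cases "p < r \<and> r < q")
    case True
    then have "norm (\<eta> r *\<^sub>R (indicator {0<..<1} r *\<^sub>R u r) - \<eta> r *\<^sub>R z) = \<eta> r * norm (u r - z)"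
      using pq G(2)[of r] by (simp add: scaleR_diff_right[symmetric])
    then show ?thesis using mult_left_mono[OF e[of r] G(2)[of r]] True by (simp add: mult.commute[of e])
  next
    case False
    then have "\<eta> r = 0" using G(3,4) by (cases "p < r") auto
    then show ?thesis by simp
  qed
  have i2: "integrable lborel (\<lambda>r. \<eta> r *\<^sub>R (indicator {0<..<1} r *\<^sub>R u r) - \<eta> r *\<^sub>R z)"
  proof (rule Bochner_Integration.integrable_bound)
    show "integrable lborel (\<lambda>r. e * \<eta> r)" using hb by auto
    show "AE r in lborel. norm (\<eta> r *\<^sub>R (indicator {0<..<1} r *\<^sub>R u r) - \<eta> r *\<^sub>R z) \<le> norm (e * \<eta> r)"
      by (intro AE_I2 order_trans[OF ptw]) (simp only: real_norm_def abs_ge_self)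
  qed measurable
  have i3: "integrable lborel (\<lambda>r. \<eta> r *\<^sub>R z)" using hb by auto
  from Bochner_Integration.integrable_add[OF i2 i3]
  have i1: "integrable lborel (\<lambda>r. \<eta> r *\<^sub>R (indicator {0<..<1} r *\<^sub>R u r))" by simp
  then show "integrable lborel (\<lambda>r. indicator {0<..<1} r *\<^sub>R \<eta> r *\<^sub>R u r)" unfolding eq .
  have "(LINT r:{0<..<1}|lborel. \<eta> r *\<^sub>R u r) - z =
      (\<integral>r. \<eta> r *\<^sub>R (indicator {0<..<1} r *\<^sub>R u r) - \<eta> r *\<^sub>R z \<partial>lborel)"
    unfolding set_lebesgue_integral_def eq Bochner_Integration.integral_diff[OF i1 i3] using hb by simp
  also have "norm \<dots> \<le> (\<integral>r. e * \<eta> r \<partial>lborel)"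
    by (rule Bochner_Integration.integral_norm_bound_integral[OF i2]) (use hb ptw in auto)
  also have "\<dots> = e" using hb by simp
  finally show "norm ((LINT r:{0<..<1}|lborel. \<eta> r *\<^sub>R u r) - z) \<le> e" .
qed

text \<open>Test with plateaus that tend to the indicator of the interval from \<open>s\<close> to
  \<open>t\<close>. Their derivatives are a mollifier near \<open>s\<close> minus one near
  \<open>t\<close>, so by \<open>mollify\<close> the left-hand side tends to
  \<open>u s - u t\<close>. The ramps lie strictly inside the interval, so that the support stays in
  the open unit interval even for \<open>s = 0\<close> or \<open>t = 1\<close>.\<close>

lemma primitive_of_weak_deriv:
  fixes u :: "real \<Rightarrow> 'h::{real_inner,banach,second_countable_topology}"
  assumes w: "L2_zero w"
    and wd: "\<And>\<phi>. test_function \<phi> \<Longrightarrow>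
      (LINT t:{0<..<1}|lborel. deriv \<phi> t *\<^sub>R u t) = - (\<integral>t. \<phi> t *\<^sub>R w t \<partial>lborel)"
    and u: "continuous_on {0..1} u"
  shows "primitive u w"
  unfolding primitive_def
proof (intro allI impI)
  fix s t :: real assume st: "0 \<le> s" "s \<le> t" "t \<le> 1"
  show "u t - u s = (\<integral>r. indicator {s<..<t} r *\<^sub>R w r \<partial>lborel)"
  proof (cases "s = t")
    case False
    then have lt: "s < t" using st by simp
    \<comment> \<open>The summand 5 ensures \<open>4 * d n < t - s\<close> already for
      \<open>n = 0\<close>, which keeps the two ramps disjoint.\<close>
    define d where "d n = (t - s) / (real n + 5)" for n
    have d: "0 < d n" "4 * d n < t - s" for n
    proof -
      show "0 < d n" using lt by (simp add: d_def)
      have "(t - s) * (4 / (real n + 5)) < (t - s) * 1"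
        using lt by (intro mult_strict_left_mono) auto
      then show "4 * d n < t - s" by (simp add: d_def mult.commute)
    qed
    have dlim: "d \<longlonglongrightarrow> 0"
      using LIMSEQ_ignore_initial_segment[OF lim_const_over_n[of "t - s"], of 5] by (simp add: d_def[abs_def])
    have "\<forall>n. \<exists>G \<eta>. step_on (s + d n) (s + 2 * d n) G \<eta>"
    proof
      fix n
      have "s + d n < s + 2 * d n" using d(1)[of n] by linarith
      then show "\<exists>G \<eta>. step_on (s + d n) (s + 2 * d n) G \<eta>" by (rule smooth_step)
    qed
    then obtain G \<eta> where G': "\<And>n. step_on (s + d n) (s + 2 * d n) (G n) (\<eta> n)" by metis
    note G = step_onD[OF G']
    have "\<forall>n. \<exists>H \<theta>. step_on (t - 2 * d n) (t - d n) H \<theta>"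
    proof
      fix n
      have "t - 2 * d n < t - d n" using d(1)[of n] by linarith
      then show "\<exists>H \<theta>. step_on (t - 2 * d n) (t - d n) H \<theta>" by (rule smooth_step)
    qed
    then obtain H \<theta> where H': "\<And>n. step_on (t - 2 * d n) (t - d n) (H n) (\<theta> n)" by metis
    note H = step_onD[OF H']
    define \<phi> where "\<phi> n x = G n x - H n x" for n x
    have tf: "test_function (\<phi> n)" "deriv (\<phi> n) = (\<lambda>x. \<eta> n x - \<theta> n x)" for n
    proof -
      have ord: "0 < s + d n" "s + d n < s + 2 * d n" "s + 2 * d n < t - 2 * d n" "t - 2 * d n < t - d n" "t - d n < 1"
        using st d[of n] by linarith+
      note T = test_function_step_diff[OF G'[of n] H'[of n] ord]
      show "test_function (\<phi> n)" "deriv (\<phi> n) = (\<lambda>x. \<eta> n x - \<theta> n x)"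
        using T by (auto simp: \<phi>_def[abs_def])
    qed
    have Gm: "G n \<in> borel_measurable borel" "H n \<in> borel_measurable borel" for n
      using DERIV_isCont[OF G(1)] DERIV_isCont[OF H(1)]
      by (auto intro!: borel_measurable_continuous_onI continuous_at_imp_continuous_on)
    have lim1: "(\<lambda>n. \<integral>r. \<phi> n r *\<^sub>R w r \<partial>lborel) \<longlonglongrightarrow> (\<integral>r. indicator {s<..<t} r *\<^sub>R w r \<partial>lborel)"
    proof (rule integral_dominated_convergence[of _ _ _ "\<lambda>r. norm (w r)"])
      show "integrable lborel (\<lambda>r. norm (w r))" using L2_zero_integrable[OF w] by auto
      show "AE r in lborel. norm (\<phi> n r *\<^sub>R w r) \<le> norm (w r)" for n
      proof (rule AE_I2)
        fix r
        have "\<bar>\<phi> n r\<bar> \<le> 1" using G(8,9)[of n r] H(8,9)[of n r] by (auto simp: \<phi>_def)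
        then show "norm (\<phi> n r *\<^sub>R w r) \<le> norm (w r)" by (simp add: mult_left_le_one_le)
      qed
      show "AE r in lborel. (\<lambda>n. \<phi> n r *\<^sub>R w r) \<longlonglongrightarrow> indicator {s<..<t} r *\<^sub>R w r"
      proof (rule AE_I2, rule tendsto_eventually)
        fix r :: real
        show "\<forall>\<^sub>F n in sequentially. \<phi> n r *\<^sub>R w r = indicator {s<..<t} r *\<^sub>R w r"
        proof (cases "r \<in> {s<..<t}")
          case True
          then have "0 < min (r - s) (t - r) / 2" by auto
          from order_tendstoD(2)[OF dlim this]
          show ?thesis
          proof eventually_elim
            case (elim n)
            then have "s + 2 * d n \<le> r" "r \<le> t - 2 * d n" by auto
            then show ?case using G(7)[of n r] H(6)[of r n] True by (simp add: \<phi>_def)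
          qed
        next
          case False
          have "\<phi> n r = 0" for n
          proof (cases "r \<le> s")
            case True
            then have "r \<le> s + d n" "r \<le> t - 2 * d n" using d[of n] by linarith+
            then show ?thesis using G(6)[of r n] H(6)[of r n] by (simp add: \<phi>_def)
          next
            case False
            then have "t \<le> r" using \<open>r \<notin> {s<..<t}\<close> by auto
            then have "s + 2 * d n \<le> r" "t - d n \<le> r" using d[of n] by linarith+
            then show ?thesis using G(7)[of n r] H(7)[of n r] by (simp add: \<phi>_def)
          qed
          then show ?thesis using False by (auto simp: indicator_def)
        qed
      qed
    next
      have [measurable]: "w \<in> borel_measurable borel" by (rule L2_zero_measurable[OF w])
      note [measurable] = Gm
      show "(\<lambda>r. \<phi> n r *\<^sub>R w r) \<in> borel_measurable lborel" for n unfolding \<phi>_def by measurable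
      show "(\<lambda>r. indicator {s<..<t} r *\<^sub>R w r) \<in> borel_measurable lborel" by measurable
    qed
    have lim2: "(\<lambda>n. \<integral>r. \<phi> n r *\<^sub>R w r \<partial>lborel) \<longlonglongrightarrow> u t - u s"
    proof (rule tendstoI)
      fix e :: real assume e: "0 < e"
      define e' where "e' = e / 3"
      have e': "0 < e'" using e by (simp add: e'_def)
      obtain d1 where d1: "d1 > 0" "\<And>r. r \<in> {0..1} \<Longrightarrow> dist r s < d1 \<Longrightarrow> dist (u r) (u s) < e'"
        using u st e' unfolding continuous_on_iff by (metis atLeastAtMost_iff order_trans)
      obtain d2 where d2: "d2 > 0" "\<And>r. r \<in> {0..1} \<Longrightarrow> dist r t < d2 \<Longrightarrow> dist (u r) (u t) < e'"
        using u st e' unfolding continuous_on_iff by (metis atLeastAtMost_iff order_trans)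
      have "0 < min d1 d2 / 2" using d1 d2 by auto
      from order_tendstoD(2)[OF dlim this]
      show "\<forall>\<^sub>F n in sequentially. dist (\<integral>r. \<phi> n r *\<^sub>R w r \<partial>lborel) (u t - u s) < e"
      proof eventually_elim
        case (elim n)
        have n1: "norm (u r - u s) \<le> e'" if "r \<in> {s + d n..s + 2 * d n}" for r
        proof -
          have "r \<in> {0..1}" "dist r s < d1" using that st d[of n] elim by (auto simp: dist_real_def)
          from d1(2)[OF this] show ?thesis by (simp add: dist_norm)
        qed
        have n2: "norm (u r - u t) \<le> e'" if "r \<in> {t - 2 * d n..t - d n}" for r
        proof -
          have "r \<in> {0..1}" "dist r t < d2" using that st d[of n] elim by (auto simp: dist_real_def)
          from d2(2)[OF this] show ?thesis by (simp add: dist_norm)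
        qed
        have o1: "0 \<le> s + d n" "s + d n < s + 2 * d n" "s + 2 * d n \<le> 1"
          and o2: "0 \<le> t - 2 * d n" "t - 2 * d n < t - d n" "t - d n \<le> 1"
          using st d[of n] by linarith+
        note m1 = mollify[OF G'[of n] o1 u n1] and m2 = mollify[OF H'[of n] o2 u n2]
        have "(LINT r:{0<..<1}|lborel. deriv (\<phi> n) r *\<^sub>R u r) =
            (LINT r:{0<..<1}|lborel. \<eta> n r *\<^sub>R u r) - (LINT r:{0<..<1}|lborel. \<theta> n r *\<^sub>R u r)"
          unfolding tf(2) set_lebesgue_integral_def using m1(2) m2(2)
          by (simp add: scaleR_diff_left scaleR_diff_right)
        then have "(\<integral>r. \<phi> n r *\<^sub>R w r \<partial>lborel) - (u t - u s) =
            ((LINT r:{0<..<1}|lborel. \<theta> n r *\<^sub>R u r) - u t) - ((LINT r:{0<..<1}|lborel. \<eta> n r *\<^sub>R u r) - u s)"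
          using wd[OF tf(1)[of n]] by (simp add: algebra_simps)
        also have "norm \<dots> \<le> e' + e'"
          using m1(1) m2(1) by (intro norm_triangle_le_diff) auto
        also have "\<dots> < e" using e by (simp add: e'_def)
        finally show ?case by (simp add: dist_norm)
      qed
    qed
    show ?thesis using LIMSEQ_unique[OF lim2 lim1] .
  qed simp
qed

lemma integrable_interval:
  fixes f :: "real \<Rightarrow> 'b::{banach,second_countable_topology}" and g :: "real \<Rightarrow> real"
  shows "integrable lborel f \<Longrightarrow> integrable lborel (\<lambda>r. indicator {s<..<t} r *\<^sub>R f r)"
    and "integrable lborel g \<Longrightarrow> integrable lborel (\<lambda>r. indicator {s<..<t} r * g r)"
  using integrable_mult_indicator[of "{s<..<t}" lborel f] integrable_mult_indicator[of "{s<..<t}" lborel g] by simp_all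

lemma integral_interval_split:
  fixes f :: "real \<Rightarrow> 'b::{banach,second_countable_topology}"
  assumes f: "integrable lborel f" and "a \<le> b" "b \<le> c"
  shows "(\<integral>r. indicator {a<..<c} r *\<^sub>R f r \<partial>lborel) =
    (\<integral>r. indicator {a<..<b} r *\<^sub>R f r \<partial>lborel) + (\<integral>r. indicator {b<..<c} r *\<^sub>R f r \<partial>lborel)"
proof -
  have int: "integrable lborel (\<lambda>r. indicator {x<..<y} r *\<^sub>R f r)" for x y
    using integrable_mult_indicator[of "{x<..<y}" lborel f] f by auto
  have [measurable]: "f \<in> borel_measurable borel" using f by auto
  have "AE r in lborel. indicator {a<..<c} r *\<^sub>R f r =
      indicator {a<..<b} r *\<^sub>R f r + indicator {b<..<c} r *\<^sub>R f r"
    using AE_lborel_singleton[of b] by eventually_elim (use assms in \<open>auto simp: indicator_def\<close>)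
  then have "(\<integral>r. indicator {a<..<c} r *\<^sub>R f r \<partial>lborel) =
      (\<integral>r. indicator {a<..<b} r *\<^sub>R f r + indicator {b<..<c} r *\<^sub>R f r \<partial>lborel)"
    by (intro integral_cong_AE) auto
  then show ?thesis using int by simp
qed

lemma primitive_norm_le:
  assumes u: "primitive u w" and w: "L2_zero w" and st: "0 \<le> s" "s \<le> t" "t \<le> 1"
  shows "norm (u t - u s) \<le> (\<integral>r. indicator {s<..<t} r * norm (w r) \<partial>lborel)"
proof -
  have "u t - u s = (\<integral>r. indicator {s<..<t} r *\<^sub>R w r \<partial>lborel)"
    using u st by (auto simp: primitive_def)
  also have "norm \<dots> \<le> (\<integral>r. norm (indicator {s<..<t} r *\<^sub>R w r) \<partial>lborel)" by (rule integral_norm_bound)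
  finally show ?thesis by (simp add: indicator_def)
qed

lemma interval_integral_le_total:
  fixes f :: "real \<Rightarrow> real"
  assumes "integrable lborel f" "\<And>r. 0 \<le> f r"
  shows "(\<integral>r. indicator {s<..<t} r * f r \<partial>lborel) \<le> (\<integral>r. f r \<partial>lborel)"
  by (rule integral_mono[OF integrable_interval(2)[OF assms(1)] assms(1)]) (use assms(2) in \<open>simp add: indicator_def\<close>)

lemma primitive_Hoelder:
  assumes u: "primitive u w" and w: "L2_zero w" and st: "0 \<le> s" "s \<le> t" "t \<le> 1"
  shows "(norm (u t - u s))\<^sup>2 \<le> (t - s) * (\<integral>r. (norm (w r))\<^sup>2 \<partial>lborel)"
proof -
  have "(norm (u t - u s))\<^sup>2 \<le> (\<integral>r. indicator {s<..<t} r * norm (w r) \<partial>lborel)\<^sup>2"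
    by (intro power_mono primitive_norm_le u w st) auto
  also have "\<dots> \<le> (t - s) * (\<integral>r. indicator {s<..<t} r * (norm (w r))\<^sup>2 \<partial>lborel)"
    by (rule Cauchy_Schwarz_interval[OF w st(2)])
  also have "\<dots> \<le> (t - s) * (\<integral>r. (norm (w r))\<^sup>2 \<partial>lborel)"
    using w st by (intro mult_left_mono interval_integral_le_total) (auto simp: L2_zero_def)
  finally show ?thesis .
qed

lemma primitive_unique:
  assumes u: "primitive u w" "primitive u w'" and w: "L2_zero w" "L2_zero w'"
  shows "AE r in lborel. w r = w' r"
proof -
  have i: "integrable lborel w" "integrable lborel w'" using L2_zero_integrable w by auto
  have "AE r in lborel. w r - w' r = 0"
  proof (rule AE_zero_of_interval_integrals)
    show "integrable lborel (\<lambda>r. w r - w' r)" using i by auto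
    fix s t :: real assume "s < t"
    \<comment> \<open>Clamping to the unit interval loses nothing, as both functions vanish outside
      it; the order of \<open>min\<close> and \<open>max\<close> keeps \<open>s' \<le> t'\<close>
      even when the given interval misses the unit interval.\<close>
    define s' t' where "s' = min 1 (max 0 s)" and "t' = max 0 (min t 1)"
    have st: "0 \<le> s'" "s' \<le> t'" "t' \<le> 1" using \<open>s < t\<close> by (auto simp: s'_def t'_def)
    have "r \<in> {s<..<t} \<longleftrightarrow> r \<in> {s'<..<t'}" if "r \<in> {0<..<1}" for r
      using that by (auto simp: s'_def t'_def)
    then have *: "indicator {s<..<t} r *\<^sub>R (w r - w' r) = indicator {s'<..<t'} r *\<^sub>R w r - indicator {s'<..<t'} r *\<^sub>R w' r" for r
      using w by (cases "r \<in> {0<..<1}") (auto simp: L2_zero_def indicator_def)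
    have "(\<integral>r. indicator {s<..<t} r *\<^sub>R (w r - w' r) \<partial>lborel) =
        (\<integral>r. indicator {s'<..<t'} r *\<^sub>R w r \<partial>lborel) - (\<integral>r. indicator {s'<..<t'} r *\<^sub>R w' r \<partial>lborel)"
      unfolding * by (intro Bochner_Integration.integral_diff integrable_interval i)
    also have "\<dots> = 0" using u st unfolding primitive_def by (metis diff_self)
    finally show "(\<integral>r. indicator {s<..<t} r *\<^sub>R (w r - w' r) \<partial>lborel) = 0" .
  qed
  then show ?thesis by simp
qed

text \<open>On a short interval \<open>2 u - u s - u t\<close> is small, so the increment of \<open>\<parallel>u\<parallel>\<^sup>2\<close>, which is zero,
  controls the integral of \<open>inner u w\<close> up to an error quadratic in the length.\<close>

lemma unit_path_orthogonal_interval: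
  fixes u :: "real \<Rightarrow> 'h::{real_inner,banach,second_countable_topology}"
  assumes u: "primitive u w" and w: "L2_zero w" and cu: "continuous_on {0..1} u"
    and n1: "\<And>t. t \<in> {0..1} \<Longrightarrow> norm (u t) = 1" and st: "0 \<le> s" "s \<le> t" "t \<le> 1"
  shows "\<bar>\<integral>r. indicator {s<..<t} r * inner (u r) (w r) \<partial>lborel\<bar>
      \<le> (t - s) * (\<integral>r. indicator {s<..<t} r * (norm (w r))\<^sup>2 \<partial>lborel)"
    and "integrable lborel (\<lambda>r. inner (u r) (w r))"
proof -
  have [measurable]: "w \<in> borel_measurable borel" using w by (rule L2_zero_measurable)
  have [measurable]: "(\<lambda>r. indicator {0<..<1} r *\<^sub>R u r) \<in> borel_measurable borel"
    by (rule borel_measurable_continuous_on_indicator) (auto intro: continuous_on_subset[OF cu])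
  have eq: "(\<lambda>r. inner (u r) (w r)) = (\<lambda>r. inner (indicator {0<..<1} r *\<^sub>R u r) (w r))"
    using w by (auto simp: L2_zero_def indicator_def fun_eq_iff)
  have iw: "integrable lborel w" by (rule L2_zero_integrable[OF w])
  show i1: "integrable lborel (\<lambda>r. inner (u r) (w r))"
  proof (rule Bochner_Integration.integrable_bound)
    show "integrable lborel (\<lambda>r. norm (w r))" using iw by auto
    show "(\<lambda>r. inner (u r) (w r)) \<in> borel_measurable lborel" unfolding eq by measurable
    have "norm (inner (u r) (w r)) \<le> norm (w r)" for r
    proof (cases "r \<in> {0<..<1}")
      case True
      then show ?thesis using Cauchy_Schwarz_ineq2[of "u r" "w r"] n1[of r] by auto
    next
      case False
      then have "w r = 0" using w by (auto simp: L2_zero_def)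
      then show ?thesis by simp
    qed
    then show "AE r in lborel. norm (inner (u r) (w r)) \<le> norm (norm (w r))" by simp
  qed
  define I where "I = (\<integral>r. indicator {s<..<t} r * norm (w r) \<partial>lborel)"
  have ind: "integrable lborel (\<lambda>r. indicator {a<..<b} r * norm (w r))" for a b :: real
    using iw by (intro integrable_interval) auto
  have j1: "integrable lborel (\<lambda>r. indicator {s<..<t} r * inner (u r) (w r))"
    using i1 by (rule integrable_interval)
  have j2: "integrable lborel (\<lambda>r. indicator {s<..<t} r *\<^sub>R w r)"
    using iw by (rule integrable_interval)
  have j3: "integrable lborel (\<lambda>r. inner (u s + u t) (indicator {s<..<t} r *\<^sub>R w r))"
    using j2 by (rule integrable_inner_right)
  have z: "inner (u s + u t) (\<integral>r. indicator {s<..<t} r *\<^sub>R w r \<partial>lborel) = 0"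
  proof -
    have "(\<integral>r. indicator {s<..<t} r *\<^sub>R w r \<partial>lborel) = u t - u s" using u st by (auto simp: primitive_def)
    moreover have "inner (u s + u t) (u t - u s) = (norm (u t))\<^sup>2 - (norm (u s))\<^sup>2"
      by (simp add: power2_norm_eq_inner inner_simps inner_commute)
    ultimately show ?thesis using n1 st by simp
  qed
  have osc: "norm (u r - u s) \<le> I" "norm (u t - u r) \<le> I" if "r \<in> {s<..<t}" for r
  proof -
    have "norm (u r - u s) \<le> (\<integral>q. indicator {s<..<r} q * norm (w q) \<partial>lborel)"
      using that st by (intro primitive_norm_le[OF u w]) auto
    also have "\<dots> \<le> I" unfolding I_def using that
      by (intro integral_mono ind) (auto simp: indicator_def)
    finally show "norm (u r - u s) \<le> I" .
    have "norm (u t - u r) \<le> (\<integral>q. indicator {r<..<t} q * norm (w q) \<partial>lborel)"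
      using that st by (intro primitive_norm_le[OF u w]) auto
    also have "\<dots> \<le> I" unfolding I_def using that
      by (intro integral_mono ind) (auto simp: indicator_def)
    finally show "norm (u t - u r) \<le> I" .
  qed
  have "2 * (\<integral>r. indicator {s<..<t} r * inner (u r) (w r) \<partial>lborel) =
      2 * (\<integral>r. indicator {s<..<t} r * inner (u r) (w r) \<partial>lborel) -
      (\<integral>r. inner (u s + u t) (indicator {s<..<t} r *\<^sub>R w r) \<partial>lborel)"
    by (subst integral_inner_right[OF j2]) (simp only: z diff_zero)
  also have "\<dots> = (\<integral>r. 2 * (indicator {s<..<t} r * inner (u r) (w r)) - inner (u s + u t) (indicator {s<..<t} r *\<^sub>R w r) \<partial>lborel)"
    by (subst Bochner_Integration.integral_diff[OF integrable_mult_right j3]) (use j1 in \<open>simp_all only: integral_mult_right_zero\<close>)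
  also have "\<bar>\<dots>\<bar> \<le> (\<integral>r. 2 * I * (indicator {s<..<t} r * norm (w r)) \<partial>lborel)"
    unfolding real_norm_def[symmetric]
  proof (rule Bochner_Integration.integral_norm_bound_integral)
    fix r
    have "norm (2 * inner (u r) (w r) - inner (u s + u t) (w r)) \<le> 2 * I * norm (w r)" if "r \<in> {s<..<t}"
    proof -
      have "2 * inner (u r) (w r) - inner (u s + u t) (w r) = inner ((u r - u s) - (u t - u r)) (w r)"
        by (simp add: inner_simps)
      also have "norm \<dots> \<le> norm ((u r - u s) - (u t - u r)) * norm (w r)"
        using Cauchy_Schwarz_ineq2 by simp
      also have "norm ((u r - u s) - (u t - u r)) \<le> 2 * I"
        using norm_triangle_ineq4[of "u r - u s" "u t - u r"] osc[OF that] by linarith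
      finally show ?thesis by (simp add: mult_right_mono)
    qed
    then show "norm (2 * (indicator {s<..<t} r * inner (u r) (w r)) - inner (u s + u t) (indicator {s<..<t} r *\<^sub>R w r))
        \<le> 2 * I * (indicator {s<..<t} r * norm (w r))"
      by (cases "r \<in> {s<..<t}") auto
  qed (intro Bochner_Integration.integrable_diff integrable_mult_right j1 j3 ind)+
  also have "\<dots> = 2 * I\<^sup>2" by (simp add: I_def power2_eq_square)
  finally have "\<bar>\<integral>r. indicator {s<..<t} r * inner (u r) (w r) \<partial>lborel\<bar> \<le> I\<^sup>2" by (simp add: abs_mult)
  also have "\<dots> \<le> (t - s) * (\<integral>r. indicator {s<..<t} r * (norm (w r))\<^sup>2 \<partial>lborel)"
    unfolding I_def by (rule Cauchy_Schwarz_interval[OF w st(2)])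
  finally show "\<bar>\<integral>r. indicator {s<..<t} r * inner (u r) (w r) \<partial>lborel\<bar>
      \<le> (t - s) * (\<integral>r. indicator {s<..<t} r * (norm (w r))\<^sup>2 \<partial>lborel)" .
qed

text \<open>The integral \<open>F\<close> of \<open>inner u w\<close> is additive over intervals,
  while on each short interval it is at most length times the energy \<open>V\<close>. Cutting into
  \<open>n\<close> equal pieces gives a bound of order \<open>1/n\<close>, so \<open>F\<close>
  vanishes on every interval; no pointwise differentiation of the path is involved.\<close>

lemma unit_path_orthogonal:
  fixes u :: "real \<Rightarrow> 'h::{real_inner,banach,second_countable_topology}"
  assumes u: "primitive u w" and w: "L2_zero w" and cu: "continuous_on {0..1} u"
    and n1: "\<And>t. t \<in> {0..1} \<Longrightarrow> norm (u t) = 1"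
  shows "AE r in lborel. inner (u r) (w r) = 0"
proof (rule AE_zero_of_interval_integrals)
  note O = unit_path_orthogonal_interval[OF u w cu n1]
  show int: "integrable lborel (\<lambda>r. inner (u r) (w r))" by (rule O(2)[of 0 0]) auto
  define F where "F s t = (\<integral>r. indicator {s<..<t} r * inner (u r) (w r) \<partial>lborel)" for s t
  define V where "V s t = (\<integral>r. indicator {s<..<t} r * (norm (w r))\<^sup>2 \<partial>lborel)" for s t
  have iV: "integrable lborel (\<lambda>r. (norm (w r))\<^sup>2)" using w by (auto simp: L2_zero_def)
  have Fa: "F a c = F a b + F b c" and Va: "V a c = V a b + V b c" if "a \<le> b" "b \<le> c" for a b c
    unfolding F_def V_def using integral_interval_split[OF int that] integral_interval_split[OF iV that] by simp_all
  have FV: "\<bar>F s t\<bar> \<le> (t - s) * V s t" if "0 \<le> s" "s \<le> t" "t \<le> 1" for s t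
    unfolding F_def V_def by (rule O(1)) (use that in auto)
  have main: "F s t = 0" if st: "0 \<le> s" "s \<le> t" "t \<le> 1" for s t
  proof -
    have sub: "\<bar>F s (s + real k * h)\<bar> \<le> h * V s (s + real k * h)" if "0 \<le> h" "s + real k * h \<le> 1" for h k
      using that(2)
    proof (induction k)
      case 0
      then show ?case using FV[of s s] st by (simp add: V_def)
    next
      case (Suc k)
      have le: "s \<le> s + real k * h" "s + real k * h \<le> s + real (Suc k) * h"
        using that by (auto simp: algebra_simps)
      have "\<bar>F s (s + real (Suc k) * h)\<bar> \<le> \<bar>F s (s + real k * h)\<bar> + \<bar>F (s + real k * h) (s + real (Suc k) * h)\<bar>"
        unfolding Fa[OF le] by simp
      also have "\<dots> \<le> h * V s (s + real k * h) + h * V (s + real k * h) (s + real (Suc k) * h)"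
        using FV[of "s + real k * h" "s + real (Suc k) * h"] Suc st le by (intro add_mono) (auto simp: algebra_simps)
      also have "\<dots> = h * V s (s + real (Suc k) * h)" unfolding Va[OF le] by (simp add: algebra_simps)
      finally show ?case .
    qed
    have "\<bar>F s t\<bar> \<le> (t - s) * V s t / real (Suc n)" for n
    proof -
      have "s + real (Suc n) * ((t - s) / real (Suc n)) = t" by simp
      then show ?thesis using sub[of "(t - s) / real (Suc n)" "Suc n"] st by simp
    qed
    moreover have "(\<lambda>n. (t - s) * V s t / real (Suc n)) \<longlonglongrightarrow> 0"
      using LIMSEQ_Suc[OF lim_const_over_n[of "(t - s) * V s t"]] by simp
    ultimately have "\<bar>F s t\<bar> \<le> 0" by (intro LIMSEQ_le_const) auto
    then show ?thesis by simp
  qed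
  fix s t :: real assume "s < t"
  define s' t' where "s' = min 1 (max 0 s)" and "t' = max 0 (min t 1)"
  have st: "0 \<le> s'" "s' \<le> t'" "t' \<le> 1" using \<open>s < t\<close> by (auto simp: s'_def t'_def)
  have "r \<in> {s<..<t} \<longleftrightarrow> r \<in> {s'<..<t'}" if "r \<in> {0<..<1}" for r
    using that by (auto simp: s'_def t'_def)
  then have eq: "indicator {s<..<t} r *\<^sub>R inner (u r) (w r) = indicator {s'<..<t'} r * inner (u r) (w r)" for r
    using w by (cases "r \<in> {0<..<1}") (auto simp: L2_zero_def indicator_def)
  show "(\<integral>r. indicator {s<..<t} r *\<^sub>R inner (u r) (w r) \<partial>lborel) = 0"
    unfolding eq using main[OF st] by (simp only: F_def)
qed

lemma test_functionD:
  assumes "test_function \<phi>"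
  shows "(\<phi> has_real_derivative deriv \<phi> t) (at t)" "continuous_on UNIV \<phi>" "continuous_on UNIV (deriv \<phi>)"
    "t \<le> 0 \<or> 1 \<le> t \<Longrightarrow> \<phi> t = 0"
proof -
  have d: "(deriv ^^ n) \<phi> differentiable (at t)" for n t using assms by (auto simp: test_function_def)
  show "(\<phi> has_real_derivative deriv \<phi> t) (at t)"
    using d[of 0 t] by (auto simp: DERIV_deriv_iff_real_differentiable)
  show "continuous_on UNIV \<phi>" "continuous_on UNIV (deriv \<phi>)"
    using d[of 0] d[of 1] by (auto intro!: continuous_at_imp_continuous_on differentiable_imp_continuous_within)
  obtain K where K: "K \<subseteq> {0<..<1}" "\<And>t. t \<notin> K \<Longrightarrow> \<phi> t = 0"
    using assms unfolding test_function_def by blast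
  show "\<phi> t = 0" if "t \<le> 0 \<or> 1 \<le> t"
    by (rule K(2)) (use K(1) that in auto)
qed

lemma L2_path_of_continuous:
  fixes f :: "real \<Rightarrow> 'h::{real_inner,banach,second_countable_topology}"
  assumes f: "continuous_on {0..1} f"
  shows "L2_path f"
  unfolding L2_path_def
proof
  show "set_borel_measurable lborel {0<..<1} f"
    unfolding set_borel_measurable_def
    using borel_measurable_continuous_on_indicator[of "{0<..<1}" f] continuous_on_subset[OF f, of "{0<..<1}"] by fastforce
  have "set_integrable lborel {0..1} (\<lambda>t. (norm (f t))\<^sup>2)"
    by (intro borel_integrable_atLeastAtMost' continuous_intros f)
  then show "set_integrable lborel {0<..<1} (\<lambda>t. (norm (f t))\<^sup>2)"
    by (rule set_integrable_subset) auto
qed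

text \<open>Integration by parts is carried out for the scalar functions
  \<open>inner h (u t)\<close>; the boundary terms vanish with the test function.\<close>

lemma C1_path:
  fixes u :: "real \<Rightarrow> 'h::{real_inner,banach,second_countable_topology}"
  assumes d: "\<And>t. t \<in> {0..1} \<Longrightarrow> (u has_vector_derivative v t) (at t within {0..1})"
    and v: "continuous_on {0..1} v"
  shows "H1_path u" "continuous_on {0..1} u"
proof -
  show u: "continuous_on {0..1} u"
    unfolding continuous_on_eq_continuous_within using has_vector_derivative_continuous[OF d] by blast
  have "is_weak_deriv u v"
    unfolding is_weak_deriv_def
  proof (intro allI impI)
    fix \<phi> assume tf: "test_function \<phi>"
    note T = test_functionD[OF tf]
    have pc: "continuous_on {0..1} \<phi>" "continuous_on {0..1} (deriv \<phi>)"
      using T(2,3) continuous_on_subset by blast+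
    have int: "integrable lborel (\<lambda>t. indicator {0<..<1} t *\<^sub>R f t)" if "continuous_on {0..1} f" for f :: "real \<Rightarrow> 'h"
      using set_integrable_subset[OF borel_integrable_atLeastAtMost'[OF that], of "{0<..<1}"]
      by (fastforce simp: set_integrable_def)
    have i1: "integrable lborel (\<lambda>t. indicator {0<..<1} t *\<^sub>R (deriv \<phi> t *\<^sub>R u t))"
      and i2: "integrable lborel (\<lambda>t. indicator {0<..<1} t *\<^sub>R (\<phi> t *\<^sub>R v t))"
      by (intro int continuous_intros pc u v)+
    have "inner h ((LINT t:{0<..<1}|lborel. deriv \<phi> t *\<^sub>R u t) + (LINT t:{0<..<1}|lborel. \<phi> t *\<^sub>R v t)) = 0" for h
    proof -
      have "((\<lambda>t. \<phi> t * inner h (u t)) has_vector_derivative (deriv \<phi> t * inner h (u t) + \<phi> t * inner h (v t))) (at t within {0..1})"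
        if "t \<in> {0..1}" for t
      proof -
        have "((\<lambda>t. inner h (u t)) has_real_derivative inner h (v t)) (at t within {0..1})"
          unfolding has_real_derivative_iff_has_vector_derivative
          by (rule bounded_linear.has_vector_derivative[OF bounded_linear_inner_right d[OF that]])
        from DERIV_mult[OF has_field_derivative_at_within[OF T(1)] this]
        show ?thesis unfolding has_real_derivative_iff_has_vector_derivative by (simp add: add.commute mult.commute)
      qed
      then have "has_bochner_integral lborel (\<lambda>t. indicator {0..1} t *\<^sub>R (deriv \<phi> t * inner h (u t) + \<phi> t * inner h (v t)))
          (\<phi> 1 * inner h (u 1) - \<phi> 0 * inner h (u 0))"
        by (intro has_bochner_integral_FTC_Icc) (auto intro!: continuous_intros pc u v)
      then have "(\<integral>t. indicator {0..1} t *\<^sub>R (deriv \<phi> t * inner h (u t) + \<phi> t * inner h (v t)) \<partial>lborel) = 0"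
        using T(4) by (simp add: has_bochner_integral_iff)
      moreover have "(\<integral>t. indicator {0..1} t *\<^sub>R (deriv \<phi> t * inner h (u t) + \<phi> t * inner h (v t)) \<partial>lborel) =
          (\<integral>t. indicator {0<..<1} t *\<^sub>R (deriv \<phi> t * inner h (u t) + \<phi> t * inner h (v t)) \<partial>lborel)"
      proof (rule integral_cong_AE)
        show "AE t in lborel. indicat_real {0..1} t *\<^sub>R (deriv \<phi> t * inner h (u t) + \<phi> t * inner h (v t)) =
            indicat_real {0<..<1} t *\<^sub>R (deriv \<phi> t * inner h (u t) + \<phi> t * inner h (v t))"
          using AE_lborel_singleton[of 0] AE_lborel_singleton[of 1] by eventually_elim (auto simp: indicator_def)
        have c: "continuous_on {0..1} (\<lambda>t. deriv \<phi> t * inner h (u t) + \<phi> t * inner h (v t))"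
          by (intro continuous_intros pc u v)
        show "(\<lambda>t. indicat_real {0..1} t *\<^sub>R (deriv \<phi> t * inner h (u t) + \<phi> t * inner h (v t))) \<in> borel_measurable lborel"
          using borel_measurable_continuous_on_indicator[OF _ c] by simp
        show "(\<lambda>t. indicat_real {0<..<1} t *\<^sub>R (deriv \<phi> t * inner h (u t) + \<phi> t * inner h (v t))) \<in> borel_measurable lborel"
          using borel_measurable_continuous_on_indicator[OF _ continuous_on_subset[OF c, of "{0<..<1}"]] by fastforce
      qed
      moreover have "inner h ((LINT t:{0<..<1}|lborel. deriv \<phi> t *\<^sub>R u t) + (LINT t:{0<..<1}|lborel. \<phi> t *\<^sub>R v t)) =
          (\<integral>t. inner h (indicator {0<..<1} t *\<^sub>R (deriv \<phi> t *\<^sub>R u t) + indicator {0<..<1} t *\<^sub>R (\<phi> t *\<^sub>R v t)) \<partial>lborel)"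
        unfolding set_lebesgue_integral_def using i1 i2 by (simp del: scaleR_scaleR)
      moreover have "inner h (indicator {0<..<1} t *\<^sub>R (deriv \<phi> t *\<^sub>R u t) + indicator {0<..<1} t *\<^sub>R (\<phi> t *\<^sub>R v t)) =
          indicator {0<..<1} t *\<^sub>R (deriv \<phi> t * inner h (u t) + \<phi> t * inner h (v t))" for t
        by (simp add: inner_simps algebra_simps)
      ultimately show ?thesis by simp
    qed
    \<comment> \<open>The vector is orthogonal to every \<open>h\<close>; taking \<open>h\<close> to
      be the vector itself shows that it is zero.\<close>
    from this[of "(LINT t:{0<..<1}|lborel. deriv \<phi> t *\<^sub>R u t) + (LINT t:{0<..<1}|lborel. \<phi> t *\<^sub>R v t)"]
    show "(LINT t:{0<..<1}|lborel. deriv \<phi> t *\<^sub>R u t) = - (LINT t:{0<..<1}|lborel. \<phi> t *\<^sub>R v t)"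
      by (simp add: eq_neg_iff_add_eq_0)
  qed
  then show "H1_path u" unfolding H1_path_def using L2_path_of_continuous[OF u] L2_path_of_continuous[OF v] by blast
qed

text \<open>Whatever representative \<open>weak_deriv\<close> picks, after extension by zero it is \<open>u'\<close>.\<close>

lemma weak_deriv_primitive:
  assumes "H1_path u" "continuous_on {0..1} u"
  shows "L2_zero (\<lambda>t. indicator {0<..<1} t *\<^sub>R weak_deriv u t)"
    and "primitive u (\<lambda>t. indicator {0<..<1} t *\<^sub>R weak_deriv u t)"
proof -
  have "\<exists>v. L2_path v \<and> is_weak_deriv u v" using assms by (auto simp: H1_path_def)
  then have 1: "L2_path (weak_deriv u)" "is_weak_deriv u (weak_deriv u)"
    unfolding weak_deriv_def by (metis (mono_tags, lifting) someI_ex)+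
  show 2: "L2_zero (\<lambda>t. indicator {0<..<1} t *\<^sub>R weak_deriv u t)" by (rule L2_zero_of_L2_path[OF 1(1)])
  show "primitive u (\<lambda>t. indicator {0<..<1} t *\<^sub>R weak_deriv u t)"
  proof (rule primitive_of_weak_deriv[OF 2 _ assms(2)])
    fix \<phi> assume "test_function \<phi>"
    then have "(LINT t:{0<..<1}|lborel. deriv \<phi> t *\<^sub>R u t) = - (LINT t:{0<..<1}|lborel. \<phi> t *\<^sub>R weak_deriv u t)"
      using 1 by (auto simp: is_weak_deriv_def)
    then show "(LINT t:{0<..<1}|lborel. deriv \<phi> t *\<^sub>R u t) = - (\<integral>t. \<phi> t *\<^sub>R (indicator {0<..<1} t *\<^sub>R weak_deriv u t) \<partial>lborel)"
      by (simp add: set_lebesgue_integral_def mult.commute)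
  qed
qed

lemma primitive_of_is_weak_deriv:
  assumes v: "L2_zero v" and wd: "is_weak_deriv u v" and u: "continuous_on {0..1} u"
  shows "primitive u v"
proof (rule primitive_of_weak_deriv[OF v _ u])
  fix \<phi> assume "test_function \<phi>"
  then have "(LINT t:{0<..<1}|lborel. deriv \<phi> t *\<^sub>R u t) = - (LINT t:{0<..<1}|lborel. \<phi> t *\<^sub>R v t)"
    using wd by (auto simp: is_weak_deriv_def)
  moreover have "(LINT t:{0<..<1}|lborel. \<phi> t *\<^sub>R v t) = (\<integral>t. \<phi> t *\<^sub>R v t \<partial>lborel)"
    unfolding set_lebesgue_integral_def using v
    by (intro Bochner_Integration.integral_cong) (auto simp: L2_zero_def indicator_def)
  ultimately show "(LINT t:{0<..<1}|lborel. deriv \<phi> t *\<^sub>R u t) = - (\<integral>t. \<phi> t *\<^sub>R v t \<partial>lborel)" by simp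
qed

text \<open>Fatou's lemma in a form that assumes measurability of the approximants only, so the
  limit may be the energy integrand.\<close>

lemma nn_integral_le_of_AE_tendsto:
  fixes u :: "nat \<Rightarrow> 'a \<Rightarrow> ennreal"
  assumes u: "\<And>n. u n \<in> borel_measurable M"
    and lim: "AE x in M. (\<lambda>n. u n x) \<longlonglongrightarrow> f x"
    and K: "eventually (\<lambda>n. (\<integral>\<^sup>+x. u n x \<partial>M) \<le> K) sequentially"
  shows "(\<integral>\<^sup>+x. f x \<partial>M) \<le> K"
proof -
  have "(\<integral>\<^sup>+x. f x \<partial>M) = (\<integral>\<^sup>+x. liminf (\<lambda>n. u n x) \<partial>M)"
    using lim by (intro nn_integral_cong_AE) (auto elim!: eventually_mono simp: lim_imp_Liminf)
  also have "\<dots> \<le> liminf (\<lambda>n. \<integral>\<^sup>+x. u n x \<partial>M)" by (rule nn_integral_liminf[OF u])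
  also have "\<dots> \<le> K"
    using Liminf_le_Limsup[OF sequentially_bot] Limsup_bounded[OF K] by (rule order_trans)
  finally show ?thesis .
qed

section \<open>Strong limits of midpoint combinations and their weak derivatives\<close>

definition sq_norm :: "(real \<Rightarrow> 'h::{real_inner,banach,second_countable_topology}) \<Rightarrow> real" where
  "sq_norm w = (\<integral>r. (norm (w r))\<^sup>2 \<partial>lborel)"

abbreviation mid :: "(real \<Rightarrow> 'h::real_vector) \<Rightarrow> (real \<Rightarrow> 'h) \<Rightarrow> real \<Rightarrow> 'h" where
  "mid w w' \<equiv> (\<lambda>t. (1/2) *\<^sub>R (w t + w' t))"

lemma parallelogram_pointwise:
  fixes x y :: "'h::real_inner"
  shows "(norm (x - y))\<^sup>2 = 2 * (norm x)\<^sup>2 + 2 * (norm y)\<^sup>2 - 4 * (norm ((1/2) *\<^sub>R (x + y)))\<^sup>2"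
  by (simp add: power2_norm_eq_inner inner_simps inner_commute algebra_simps)

lemma L2_zero_mid_diff:
  assumes w: "L2_zero w" and w': "L2_zero w'"
  shows "L2_zero (mid w w')" "L2_zero (\<lambda>t. w t - w' t)"
    and "sq_norm (\<lambda>t. w t - w' t) = 2 * sq_norm w + 2 * sq_norm w' - 4 * sq_norm (mid w w')"
proof -
  have [measurable]: "w \<in> borel_measurable borel" "w' \<in> borel_measurable borel"
    using w w' by (auto simp: L2_zero_def)
  have i: "integrable lborel (\<lambda>r. (norm (w r))\<^sup>2)" "integrable lborel (\<lambda>r. (norm (w' r))\<^sup>2)"
    using w w' by (auto simp: L2_zero_def)
  have i0: "integrable lborel (\<lambda>r. 2 * (norm (w r))\<^sup>2 + 2 * (norm (w' r))\<^sup>2)" using i by simp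
  have le: "4 * (norm ((1/2) *\<^sub>R (x + y)))\<^sup>2 \<le> 2 * (norm x)\<^sup>2 + 2 * (norm y)\<^sup>2"
      "(norm (x - y))\<^sup>2 \<le> 2 * (norm x)\<^sup>2 + 2 * (norm y)\<^sup>2" for x y :: 'a
    using parallelogram_pointwise[of x y] zero_le_power2[of "norm (x - y)"] zero_le_power2[of "norm ((1/2) *\<^sub>R (x + y))"]
    by linarith+
  have m: "integrable lborel (\<lambda>r. (norm (mid w w' r))\<^sup>2)"
  proof (rule Bochner_Integration.integrable_bound[OF i0])
    have "(norm (mid w w' x))\<^sup>2 \<le> 2 * (norm (w x))\<^sup>2 + 2 * (norm (w' x))\<^sup>2" for x
      using le(1)[of "w x" "w' x"] zero_le_power2[of "norm (mid w w' x)"] by linarith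
    then show "AE x in lborel. norm ((norm (mid w w' x))\<^sup>2) \<le> norm (2 * (norm (w x))\<^sup>2 + 2 * (norm (w' x))\<^sup>2)"
      by (intro AE_I2) (simp add: abs_of_nonneg)
  qed measurable
  have d: "integrable lborel (\<lambda>r. (norm (w r - w' r))\<^sup>2)"
  proof (rule Bochner_Integration.integrable_bound[OF i0])
    show "AE x in lborel. norm ((norm (w x - w' x))\<^sup>2) \<le> norm (2 * (norm (w x))\<^sup>2 + 2 * (norm (w' x))\<^sup>2)"
      using le(2) by (intro AE_I2) (simp add: abs_of_nonneg)
  qed measurable
  show "L2_zero (mid w w')" "L2_zero (\<lambda>t. w t - w' t)"
    using w w' m d unfolding L2_zero_def by auto
  show "sq_norm (\<lambda>t. w t - w' t) = 2 * sq_norm w + 2 * sq_norm w' - 4 * sq_norm (mid w w')"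
    unfolding sq_norm_def parallelogram_pointwise[of "w _" "w' _"] using i m by simp
qed

text \<open>Closing the tail \<open>V n, n \<ge> N\<close> under midpoints replaces the convex hull in Mazur's lemma:
  the parallelogram law only ever needs midpoints.\<close>

inductive tail_hull :: "(nat \<Rightarrow> real \<Rightarrow> 'h::real_vector) \<Rightarrow> nat \<Rightarrow> (real \<Rightarrow> 'h) \<Rightarrow> bool" for V N where
  base: "N \<le> n \<Longrightarrow> tail_hull V N (V n)"
| mid: "tail_hull V N w \<Longrightarrow> tail_hull V N w' \<Longrightarrow> tail_hull V N (mid w w')"

lemma tail_hull_antimono: "tail_hull V N w \<Longrightarrow> M \<le> N \<Longrightarrow> tail_hull V M w"
  by (induction rule: tail_hull.induct) (auto intro: tail_hull.intros)

lemma L2_zero_L1_le: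
  assumes "L2_zero w"
  shows "(\<integral>r. norm (w r) \<partial>lborel)\<^sup>2 \<le> sq_norm w"
proof -
  have eq: "indicator {0<..<1} r * norm (w r) = norm (w r)" "indicator {0<..<1} r * (norm (w r))\<^sup>2 = (norm (w r))\<^sup>2" for r
    using assms by (auto simp: L2_zero_def indicator_def)
  show ?thesis using Cauchy_Schwarz_interval[OF assms, of 0 1] unfolding eq sq_norm_def by simp
qed

lemma sq_norm_nonneg: "0 \<le> sq_norm w"
  unfolding sq_norm_def by (rule integral_nonneg_AE) simp

text \<open>On the unit interval the square norm controls the integral of the norm, so the almost
  everywhere convergent subsequence comes from completeness in the integral norm. Fatou's lemma puts
  the limit back into the square-integrable functions and yields the last convergence, which is the
  one that weak derivatives need.\<close>

lemma L2_Cauchy_limit: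
  fixes w :: "nat \<Rightarrow> real \<Rightarrow> 'h::{real_inner,banach,second_countable_topology}"
  assumes w: "\<And>n. L2_zero (w n)" and C: "\<And>n. sq_norm (w n) \<le> C"
    and cau: "\<And>e. e > 0 \<Longrightarrow> \<exists>N. \<forall>i\<ge>N. \<forall>j\<ge>N. sq_norm (\<lambda>t. w i t - w j t) < e"
  obtains r v where "strict_mono (r :: nat \<Rightarrow> nat)" "L2_zero v" "AE t in lborel. (\<lambda>n. w (r n) t) \<longlonglongrightarrow> v t"
    "(\<lambda>n. \<integral>t. norm (w (r n) t - v t) \<partial>lborel) \<longlonglongrightarrow> 0"
proof -
  have [measurable]: "w n \<in> borel_measurable borel" for n using w by (auto simp: L2_zero_def)
  have int: "integrable lborel (w n)" for n using L2_zero_integrable[OF w] .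
  have L1: "\<exists>N. \<forall>i\<ge>N. \<forall>j\<ge>N. (\<integral>t. norm (w i t - w j t) \<partial>lborel) < e" if e: "e > 0" for e
  proof -
    obtain N where N: "\<forall>i\<ge>N. \<forall>j\<ge>N. sq_norm (\<lambda>t. w i t - w j t) < e\<^sup>2" using cau[of "e\<^sup>2"] e by auto
    have "(\<integral>t. norm (w i t - w j t) \<partial>lborel) < e" if "i \<ge> N" "j \<ge> N" for i j
    proof -
      have "(\<integral>t. norm (w i t - w j t) \<partial>lborel)\<^sup>2 < e\<^sup>2"
        using L2_zero_L1_le[OF L2_zero_mid_diff(2)[OF w w], of i j] N that by (meson le_less_trans)
      then show ?thesis using e by (simp add: power2_less_imp_less)
    qed
    then show ?thesis by blast
  qed
  obtain r where r: "strict_mono r" "AE t in lborel. Cauchy (\<lambda>i. w (r i) t)"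
    by (rule cauchy_L1_AE_cauchy_subseq[of lborel w, OF int L1])
  define v where "v t = lim (\<lambda>i. w (r i) t)" for t
  have vm[measurable]: "v \<in> borel_measurable borel" unfolding v_def by measurable
  have lim: "AE t in lborel. (\<lambda>n. w (r n) t) \<longlonglongrightarrow> v t"
    using r(2) unfolding v_def by eventually_elim (simp add: Cauchy_convergent_iff convergent_LIMSEQ_iff)
  have v0: "v t = 0" if "t \<notin> {0<..<1}" for t
    using w that by (auto simp: v_def L2_zero_def)
  have nn2: "(\<integral>\<^sup>+t. ennreal ((norm (w n t))\<^sup>2) \<partial>lborel) = ennreal (sq_norm (w n))" for n
    unfolding sq_norm_def using w by (intro nn_integral_eq_integral) (auto simp: L2_zero_def)
  have "(\<integral>\<^sup>+t. ennreal ((norm (v t))\<^sup>2) \<partial>lborel) \<le> ennreal C"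
  proof (rule nn_integral_le_of_AE_tendsto[of "\<lambda>n t. ennreal ((norm (w (r n) t))\<^sup>2)"])
    show "AE x in lborel. (\<lambda>n. ennreal ((norm (w (r n) x))\<^sup>2)) \<longlonglongrightarrow> ennreal ((norm (v x))\<^sup>2)"
      using lim by eventually_elim (auto intro!: tendsto_intros)
    show "\<forall>\<^sub>F n in sequentially. (\<integral>\<^sup>+ x. ennreal ((norm (w (r n) x))\<^sup>2) \<partial>lborel) \<le> ennreal C"
      using C by (auto simp: nn2 intro!: always_eventually ennreal_leI)
  qed measurable
  then have "integrable lborel (\<lambda>t. (norm (v t))\<^sup>2)"
    by (intro integrableI_bounded) (auto simp: le_less_trans)
  then have v: "L2_zero v" using v0 vm by (auto simp: L2_zero_def)
  have iv: "integrable lborel v" by (rule L2_zero_integrable[OF v])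
  have "(\<lambda>n. \<integral>t. norm (w (r n) t - v t) \<partial>lborel) \<longlonglongrightarrow> 0"
  proof (rule LIMSEQ_I)
    fix e :: real assume e: "0 < e"
    then obtain N where N: "\<And>i j. i \<ge> N \<Longrightarrow> j \<ge> N \<Longrightarrow> (\<integral>t. norm (w i t - w j t) \<partial>lborel) < e / 2"
      using L1[of "e / 2"] by auto
    have "norm ((\<integral>t. norm (w (r n) t - v t) \<partial>lborel) - 0) < e" if n: "n \<ge> N" for n
    proof -
      have rn: "N \<le> r k" if "N \<le> k" for k using that seq_suble[OF r(1), of k] by simp
      have "(\<integral>\<^sup>+t. ennreal (norm (w (r n) t - v t)) \<partial>lborel) \<le> ennreal (e / 2)"
      proof (rule nn_integral_le_of_AE_tendsto[of "\<lambda>m t. ennreal (norm (w (r n) t - w (r m) t))"])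
        show "AE x in lborel. (\<lambda>m. ennreal (norm (w (r n) x - w (r m) x))) \<longlonglongrightarrow> ennreal (norm (w (r n) x - v x))"
          using lim by eventually_elim (auto intro!: tendsto_intros)
        have "(\<integral>\<^sup>+ x. ennreal (norm (w (r n) x - w (r m) x)) \<partial>lborel) \<le> ennreal (e / 2)" if "m \<ge> N" for m
        proof -
          have "(\<integral>\<^sup>+ x. ennreal (norm (w (r n) x - w (r m) x)) \<partial>lborel) = ennreal (\<integral>x. norm (w (r n) x - w (r m) x) \<partial>lborel)"
            using int by (intro nn_integral_eq_integral) auto
          then show ?thesis using N[OF rn[OF n] rn[OF that]] by (simp add: ennreal_leI)
        qed
        then show "\<forall>\<^sub>F m in sequentially. (\<integral>\<^sup>+ x. ennreal (norm (w (r n) x - w (r m) x)) \<partial>lborel) \<le> ennreal (e / 2)"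
          by (auto simp: eventually_sequentially)
      qed measurable
      moreover have "(\<integral>\<^sup>+t. ennreal (norm (w (r n) t - v t)) \<partial>lborel) = ennreal (\<integral>t. norm (w (r n) t - v t) \<partial>lborel)"
        using int iv by (intro nn_integral_eq_integral) auto
      ultimately have "(\<integral>t. norm (w (r n) t - v t) \<partial>lborel) \<le> e / 2" using e by (simp add: ennreal_le_iff)
      moreover have "0 \<le> (\<integral>t. norm (w (r n) t - v t) \<partial>lborel)" by (rule integral_nonneg_AE) simp
      ultimately show ?thesis using e by simp
    qed
    then show "\<exists>no. \<forall>n\<ge>no. norm ((\<integral>t. norm (w (r n) t - v t) \<partial>lborel) - 0) < e" by blast
  qed
  with r(1) v lim show ?thesis by (rule that)
qed

text \<open>Let \<open>c N\<close> be the infimum of the square norm over the hull of the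
  \<open>N\<close>-th tail. It increases with \<open>N\<close> to a finite limit \<open>cl\<close>.
  Near-minimizers \<open>w0 i\<close> and \<open>w0 j\<close> with \<open>i, j \<ge> N\<close> have
  a midpoint of square norm at least \<open>c N\<close>, so the parallelogram law bounds their
  distance by \<open>4 * (cl - c N)\<close> plus the tolerances: they form a Cauchy
  sequence.\<close>

lemma tail_hull_limit:
  fixes V :: "nat \<Rightarrow> real \<Rightarrow> 'h::{real_inner,banach,second_countable_topology}"
  assumes V: "\<And>n. L2_zero (V n)" "\<And>n. sq_norm (V n) \<le> C"
  obtains w v where "\<And>N. tail_hull V N (w N)" "\<And>N. L2_zero (w N)" "L2_zero v"
    "AE t in lborel. (\<lambda>n. w n t) \<longlonglongrightarrow> v t" "(\<lambda>n. \<integral>t. norm (w n t - v t) \<partial>lborel) \<longlonglongrightarrow> 0"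
proof -
  have hull: "L2_zero w" "sq_norm w \<le> C" if "tail_hull V N w" for N w
  proof -
    have "L2_zero w \<and> sq_norm w \<le> C" using that
    proof (induction rule: tail_hull.induct)
      case (mid w w')
      then have "L2_zero w" "L2_zero w'" by auto
      from L2_zero_mid_diff[OF this] sq_norm_nonneg[of "\<lambda>t. w t - w' t"] mid show ?case by auto
    qed (use V in auto)
    then show "L2_zero w" "sq_norm w \<le> C" by auto
  qed
  define c where "c N = Inf (sq_norm ` {w. tail_hull V N w})" for N
  have ne: "{w. tail_hull V N w} \<noteq> {}" for N using tail_hull.base[of N N V] by blast
  have bb: "bdd_below (sq_norm ` A)" for A :: "(real \<Rightarrow> 'h) set"
    using sq_norm_nonneg by (auto simp: bdd_below_def)
  have cle: "c N \<le> sq_norm w" if "tail_hull V N w" for N w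
    unfolding c_def using that by (intro cInf_lower bb) auto
  have cm: "c N \<le> c M" if "N \<le> M" for N M
    unfolding c_def using that ne[of M] tail_hull_antimono[of V M _ N]
    by (intro cInf_superset_mono bb image_mono) auto
  have cC: "c N \<le> C" for N using cle[OF tail_hull.base[of N N V]] V(2)[of N] by simp
  obtain cl where cl: "c \<longlonglongrightarrow> cl" "\<And>n. c n \<le> cl"
    using incseq_convergent[of c C] cm cC by (metis incseq_def)
  have "\<exists>w. tail_hull V N w \<and> sq_norm w < c N + 1 / real (Suc N)" for N
  proof -
    have "Inf (sq_norm ` {w. tail_hull V N w}) < c N + 1 / real (Suc N)" by (simp add: c_def)
    then show ?thesis using ne[of N] by (subst (asm) cInf_less_iff[OF _ bb]) auto
  qed
  then obtain w0 where w0: "\<And>N. tail_hull V N (w0 N)" "\<And>N. sq_norm (w0 N) < c N + 1 / real (Suc N)" by metis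
  have cau: "\<exists>N. \<forall>i\<ge>N. \<forall>j\<ge>N. sq_norm (\<lambda>t. w0 i t - w0 j t) < e" if e: "e > 0" for e
  proof -
    have "(\<lambda>N. 4 * (cl - c N) + 4 / real (Suc N)) \<longlonglongrightarrow> 4 * (cl - cl) + 0"
      by (intro tendsto_intros cl(1) LIMSEQ_Suc[OF lim_const_over_n])
    then have "\<forall>\<^sub>F N in sequentially. 4 * (cl - c N) + 4 / real (Suc N) < e"
      using e by (intro order_tendstoD(2)) auto
    then obtain N where N: "4 * (cl - c N) + 4 / real (Suc N) < e" by (auto simp: eventually_sequentially)
    have "sq_norm (\<lambda>t. w0 i t - w0 j t) < e" if ij: "i \<ge> N" "j \<ge> N" for i j
    proof -
      have h: "tail_hull V N (w0 i)" "tail_hull V N (w0 j)"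
        using tail_hull_antimono w0(1) ij by blast+
      define q where "q = 1 / real (Suc N)"
      have b: "sq_norm (w0 k) \<le> cl + q" if "k \<ge> N" for k
      proof -
        have "1 / real (Suc k) \<le> 1 / real (Suc N)" using that by (intro divide_left_mono) auto
        then show ?thesis unfolding q_def using w0(2)[of k] cl(2)[of k] by (meson add_mono less_imp_le order_trans)
      qed
      have "c N \<le> sq_norm (mid (w0 i) (w0 j))" by (intro cle tail_hull.mid h)
      then have "sq_norm (\<lambda>t. w0 i t - w0 j t) \<le> 4 * (cl + q) - 4 * c N"
        unfolding L2_zero_mid_diff(3)[OF hull(1)[OF h(1)] hull(1)[OF h(2)]]
        using b[OF ij(1)] b[OF ij(2)] by argo
      also have "\<dots> < e" using N by (simp add: q_def)
      finally show ?thesis .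
    qed
    then show ?thesis by blast
  qed
  obtain r v where rv: "strict_mono (r :: nat \<Rightarrow> nat)" "L2_zero v" "AE t in lborel. (\<lambda>n. w0 (r n) t) \<longlonglongrightarrow> v t"
    "(\<lambda>n. \<integral>t. norm (w0 (r n) t - v t) \<partial>lborel) \<longlonglongrightarrow> 0"
    by (rule L2_Cauchy_limit[OF hull(1)[OF w0(1)] hull(2)[OF w0(1)] cau])
  show ?thesis
  proof (rule that[of "\<lambda>n. w0 (r n)" v])
    \<comment> \<open>The passage to a subsequence stays within the tails because
      \<open>r N \<ge> N\<close>.\<close>
    show "tail_hull V N (w0 (r N))" for N
      using tail_hull_antimono[OF w0(1)] seq_suble[OF rv(1)] by blast
  qed (use rv hull(1)[OF w0(1)] in auto)
qed

text \<open>For late \<open>n\<close> the function \<open>V n\<close> satisfies the weak derivative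
  identity of the limit \<open>b\<close> up to an error \<open>e\<close>. This approximate identity
  survives midpoints, hence holds on the hull of the tail, and it passes to \<open>v\<close> because
  \<phi> is bounded.\<close>

lemma weak_deriv_of_hull_limit:
  fixes V :: "nat \<Rightarrow> real \<Rightarrow> 'h::{real_inner,banach,second_countable_topology}"
  assumes hull: "\<And>N. tail_hull V N (w N)" and wl: "\<And>N. L2_zero (w N)" and v: "L2_zero v"
    and lim: "(\<lambda>n. \<integral>t. norm (w n t - v t) \<partial>lborel) \<longlonglongrightarrow> 0"
    and Vl: "\<And>n. L2_zero (V n)"
    and wd: "\<And>n \<phi>. test_function \<phi> \<Longrightarrow>
      (LINT t:{0<..<1}|lborel. deriv \<phi> t *\<^sub>R u n t) = - (\<integral>t. \<phi> t *\<^sub>R V n t \<partial>lborel)"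
    and cu: "\<And>n. continuous_on {0..1} (u n)" and cb: "continuous_on {0..1} b"
    and ub: "\<And>e. e > 0 \<Longrightarrow> \<exists>N. \<forall>n\<ge>N. \<forall>t\<in>{0..1}. norm (u n t - b t) < e"
  shows "is_weak_deriv b v"
  unfolding is_weak_deriv_def
proof (intro allI impI)
  fix \<phi> assume tf: "test_function \<phi>"
  note T = test_functionD[OF tf]
  have [measurable]: "\<phi> \<in> borel_measurable borel" using T(2) by (rule borel_measurable_continuous_onI)
  have "compact ((\<lambda>t. norm (\<phi> t)) ` {0..1})" "compact ((\<lambda>t. norm (deriv \<phi> t)) ` {0..1})"
    using T(2,3) by (auto intro!: compact_continuous_image continuous_intros intro: continuous_on_subset)
  then obtain P1 P2 where P: "\<forall>x\<in>(\<lambda>t. norm (\<phi> t)) ` {0..1}. norm x \<le> P1"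
    "\<forall>x\<in>(\<lambda>t. norm (deriv \<phi> t)) ` {0..1}. norm x \<le> P2"
    by (meson bounded_iff compact_imp_bounded)
  define P where "P = max 1 (max P1 P2)"
  have P1: "norm (\<phi> t) \<le> P" "norm (deriv \<phi> t) \<le> P" if "t \<in> {0..1}" for t
    using P that by (fastforce simp: P_def le_max_iff_disj)+
  have P0: "P \<ge> 1" by (simp add: P_def)
  have Pall: "norm (\<phi> t) \<le> P" for t using P1[of t] T(4)[of t] P0 by (cases "t \<in> {0..1}") auto
  have ip: "integrable lborel (\<lambda>t. \<phi> t *\<^sub>R f t)" if "L2_zero f" for f :: "real \<Rightarrow> 'h"
  proof (rule Bochner_Integration.integrable_bound)
    show "integrable lborel (\<lambda>t. P * norm (f t))" using L2_zero_integrable[OF that] by simp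
    have [measurable]: "f \<in> borel_measurable borel" using that by (rule L2_zero_measurable)
    show "(\<lambda>t. \<phi> t *\<^sub>R f t) \<in> borel_measurable lborel" by measurable
    have "norm (\<phi> t *\<^sub>R f t) \<le> norm (P * norm (f t))" for t
      using mult_right_mono[OF Pall[of t], of "norm (f t)"] P0 by simp
    then show "AE t in lborel. norm (\<phi> t *\<^sub>R f t) \<le> norm (P * norm (f t))" by simp
  qed
  have iu: "integrable lborel (\<lambda>t. indicator {0<..<1} t *\<^sub>R (deriv \<phi> t *\<^sub>R f t))"
    if "continuous_on {0..1} f" for f :: "real \<Rightarrow> 'h"
  proof -
    have "continuous_on {0..1} (\<lambda>t. deriv \<phi> t *\<^sub>R f t)"
      using T(3) that by (auto intro!: continuous_intros intro: continuous_on_subset)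
    then have "set_integrable lborel {0<..<1} (\<lambda>t. deriv \<phi> t *\<^sub>R f t)"
      by (intro set_integrable_subset[OF borel_integrable_atLeastAtMost']) auto
    then show ?thesis by (simp add: set_integrable_def)
  qed
  define A where "A = (LINT t:{0<..<1}|lborel. deriv \<phi> t *\<^sub>R b t)"
  have "norm (A + (\<integral>t. \<phi> t *\<^sub>R v t \<partial>lborel)) \<le> 2 * e" if e: "e > 0" for e
  proof -
    have "e / P > 0" using e P0 by simp
    from ub[OF this] obtain N where N: "\<And>n t. n \<ge> N \<Longrightarrow> t \<in> {0..1} \<Longrightarrow> norm (u n t - b t) < e / P" by blast
    have base: "norm (A + (\<integral>t. \<phi> t *\<^sub>R V n t \<partial>lborel)) \<le> e" if n: "n \<ge> N" for n
    proof -
      have "A + (\<integral>t. \<phi> t *\<^sub>R V n t \<partial>lborel) = A - (LINT t:{0<..<1}|lborel. deriv \<phi> t *\<^sub>R u n t)"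
        using wd[OF tf, of n] by simp
      also have "\<dots> = (\<integral>t. indicator {0<..<1} t *\<^sub>R (deriv \<phi> t *\<^sub>R b t) - indicator {0<..<1} t *\<^sub>R (deriv \<phi> t *\<^sub>R u n t) \<partial>lborel)"
        unfolding A_def set_lebesgue_integral_def
        by (rule Bochner_Integration.integral_diff[symmetric, OF iu[OF cb] iu[OF cu]])
      also have "norm \<dots> \<le> (\<integral>t. e * indicator {0<..<1::real} t \<partial>lborel)"
      proof (rule Bochner_Integration.integral_norm_bound_integral)
        show "integrable lborel (\<lambda>t. e * indicator {0<..<1::real} t)" by (intro integrable_mult_right integrable_real_indicator) auto
        fix t
        have "norm (deriv \<phi> t *\<^sub>R b t - deriv \<phi> t *\<^sub>R u n t) \<le> e" if t: "t \<in> {0<..<1}"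
        proof -
          have "norm (deriv \<phi> t *\<^sub>R b t - deriv \<phi> t *\<^sub>R u n t) = norm (deriv \<phi> t) * norm (u n t - b t)"
            by (simp add: scaleR_diff_right[symmetric] norm_minus_commute)
          also have "\<dots> \<le> P * (e / P)" using t P1(2)[of t] N[OF n, of t] P0 by (intro mult_mono) auto
          finally show ?thesis using P0 by simp
        qed
        then show "norm (indicator {0<..<1} t *\<^sub>R (deriv \<phi> t *\<^sub>R b t) - indicator {0<..<1} t *\<^sub>R (deriv \<phi> t *\<^sub>R u n t)) \<le> e * indicator {0<..<1} t"
          by (cases "t \<in> {0<..<1}") simp_all
      qed (intro Bochner_Integration.integrable_diff iu cb cu)
      also have "\<dots> = e" by simp
      finally show ?thesis .
    qed
    have "L2_zero x \<and> norm (A + (\<integral>t. \<phi> t *\<^sub>R x t \<partial>lborel)) \<le> e" if "tail_hull V N x" for x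
      using that
    proof (induction rule: tail_hull.induct)
      case (mid x y)
      have "A + (\<integral>t. \<phi> t *\<^sub>R mid x y t \<partial>lborel) =
          (1/2) *\<^sub>R ((A + (\<integral>t. \<phi> t *\<^sub>R x t \<partial>lborel)) + (A + (\<integral>t. \<phi> t *\<^sub>R y t \<partial>lborel)))"
      proof -
        have "(\<integral>t. \<phi> t *\<^sub>R mid x y t \<partial>lborel) = (\<integral>t. (1/2) *\<^sub>R (\<phi> t *\<^sub>R x t + \<phi> t *\<^sub>R y t) \<partial>lborel)"
          by (simp add: scaleR_add_right mult.commute)
        also have "\<dots> = (1/2) *\<^sub>R ((\<integral>t. \<phi> t *\<^sub>R x t \<partial>lborel) + (\<integral>t. \<phi> t *\<^sub>R y t \<partial>lborel))"
          using ip mid.IH by (subst integral_scaleR_right) simp_all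
        finally show ?thesis
          by (simp add: scaleR_add_right algebra_simps) (metis scaleR_half_double scaleR_add_right)
      qed
      moreover have "norm (A + (\<integral>t. \<phi> t *\<^sub>R x t \<partial>lborel)) \<le> e" "norm (A + (\<integral>t. \<phi> t *\<^sub>R y t \<partial>lborel)) \<le> e"
        using mid.IH by auto
      ultimately have "norm (A + (\<integral>t. \<phi> t *\<^sub>R mid x y t \<partial>lborel)) \<le> e"
        using norm_triangle_le[of "A + (\<integral>t. \<phi> t *\<^sub>R x t \<partial>lborel)" "A + (\<integral>t. \<phi> t *\<^sub>R y t \<partial>lborel)" "2 * e"] by simp
      then show ?case using L2_zero_mid_diff(1) mid.IH by blast
    qed (use base Vl in auto)
    then have wN: "norm (A + (\<integral>t. \<phi> t *\<^sub>R w n t \<partial>lborel)) \<le> e" if "n \<ge> N" for n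
      using tail_hull_antimono[OF hull that] by blast
    have "\<forall>\<^sub>F n in sequentially. (\<integral>t. norm (w n t - v t) \<partial>lborel) < e / P"
      using order_tendstoD(2)[OF lim] \<open>e / P > 0\<close> by blast
    then obtain N2 where "\<And>n. n \<ge> N2 \<Longrightarrow> (\<integral>t. norm (w n t - v t) \<partial>lborel) < e / P"
      unfolding eventually_sequentially by blast
    then obtain n where n: "n \<ge> N" "(\<integral>t. norm (w n t - v t) \<partial>lborel) < e / P"
      using max.cobounded1 max.cobounded2 by blast
    have "norm ((\<integral>t. \<phi> t *\<^sub>R v t \<partial>lborel) - (\<integral>t. \<phi> t *\<^sub>R w n t \<partial>lborel)) =
        norm (\<integral>t. \<phi> t *\<^sub>R v t - \<phi> t *\<^sub>R w n t \<partial>lborel)"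
      using ip[OF v] ip[OF wl] by simp
    also have "\<dots> \<le> (\<integral>t. P * norm (w n t - v t) \<partial>lborel)"
    proof (rule Bochner_Integration.integral_norm_bound_integral)
      show "integrable lborel (\<lambda>t. P * norm (w n t - v t))"
        using L2_zero_integrable[OF L2_zero_mid_diff(2)[OF wl v]] by simp
      show "norm (\<phi> t *\<^sub>R v t - \<phi> t *\<^sub>R w n t) \<le> P * norm (w n t - v t)" for t
        using mult_right_mono[OF Pall[of t], of "norm (w n t - v t)"]
        by (simp add: scaleR_diff_right[symmetric] norm_minus_commute)
    qed (intro Bochner_Integration.integrable_diff ip v wl)
    also have "\<dots> \<le> P * (e / P)" using n(2) P0 by (simp add: mult_left_mono field_simps)
    also have "\<dots> = e" using P0 by simp
    finally have "norm ((\<integral>t. \<phi> t *\<^sub>R v t \<partial>lborel) - (\<integral>t. \<phi> t *\<^sub>R w n t \<partial>lborel)) \<le> e" .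
    then have "norm ((A + (\<integral>t. \<phi> t *\<^sub>R w n t \<partial>lborel)) + ((\<integral>t. \<phi> t *\<^sub>R v t \<partial>lborel) - (\<integral>t. \<phi> t *\<^sub>R w n t \<partial>lborel))) \<le> 2 * e"
      using wN[OF n(1)] by (intro norm_triangle_le) simp
    then show ?thesis by simp
  qed
  note bound = this
  have main: "norm (A + (\<integral>t. \<phi> t *\<^sub>R v t \<partial>lborel)) \<le> 0 + e" if "e > 0" for e
    using bound[of "e / 2"] that by simp
  have "norm (A + (\<integral>t. \<phi> t *\<^sub>R v t \<partial>lborel)) \<le> 0" by (rule field_le_epsilon) (rule main)
  then have "A = - (\<integral>t. \<phi> t *\<^sub>R v t \<partial>lborel)" by (simp add: eq_neg_iff_add_eq_0)
  moreover have "(LINT t:{0<..<1}|lborel. \<phi> t *\<^sub>R v t) = (\<integral>t. \<phi> t *\<^sub>R v t \<partial>lborel)"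
    unfolding set_lebesgue_integral_def using v
    by (intro Bochner_Integration.integral_cong) (auto simp: L2_zero_def indicator_def)
  ultimately show "(LINT t:{0<..<1}|lborel. deriv \<phi> t *\<^sub>R b t) = - (LINT t:{0<..<1}|lborel. \<phi> t *\<^sub>R v t)"
    by (simp add: A_def)
qed

lemma nn_integral_sq_norm:
  assumes "L2_zero w"
  shows "(\<integral>\<^sup>+t. ennreal ((norm (w t))\<^sup>2) \<partial>lborel) = ennreal (sq_norm w)"
  unfolding sq_norm_def using assms by (intro nn_integral_eq_integral) (auto simp: L2_zero_def)

lemma diagonal_convergent_subsequence:
  fixes f :: "nat \<Rightarrow> nat \<Rightarrow> real"
  assumes b: "\<And>n i. \<bar>f n i\<bar> \<le> 1"
  obtains r where "strict_mono (r :: nat \<Rightarrow> nat)" "\<And>i. convergent (\<lambda>n. f (r n) i)"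
proof -
  define P where "P i s \<longleftrightarrow> convergent (\<lambda>n. f (s n) i)" for i and s :: "nat \<Rightarrow> nat"
  interpret subseqs P
  proof
    fix i and s :: "nat \<Rightarrow> nat" assume "strict_mono s"
    have "seq_compact {-1..1::real}" using compact_Icc compact_eq_seq_compact_metric by blast
    then obtain l r where "strict_mono (r :: nat \<Rightarrow> nat)" "((\<lambda>n. f (s n) i) \<circ> r) \<longlonglongrightarrow> l"
      unfolding seq_compact_def using b by (metis abs_le_iff atLeastAtMost_iff minus_le_iff)
    then show "\<exists>r'. strict_mono r' \<and> P i (s \<circ> r')"
      unfolding P_def by (intro exI[of _ r]) (auto simp: convergent_def o_def)
  qed
  have "P i (diagseq \<circ> ((+) (Suc i)))" for i
  proof (rule diagseq_holds)
    fix r s :: "nat \<Rightarrow> nat" and n assume "strict_mono r" "P n s"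
    then show "P n (s \<circ> r)" using convergent_subseq_convergent[of "\<lambda>k. f (s k) n" r] by (simp add: P_def o_def)
  qed
  then have "convergent (\<lambda>n. f (diagseq (n + Suc i)) i)" for i 
    unfolding P_def o_def by (simp only: add.commute[of _ "Suc i"])
  then have "convergent (\<lambda>n. f (diagseq n) i)" for i
    using convergent_ignore_initial_segment[of "\<lambda>n. f (diagseq n) i" "Suc i"] by simp
  then show ?thesis using that subseq_diagseq by blast
qed

section \<open>The kernel space\<close>

locale kernel_space =
  fixes \<epsilon> :: real
    and c :: "'a::metric_space \<Rightarrow> 'a \<Rightarrow> real"
    and incl :: "'h::{real_inner,banach,second_countable_topology} \<Rightarrow> 'a \<Rightarrow> real"
  assumes compact_X: "compact (UNIV :: 'a set)"
    and eps_pos: "\<epsilon> > 0"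
    and cont_c: "continuous_on UNIV (\<lambda>p. c (fst p) (snd p))"
    and c_nonneg: "\<And>x y. 0 \<le> c x y"
    and c_sym: "\<And>x y. c x y = c y x"
    and rkhs: "is_rkhs (k_c \<epsilon> c) incl"
    and univ: "universal incl"
begin

abbreviation k :: "'a \<Rightarrow> 'a \<Rightarrow> real" where "k \<equiv> k_c \<epsilon> c"

text \<open>The canonical feature map: by the reproducing property, pairing with
  \<open>kap x\<close> is evaluation at \<open>x\<close>.\<close>

definition kap :: "'a \<Rightarrow> 'h" where "kap x = inv incl (k x)"

lemma incl_kap: "incl (kap x) = k x" and incl_eq: "incl h x = inner h (kap x)"
proof -
  obtain \<kappa> where \<kappa>: "incl \<kappa> = k x" "\<And>h. incl h x = inner h \<kappa>" using rkhs unfolding is_rkhs_def by metis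
  have "inj incl" using rkhs unfolding is_rkhs_def by blast
  then have "kap x = \<kappa>" unfolding kap_def \<kappa>(1)[symmetric] by (rule inv_f_f)
  then show "incl (kap x) = k x" "incl h x = inner h (kap x)" using \<kappa> by auto
qed

lemma inner_kap: "inner (kap x) (kap y) = k x y"
  using incl_eq[of "kap x" y] incl_kap[of x] by simp

lemma k_pos: "0 < k x y" and k_le_1: "k x y \<le> 1" and k_sym: "k x y = k y x"
  using eps_pos c_nonneg[of x y] c_sym[of x y] by (auto simp: k_c_def)

lemma continuous_c_comp: "continuous_on T f \<Longrightarrow> continuous_on T g \<Longrightarrow> continuous_on T (\<lambda>x. c (f x) (g x))"
  using continuous_on_compose2[OF cont_c, of T "\<lambda>x. (f x, g x)"] by (auto intro: continuous_on_Pair)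

lemma continuous_k_comp: "continuous_on T f \<Longrightarrow> continuous_on T g \<Longrightarrow> continuous_on T (\<lambda>x. k (f x) (g x))"
  unfolding k_c_def using eps_pos by (auto intro!: continuous_intros continuous_c_comp)

lemma norm_kap: "norm (kap x) \<le> 1"
proof -
  have "(norm (kap x))\<^sup>2 \<le> 1\<^sup>2" using inner_kap[of x x] k_le_1[of x x] by (simp add: power2_norm_eq_inner)
  then show ?thesis by (rule power2_le_imp_le) simp
qed

lemma incl_le: "\<bar>incl h x\<bar> \<le> norm h"
  using Cauchy_Schwarz_ineq2[of h "kap x"] mult_left_mono[OF norm_kap[of x], of "norm h"]
  by (simp add: incl_eq)

lemma continuous_kap: "continuous_on UNIV kap"
  unfolding continuous_on_eq_continuous_within
proof
  fix x :: 'a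
  have "continuous_on UNIV (\<lambda>y. k y y - 2 * k y x + k x x)"
    by (intro continuous_intros continuous_k_comp)
  then have "((\<lambda>y. k y y - 2 * k y x + k x x) \<longlongrightarrow> k x x - 2 * k x x + k x x) (at x)"
    unfolding continuous_on_def by blast
  moreover have "k y y - 2 * k y x + k x x = (norm (kap y - kap x))\<^sup>2" for y
    by (simp add: power2_norm_eq_inner inner_simps inner_kap k_sym[of x y])
  ultimately have "((\<lambda>y. sqrt ((norm (kap y - kap x))\<^sup>2)) \<longlongrightarrow> sqrt 0) (at x)"
    by (intro tendsto_real_sqrt) simp
  then have "((\<lambda>y. norm (kap y - kap x)) \<longlongrightarrow> 0) (at x)" by simp
  then show "continuous (at x within UNIV) kap"
    unfolding continuous_within by (subst tendsto_iff) (simp add: tendsto_iff dist_norm)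
qed

lemma continuous_incl: "continuous_on UNIV (incl h)"
proof -
  have "incl h = (\<lambda>x. inner h (kap x))" by (simp add: incl_eq fun_eq_iff)
  then show ?thesis by (auto intro!: continuous_intros continuous_kap)
qed

lemma incl_simps: "incl (g + h) x = incl g x + incl h x" "incl (g - h) x = incl g x - incl h x"
  "incl (r *\<^sub>R h) x = r * incl h x" "incl 0 x = 0" "incl (- h) x = - incl h x"
  by (simp_all add: incl_eq inner_simps)

definition kmin :: real where "kmin = (SOME m. 0 < m \<and> m \<le> 1 \<and> (\<forall>x y. m \<le> k x y))"

lemma kmin: "0 < kmin" "kmin \<le> 1" "kmin \<le> k x y"
proof -
  have "continuous_on (UNIV \<times> UNIV) (\<lambda>p. k (fst p) (snd p))"
    by (intro continuous_k_comp continuous_intros)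
  note cont = this
  have ne: "(UNIV :: 'a set) \<times> (UNIV :: 'a set) \<noteq> {}" by simp
  from continuous_attains_inf[OF compact_Times[OF compact_X compact_X] ne cont]
  obtain p where "\<forall>q\<in>UNIV \<times> UNIV. k (fst p) (snd p) \<le> k (fst q) (snd q)" by blast
  then have "\<forall>x y. k (fst p) (snd p) \<le> k x y" by force
  then have "\<exists>m. 0 < m \<and> m \<le> 1 \<and> (\<forall>x y. m \<le> k x y)" using k_pos k_le_1 by blast
  from someI_ex[OF this] show "0 < kmin" "kmin \<le> 1" "kmin \<le> k x y" unfolding kmin_def by auto
qed

text \<open>A substitute for the constant function 1, which need not belong to the RKHS;
  universality provides it.\<close>

definition near_one :: 'h where "near_one = (SOME h. \<forall>x. \<bar>incl h x - 1\<bar> < 1/2)"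

lemma near_one: "1/2 \<le> incl near_one x"
proof -
  have "\<forall>\<delta>>0. \<exists>h. \<forall>x. \<bar>incl h x - 1\<bar> < \<delta>"
    using univ continuous_on_const[of UNIV "1::real"] unfolding universal_def by blast
  then have "\<exists>h. \<forall>x. \<bar>incl h x - 1\<bar> < 1/2" by (meson half_gt_zero zero_less_one)
  from someI_ex[OF this] have "\<bar>incl near_one x - 1\<bar> < 1/2" unfolding near_one_def by blast
  then show ?thesis by linarith
qed

definition cone_const :: real where "cone_const = 2 * norm near_one + 1"

lemma cone_const_pos: "0 < cone_const" by (simp add: cone_const_def add_nonneg_pos)

text \<open>The dual cone of the nonnegative functions of the RKHS. Its unit sphere is the image of \<open>B\<close>.\<close>

definition pos_cone :: "'h set" where "pos_cone = {b. \<forall>h. (\<forall>x. 0 \<le> incl h x) \<longrightarrow> 0 \<le> inner h b}"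

lemma pos_coneD: "b \<in> pos_cone \<Longrightarrow> (\<And>x. 0 \<le> incl h x) \<Longrightarrow> 0 \<le> inner h b" by (auto simp: pos_cone_def)

text \<open>Both \<open>2 * s * near_one + h\<close> and \<open>2 * s * near_one - h\<close> are
  nonnegative functions, so elements of the cone are functionals bounded in the uniform norm.
  Harnack's inequality, the positive extension to continuous functions and the passage from uniform
  to norm convergence all rest on this.\<close>

lemma pos_cone_bound:
  assumes b: "b \<in> pos_cone" and h: "\<And>x. \<bar>incl h x\<bar> \<le> s"
  shows "\<bar>inner h b\<bar> \<le> cone_const * s * norm b"
proof -
  have s: "0 \<le> s" using h[of undefined] by linarith
  have le: "s \<le> 2 * s * incl near_one x" for x using mult_left_mono[OF near_one[of x], of "2 * s"] s by simp
  have "0 \<le> inner ((2 * s) *\<^sub>R near_one + h) b" "0 \<le> inner ((2 * s) *\<^sub>R near_one - h) b"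
  proof -
    have "\<bar>incl h x\<bar> \<le> 2 * s * incl near_one x" for x using h[of x] le[of x] by linarith
    then have "0 \<le> 2 * s * incl near_one x + incl h x" "0 \<le> 2 * s * incl near_one x - incl h x" for x
      by (smt (verit))+
    then show "0 \<le> inner ((2 * s) *\<^sub>R near_one + h) b" "0 \<le> inner ((2 * s) *\<^sub>R near_one - h) b"
      by (intro pos_coneD[OF b]; simp add: incl_simps)+
  qed
  then have "\<bar>inner h b\<bar> \<le> 2 * s * inner near_one b" by (simp add: inner_simps abs_le_iff)
  also have "\<dots> \<le> 2 * s * (norm near_one * norm b)"
    using s norm_cauchy_schwarz by (intro mult_left_mono) auto
  also have "\<dots> \<le> cone_const * s * norm b" unfolding cone_const_def using s by (simp add: algebra_simps)
  finally show ?thesis .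
qed

lemma pos_cone_add: "b \<in> pos_cone \<Longrightarrow> b' \<in> pos_cone \<Longrightarrow> b + b' \<in> pos_cone" by (auto simp: pos_cone_def inner_simps)

lemma pos_cone_scale: "b \<in> pos_cone \<Longrightarrow> 0 \<le> r \<Longrightarrow> r *\<^sub>R b \<in> pos_cone" by (auto simp: pos_cone_def)

lemma pos_cone_closed:
  assumes "\<And>n. b n \<in> pos_cone" "b \<longlonglongrightarrow> l"
  shows "l \<in> pos_cone"
  unfolding pos_cone_def
proof (intro CollectI allI impI)
  fix h assume "\<forall>x. 0 \<le> incl h x"
  then have "0 \<le> inner h (b n)" for n using pos_coneD[OF assms(1)] by blast
  moreover have "(\<lambda>n. inner h (b n)) \<longlonglongrightarrow> inner h l" by (intro tendsto_intros assms)
  ultimately show "0 \<le> inner h l" by (intro LIMSEQ_le_const) auto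
qed

lemma pos_cone_incl_nonneg: "b \<in> pos_cone \<Longrightarrow> 0 \<le> incl b x"
  using pos_coneD[of b "kap x"] k_pos[of x] by (auto simp: incl_kap incl_eq[of b] inner_commute less_imp_le)

text \<open>Harnack's inequality \<open>kmin * b y \<le> b x\<close> follows from \<open>k \<ge> kmin\<close> and \<open>k \<le> 1\<close>.\<close>

lemma pos_cone_Harnack:
  assumes b: "b \<in> pos_cone"
  shows "kmin * norm b \<le> cone_const * incl b x"
proof (cases "b = 0")
  case False
  have "\<bar>incl b y\<bar> \<le> incl b x / kmin" for y
  proof -
    have "0 \<le> inner (kap x - kmin *\<^sub>R kap y) b"
    proof (rule pos_coneD[OF b])
      fix z
      have "kmin * k y z \<le> kmin * 1" using kmin(1) k_le_1 by (intro mult_left_mono) auto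
      then show "0 \<le> incl (kap x - kmin *\<^sub>R kap y) z" using kmin(3)[of x z] by (simp add: incl_simps incl_kap)
    qed
    then have "kmin * incl b y \<le> incl b x" by (simp add: incl_eq inner_simps inner_commute)
    then show ?thesis using pos_cone_incl_nonneg[OF b, of y] kmin(1) by (simp add: field_simps)
  qed
  from pos_cone_bound[OF b this]
  have "norm b * norm b \<le> cone_const * (incl b x / kmin) * norm b" by (simp add: power2_norm_eq_inner[symmetric] power2_eq_square)
  then have "norm b \<le> cone_const * (incl b x / kmin)" by (rule mult_right_le_imp_le) (use False in simp)
  then show ?thesis using kmin(1) by (simp add: field_simps)
qed (simp add: incl_simps)

text \<open>Harnack's constant: a lower bound for all functions of the unit sphere of the cone,
  hence for every \<open>B \<mu>\<close>, independently of the measure.\<close>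

definition bmin :: real where "bmin = kmin / cone_const"

lemma bmin_pos: "0 < bmin" using kmin cone_const_pos by (simp add: bmin_def)

lemma pos_cone_lower: "b \<in> pos_cone \<Longrightarrow> bmin * norm b \<le> incl b x"
  using pos_cone_Harnack[of b x] cone_const_pos by (simp add: bmin_def field_simps)

lemma pos_cone_incl_pos: "b \<in> pos_cone \<Longrightarrow> b \<noteq> 0 \<Longrightarrow> 0 < incl b x"
  using pos_cone_lower[of b x] bmin_pos by (metis mult_pos_pos less_le_trans zero_less_norm_iff)

lemma kap_pos_cone: "kap x \<in> pos_cone" by (auto simp: pos_cone_def incl_eq[symmetric])

lemma kap_nz: "kap x \<noteq> 0" using inner_kap[of x x] k_pos[of x x] by auto

section \<open>Kernel means of continuous densities\<close>

lemma measurable_continuous: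
  "radon_prob \<mu> \<Longrightarrow> continuous_on UNIV g \<Longrightarrow> g \<in> borel_measurable \<mu>"
  for g :: "'a \<Rightarrow> 'b::topological_space"
  using borel_measurable_continuous_onI[of g] by (auto simp: radon_prob_def cong: measurable_cong_sets)

lemma integrable_continuous:
  fixes g :: "'a \<Rightarrow> 'b::{banach,second_countable_topology}"
  assumes \<mu>: "radon_prob \<mu>" and g: "continuous_on UNIV g"
  shows "integrable \<mu> g"
proof -
  interpret prob_space \<mu> using \<mu> by (simp add: radon_prob_def)
  have "bounded (g ` UNIV)" using g compact_X by (intro compact_imp_bounded compact_continuous_image) auto
  then obtain B where "\<And>x. norm (g x) \<le> B" by (auto simp: bounded_iff)
  then show ?thesis using measurable_continuous[OF \<mu> g] by (intro integrable_const_bound[of _ B]) auto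
qed

definition kernel_mean :: "'a measure \<Rightarrow> ('a \<Rightarrow> real) \<Rightarrow> 'h" where "kernel_mean \<mu> g = (\<integral>x. g x *\<^sub>R kap x \<partial>\<mu>)"

lemma inner_kernel_mean:
  assumes "radon_prob \<mu>" "continuous_on UNIV g"
  shows "inner h (kernel_mean \<mu> g) = (\<integral>x. g x * incl h x \<partial>\<mu>)"
proof -
  have "integrable \<mu> (\<lambda>x. g x *\<^sub>R kap x)"
    by (intro integrable_continuous assms continuous_intros continuous_kap)
  then have "inner h (kernel_mean \<mu> g) = (\<integral>x. inner h (g x *\<^sub>R kap x) \<partial>\<mu>)"
    unfolding kernel_mean_def by (subst integral_inner_right) simp_all
  then show ?thesis by (simp add: incl_eq)
qed

lemma kernel_mean_cone:
  assumes "radon_prob \<mu>" "continuous_on UNIV g" "\<And>x. 0 \<le> g x"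
  shows "kernel_mean \<mu> g \<in> pos_cone"
  unfolding pos_cone_def using inner_kernel_mean[OF assms(1,2)] assms(3) by (auto intro!: integral_nonneg_AE)

lemma incl_kernel_mean:
  assumes "radon_prob \<mu>" "continuous_on UNIV g"
  shows "incl (kernel_mean \<mu> g) y = (\<integral>x. g x * k x y \<partial>\<mu>)"
  using inner_kernel_mean[OF assms, of "kap y"] by (simp add: incl_eq[of "kernel_mean \<mu> g"] inner_commute incl_kap k_sym)

section \<open>Existence and uniqueness of the potential\<close>

text \<open>Its derivative at \<open>b\<close> in direction \<open>g\<close> is the integral of
  \<open>g / b\<close> minus \<open>inner g b\<close>. Thus critical points solve
  \<open>b = kernel_mean \<mu> (1 / b)\<close>, the normalization equation of the potential written
  for the reciprocal of \<open>a_fun\<close>.\<close>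

definition log_functional :: "'a measure \<Rightarrow> 'h \<Rightarrow> real" where
  "log_functional \<mu> b = (\<integral>x. ln (incl b x) \<partial>\<mu>) - (norm b)\<^sup>2 / 2"

lemma continuous_ln_incl: "b \<in> pos_cone \<Longrightarrow> b \<noteq> 0 \<Longrightarrow> continuous_on UNIV (\<lambda>x. ln (incl b x))"
  using pos_cone_incl_pos by (intro continuous_intros continuous_incl) (metis less_irrefl)

lemma continuous_inv_incl: "b \<in> pos_cone \<Longrightarrow> b \<noteq> 0 \<Longrightarrow> continuous_on UNIV (\<lambda>x. 1 / incl b x)"
  using pos_cone_incl_pos by (intro continuous_intros continuous_incl) (metis less_irrefl)

lemma integral_ln_le:
  assumes \<mu>: "radon_prob \<mu>" and b: "b \<in> pos_cone" "b \<noteq> 0"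
  shows "(\<integral>x. ln (incl b x) \<partial>\<mu>) \<le> ln (norm b)"
proof -
  interpret prob_space \<mu> using \<mu> by (simp add: radon_prob_def)
  have "(\<integral>x. ln (incl b x) \<partial>\<mu>) \<le> (\<integral>x. ln (norm b) \<partial>\<mu>)"
  proof (rule integral_mono)
    show "integrable \<mu> (\<lambda>x. ln (incl b x))" by (intro integrable_continuous \<mu> continuous_ln_incl b)
    show "ln (incl b x) \<le> ln (norm b)" for x
      using incl_le[of b x] pos_cone_incl_pos[OF b, of x] by (intro ln_mono) auto
  qed auto
  then show ?thesis by (simp add: prob_space)
qed

text \<open>Concavity of the logarithm and the parallelogram law combine to uniform concavity; its
  quadratic gain makes maximizing sequences Cauchy.\<close>

lemma log_functional_mid:
  assumes \<mu>: "radon_prob \<mu>" and b: "b \<in> pos_cone" "b \<noteq> 0" and b': "b' \<in> pos_cone" "b' \<noteq> 0"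
  shows "(1/2) *\<^sub>R (b + b') \<in> pos_cone" "(1/2) *\<^sub>R (b + b') \<noteq> 0"
    and "(log_functional \<mu> b + log_functional \<mu> b') / 2 + (norm (b - b'))\<^sup>2 / 8 \<le> log_functional \<mu> ((1/2) *\<^sub>R (b + b'))"
proof -
  let ?m = "(1/2) *\<^sub>R (b + b')"
  show mP: "?m \<in> pos_cone" using b b' by (intro pos_cone_scale pos_cone_add) auto
  have pos: "0 < incl b x" "0 < incl b' x" for x using pos_cone_incl_pos b b' by auto
  have "incl ?m undefined > 0" using pos[of undefined] by (simp add: incl_simps)
  then show mz: "?m \<noteq> 0" using incl_simps(4)[of undefined] by (metis less_irrefl)
  have pt: "(ln (incl b x) + ln (incl b' x)) / 2 \<le> ln (incl ?m x)" for x
  proof -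
    have "ln (incl b x) + ln (incl b' x) = ln (incl b x * incl b' x)" using less_imp_neq[OF pos(1)] less_imp_neq[OF pos(2)] by (metis ln_mult)
    also have "\<dots> \<le> ln ((incl ?m x)\<^sup>2)"
    proof (rule ln_mono)
      have "0 \<le> (incl b x - incl b' x)\<^sup>2" by simp
      then show "incl b x * incl b' x \<le> (incl ?m x)\<^sup>2" by (simp add: incl_simps power2_eq_square field_simps)
    qed (use pos in auto)
    also have "\<dots> = 2 * ln (incl ?m x)" using pos_cone_incl_pos[OF mP mz, of x] by (simp add: ln_realpow)
    finally show ?thesis by simp
  qed
  have i: "integrable \<mu> (\<lambda>x. ln (incl b x))" "integrable \<mu> (\<lambda>x. ln (incl b' x))" "integrable \<mu> (\<lambda>x. ln (incl ?m x))"
    using \<mu> b b' mP mz by (intro integrable_continuous continuous_ln_incl; simp)+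
  have "((\<integral>x. ln (incl b x) \<partial>\<mu>) + (\<integral>x. ln (incl b' x) \<partial>\<mu>)) / 2 = (\<integral>x. (ln (incl b x) + ln (incl b' x)) / 2 \<partial>\<mu>)"
    using i by simp
  also have "\<dots> \<le> (\<integral>x. ln (incl ?m x) \<partial>\<mu>)" using i pt by (intro integral_mono) auto
  finally have "((\<integral>x. ln (incl b x) \<partial>\<mu>) + (\<integral>x. ln (incl b' x) \<partial>\<mu>)) / 2 \<le> (\<integral>x. ln (incl ?m x) \<partial>\<mu>)" .
  moreover have "(norm ?m)\<^sup>2 / 2 = ((norm b)\<^sup>2 / 2 + (norm b')\<^sup>2 / 2) / 2 - (norm (b - b'))\<^sup>2 / 8"
    by (simp add: power2_norm_eq_inner inner_simps inner_commute field_simps)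
  ultimately show "(log_functional \<mu> b + log_functional \<mu> b') / 2 + (norm (b - b'))\<^sup>2 / 8 \<le> log_functional \<mu> ?m"
    unfolding log_functional_def by argo
qed

text \<open>Uniform concavity replaces weak compactness: a maximizing sequence converges in norm. It
  remains to keep its limit away from zero and to pass to the limit in the logarithm.\<close>

lemma log_functional_maximizer:
  assumes \<mu>: "radon_prob \<mu>"
  obtains b where "b \<in> pos_cone" "b \<noteq> 0" "\<And>b'. b' \<in> pos_cone \<Longrightarrow> b' \<noteq> 0 \<Longrightarrow> log_functional \<mu> b' \<le> log_functional \<mu> b"
proof -
  interpret prob_space \<mu> using \<mu> by (simp add: radon_prob_def)
  let ?P = "pos_cone - {0}"
  have ub: "log_functional \<mu> b \<le> 0" if "b \<in> ?P" for b
  proof -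
    have "log_functional \<mu> b \<le> ln (norm b) - (norm b)\<^sup>2 / 2" using integral_ln_le[OF \<mu>] that by (simp add: log_functional_def)
    also have "\<dots> \<le> (norm b - 1) - (norm b)\<^sup>2 / 2" using that by (intro diff_right_mono ln_le_minus_one) auto
    also have "\<dots> \<le> 0" using zero_le_power2[of "norm b - 1"] by (simp add: power2_diff)
    finally show ?thesis .
  qed
  have ne: "?P \<noteq> {}" using kap_pos_cone kap_nz by blast
  have bd: "bdd_above (log_functional \<mu> ` ?P)" using ub by (auto simp: bdd_above_def)
  define s where "s = Sup (log_functional \<mu> ` ?P)"
  have sle: "log_functional \<mu> b \<le> s" if "b \<in> ?P" for b unfolding s_def using that bd by (intro cSup_upper) auto
  have "\<exists>b\<in>?P. s - 1 / real (Suc n) < log_functional \<mu> b" for n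
  proof -
    have "s - 1 / real (Suc n) < Sup (log_functional \<mu> ` ?P)" by (simp add: s_def)
    then show ?thesis using less_cSup_iff[of "log_functional \<mu> ` ?P"] bd ne by auto
  qed
  then obtain b where b: "\<And>n. b n \<in> ?P" "\<And>n. s - 1 / real (Suc n) < log_functional \<mu> (b n)" by metis
  have "Cauchy b"
  proof (rule CauchyI)
    fix e :: real assume e: "0 < e"
    have "(\<lambda>n. 8 / real (Suc n)) \<longlonglongrightarrow> 0" by (rule LIMSEQ_Suc[OF lim_const_over_n])
    then have "\<forall>\<^sub>F n in sequentially. 8 / real (Suc n) < e\<^sup>2" using e by (intro order_tendstoD(2)) auto
    then obtain N where N: "8 / real (Suc N) < e\<^sup>2" by (auto simp: eventually_sequentially)
    have "norm (b i - b j) < e" if ij: "i \<ge> N" "j \<ge> N" for i j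
    proof -
      define q where "q = 1 / real (Suc N)"
      have low: "s - q < log_functional \<mu> (b n)" if "n \<ge> N" for n
      proof -
        have "1 / real (Suc n) \<le> q" unfolding q_def using that by (intro divide_left_mono) auto
        then show ?thesis using b(2)[of n] by linarith
      qed
      note m = log_functional_mid[OF \<mu>, of "b i" "b j"]
      have "(log_functional \<mu> (b i) + log_functional \<mu> (b j)) / 2 + (norm (b i - b j))\<^sup>2 / 8 \<le> s"
        using m b(1)[of i] b(1)[of j] sle[of "(1/2) *\<^sub>R (b i + b j)"] by auto
      then have "(norm (b i - b j))\<^sup>2 < 8 * q" using low[OF ij(1)] low[OF ij(2)] by argo
      also have "8 * q < e\<^sup>2" using N by (simp add: q_def)
      finally show ?thesis using e by (simp add: power2_less_imp_less)
    qed
    then show "\<exists>M. \<forall>m\<ge>M. \<forall>n\<ge>M. norm (b m - b n) < e" by blast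
  qed
  then obtain l where l: "b \<longlonglongrightarrow> l" using Cauchy_convergent convergent_def by blast
  have lP: "l \<in> pos_cone" by (rule pos_cone_closed[OF _ l]) (use b in auto)
  \<comment> \<open>Values of at least \<open>s - 1\<close> force
    \<open>ln (norm (b n)) \<ge> s - 1\<close>, so the norms, and with them the norm of the limit,
    are at least \<open>r\<close>.\<close>
  define r where "r = exp (s - 1)"
  have nb: "r \<le> norm (b n)" for n
  proof -
    have "s - 1 \<le> s - 1 / real (Suc n)" by simp
    also have "\<dots> \<le> log_functional \<mu> (b n)" using b(2)[of n] by simp
    also have "\<dots> \<le> (\<integral>x. ln (incl (b n) x) \<partial>\<mu>)" by (simp add: log_functional_def)
    also have "\<dots> \<le> ln (norm (b n))" using integral_ln_le[OF \<mu>] b(1)[of n] by simp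
    finally have "exp (s - 1) \<le> exp (ln (norm (b n)))" by (rule exp_le_cancel_iff[THEN iffD2])
    also have "exp (ln (norm (b n))) = norm (b n)" using b(1)[of n] by simp
    finally show ?thesis unfolding r_def .
  qed
  have nl: "r \<le> norm l" using nb by (intro LIMSEQ_le_const[OF tendsto_norm[OF l]]) auto
  have r0: "0 < r" by (simp add: r_def)
  then have l0: "l \<noteq> 0" using nl by auto
  define q where "q = bmin * r"
  have q: "0 < q" using bmin_pos r0 by (simp add: q_def)
  have lq: "q \<le> incl l x" for x
    unfolding q_def using pos_cone_lower[OF lP, of x] mult_left_mono[OF nl, of bmin] bmin_pos by linarith
  \<comment> \<open>Only upper semicontinuity is wanted, so the one-sided inequality
    \<open>ln z \<le> z - 1\<close> for the quotient \<open>b n / l\<close> suffices, and only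
    \<open>l\<close> has to be bounded below.\<close>
  have "log_functional \<mu> (b n) \<le> (\<integral>x. ln (incl l x) \<partial>\<mu>) + norm (b n - l) / q - (norm (b n))\<^sup>2 / 2" for n
  proof -
    have bn: "b n \<in> pos_cone" "b n \<noteq> 0" using b(1)[of n] by auto
    have "(\<integral>x. ln (incl (b n) x) \<partial>\<mu>) \<le> (\<integral>x. ln (incl l x) + norm (b n - l) / q \<partial>\<mu>)"
    proof (rule integral_mono)
      show "integrable \<mu> (\<lambda>x. ln (incl (b n) x))" by (intro integrable_continuous \<mu> continuous_ln_incl bn)
      show "integrable \<mu> (\<lambda>x. ln (incl l x) + norm (b n - l) / q)"
        by (intro integrable_continuous \<mu> continuous_ln_incl lP l0 continuous_intros)
      fix x
      have p: "0 < incl l x" "0 < incl (b n) x" using pos_cone_incl_pos lP l0 bn by auto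
      have "ln (incl (b n) x) - ln (incl l x) = ln (incl (b n) x / incl l x)" using p by (simp add: ln_div)
      also have "\<dots> \<le> incl (b n) x / incl l x - 1" using p by (intro ln_le_minus_one) auto
      also have "\<dots> = incl (b n - l) x / incl l x" using p by (simp add: incl_simps field_simps)
      also have "\<dots> \<le> norm (b n - l) / q"
        using incl_le[of "b n - l" x] lq[of x] q p by (intro frac_le) auto
      finally show "ln (incl (b n) x) \<le> ln (incl l x) + norm (b n - l) / q" by simp
    qed
    also have "\<dots> = (\<integral>x. ln (incl l x) \<partial>\<mu>) + norm (b n - l) / q"
      using integrable_continuous[OF \<mu> continuous_ln_incl[OF lP l0]] by (simp add: prob_space)
    finally show ?thesis by (simp add: log_functional_def)
  qed
  then have "s - 1 / real (Suc n) \<le> (\<integral>x. ln (incl l x) \<partial>\<mu>) + norm (b n - l) / q - (norm (b n))\<^sup>2 / 2" for n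
    using b(2)[of n] by (meson less_imp_le order_trans)
  moreover have "(\<lambda>n. (\<integral>x. ln (incl l x) \<partial>\<mu>) + norm (b n - l) / q - (norm (b n))\<^sup>2 / 2)
      \<longlonglongrightarrow> (\<integral>x. ln (incl l x) \<partial>\<mu>) + norm (l - l) / q - (norm l)\<^sup>2 / 2"
    using q by (intro tendsto_intros l) auto
  moreover have "(\<lambda>n. s - 1 / real (Suc n)) \<longlonglongrightarrow> s - 0"
    by (intro tendsto_intros LIMSEQ_Suc[OF lim_const_over_n])
  ultimately have "s - 0 \<le> (\<integral>x. ln (incl l x) \<partial>\<mu>) + norm (l - l) / q - (norm l)\<^sup>2 / 2"
    by (intro LIMSEQ_le) auto
  then have "s \<le> log_functional \<mu> l" by (simp add: log_functional_def)
  then show ?thesis using that[OF lP l0] sle by (metis DiffI order_trans singletonD)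
qed

text \<open>The first-order condition at the maximizer \<open>b\<close> of \<open>log_functional\<close>, tested against
  \<open>kernel_mean \<mu> (1 / b)\<close>, forces \<open>b = kernel_mean \<mu> (1 / b)\<close>.\<close>

lemma schroedinger_exists:
  assumes \<mu>: "radon_prob \<mu>"
  obtains b where "b \<in> pos_cone" "norm b = 1" "b = kernel_mean \<mu> (\<lambda>x. 1 / incl b x)"
proof -
  interpret prob_space \<mu> using \<mu> by (simp add: radon_prob_def)
  obtain b where b: "b \<in> pos_cone" "b \<noteq> 0" and mx: "\<And>b'. b' \<in> pos_cone \<Longrightarrow> b' \<noteq> 0 \<Longrightarrow> log_functional \<mu> b' \<le> log_functional \<mu> b"
    using log_functional_maximizer[OF \<mu>] by blast
  have pos: "0 < incl b x" for x using pos_cone_incl_pos[OF b] .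
  have ilb: "integrable \<mu> (\<lambda>x. ln (incl b x))" by (intro integrable_continuous \<mu> continuous_ln_incl b)
  \<comment> \<open>Maximality against the rescaled \<open>b / n\<close> gives
    \<open>n\<^sup>2 - 1 \<le> ln (n\<^sup>2)\<close>, and equality in
    \<open>ln z \<le> z - 1\<close> holds only at 1.\<close>
  have n1: "norm b = 1"
  proof -
    define n where "n = norm b"
    have n: "0 < n" using b by (simp add: n_def)
    have "(\<integral>x. ln (incl ((1/n) *\<^sub>R b) x) \<partial>\<mu>) = (\<integral>x. ln (incl b x) - ln n \<partial>\<mu>)"
      using pos n by (intro Bochner_Integration.integral_cong) (auto simp: incl_simps ln_divide_pos)
    then have "log_functional \<mu> ((1/n) *\<^sub>R b) = log_functional \<mu> b - ln n - 1/2 + n\<^sup>2 / 2"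
      using ilb n b by (simp add: log_functional_def prob_space n_def)
    moreover have "log_functional \<mu> ((1/n) *\<^sub>R b) \<le> log_functional \<mu> b" using b n by (intro mx pos_cone_scale) auto
    ultimately have "n\<^sup>2 - 1 \<le> 2 * ln n" by simp
    also have "2 * ln n = ln (n\<^sup>2)" using n by (simp add: ln_realpow)
    finally have "ln (n\<^sup>2) = n\<^sup>2 - 1" using ln_le_minus_one[of "n\<^sup>2"] n by simp
    then have "n\<^sup>2 = 1" using ln_eq_minus_one[of "n\<^sup>2"] n by simp
    then show ?thesis using n unfolding n_def by (simp add: power2_eq_1_iff)
  qed
  \<comment> \<open>The one-sided first-order condition along the ray
    \<open>b + s *\<^sub>R g\<close>, which stays in the cone for positive \<open>s\<close>. The
    second-order error is explicit through \<open>z - z\<^sup>2 \<le> ln (1 + z)\<close>, so no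
    derivative under the integral is taken.\<close>
  have opt: "(\<integral>x. incl g x / incl b x \<partial>\<mu>) \<le> inner g b" if g: "g \<in> pos_cone" for g
  proof -
    define C where "C = (\<integral>x. (incl g x / incl b x)\<^sup>2 \<partial>\<mu>) + (norm g)\<^sup>2 / 2"
    have cg: "continuous_on UNIV (\<lambda>x. incl g x / incl b x)"
      using pos by (intro continuous_intros continuous_incl) (metis less_irrefl)
    have ig: "integrable \<mu> (\<lambda>x. incl g x / incl b x)" "integrable \<mu> (\<lambda>x. (incl g x / incl b x)\<^sup>2)"
      by (intro integrable_continuous \<mu> cg continuous_intros)+
    have "(\<integral>x. incl g x / incl b x \<partial>\<mu>) \<le> inner g b + s * C" if s: "0 < s" for s
    proof -
      have bs: "b + s *\<^sub>R g \<in> pos_cone" using b g s by (intro pos_cone_add pos_cone_scale) auto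
      have ge: "0 \<le> incl g x" for x using pos_cone_incl_nonneg[OF g] .
      have "incl (b + s *\<^sub>R g) undefined > 0" using pos[of undefined] ge[of undefined] s by (simp add: incl_simps add_pos_nonneg)
      then have bs0: "b + s *\<^sub>R g \<noteq> 0" using incl_simps(4)[of undefined] by (metis less_irrefl)
      have pt: "ln (incl b x) + s * (incl g x / incl b x) - s\<^sup>2 * (incl g x / incl b x)\<^sup>2 \<le> ln (incl (b + s *\<^sub>R g) x)" for x
      proof -
        define z where "z = s * (incl g x / incl b x)"
        have z: "0 \<le> z" using pos[of x] ge[of x] s by (simp add: z_def)
        have "z - z\<^sup>2 \<le> z / (1 + z)"
        proof -
          have "(z - z\<^sup>2) * (1 + z) = z - z ^ 3" by (simp add: algebra_simps power2_eq_square power3_eq_cube)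
          also have "\<dots> \<le> z" using z by simp
          finally show ?thesis using z by (simp add: pos_le_divide_eq)
        qed
        also have "z / (1 + z) = 1 - 1 / (1 + z)" using z by (simp add: field_simps)
        also have "\<dots> \<le> - ln (1 / (1 + z))" using ln_le_minus_one[of "1 / (1 + z)"] z by simp
        also have "\<dots> = ln (1 + z)" using z by (simp add: ln_div)
        finally have f1: "z - z\<^sup>2 \<le> ln (1 + z)" .
        have f2: "incl (b + s *\<^sub>R g) x = incl b x * (1 + z)"
          using pos[of x] by (simp add: z_def incl_simps field_simps)
        have f3: "ln (incl b x * (1 + z)) = ln (incl b x) + ln (1 + z)"
          using pos[of x] z by (intro ln_mult_pos) auto
        have f4: "s * (incl g x / incl b x) = z" "s\<^sup>2 * (incl g x / incl b x)\<^sup>2 = z\<^sup>2"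
          by (simp_all only: z_def power_mult_distrib)
        show ?thesis unfolding f2 f3 f4 using f1 by linarith
      qed
      have "(\<integral>x. ln (incl b x) \<partial>\<mu>) + s * (\<integral>x. incl g x / incl b x \<partial>\<mu>) - s\<^sup>2 * (\<integral>x. (incl g x / incl b x)\<^sup>2 \<partial>\<mu>)
          = (\<integral>x. ln (incl b x) + s * (incl g x / incl b x) - s\<^sup>2 * (incl g x / incl b x)\<^sup>2 \<partial>\<mu>)"
        using ilb ig by (simp only: Bochner_Integration.integral_diff Bochner_Integration.integral_add
            integrable_mult_right integral_mult_right_zero Bochner_Integration.integrable_add)
      also have "\<dots> \<le> (\<integral>x. ln (incl (b + s *\<^sub>R g) x) \<partial>\<mu>)"
        by (intro integral_mono pt Bochner_Integration.integrable_diff Bochner_Integration.integrable_add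
            ilb integrable_mult_right ig integrable_continuous[OF \<mu>] continuous_ln_incl bs bs0)
      finally have "(\<integral>x. ln (incl b x) \<partial>\<mu>) + s * (\<integral>x. incl g x / incl b x \<partial>\<mu>) - s\<^sup>2 * (\<integral>x. (incl g x / incl b x)\<^sup>2 \<partial>\<mu>)
          \<le> (\<integral>x. ln (incl (b + s *\<^sub>R g) x) \<partial>\<mu>)" .
      moreover have "(norm (b + s *\<^sub>R g))\<^sup>2 = (norm b)\<^sup>2 + 2 * s * inner g b + s\<^sup>2 * (norm g)\<^sup>2"
        unfolding power2_norm_eq_inner by (simp add: inner_simps inner_commute power2_eq_square algebra_simps)
      moreover have "log_functional \<mu> (b + s *\<^sub>R g) \<le> log_functional \<mu> b" by (rule mx[OF bs bs0])
      ultimately have "s * (\<integral>x. incl g x / incl b x \<partial>\<mu>) \<le> s * inner g b + s\<^sup>2 * C"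
        unfolding log_functional_def C_def by (simp add: algebra_simps add_divide_distrib)
      also have "\<dots> = s * (inner g b + s * C)" by (simp add: power2_eq_square algebra_simps)
      finally show ?thesis using s by simp
    qed
    note main = this
    have C: "0 \<le> C" unfolding C_def by (intro add_nonneg_nonneg integral_nonneg_AE) auto
    show ?thesis
    proof (rule field_le_epsilon)
      fix e :: real assume e: "0 < e"
      have "(\<integral>x. incl g x / incl b x \<partial>\<mu>) \<le> inner g b + e / (C + 1) * C"
        using C e by (intro main) auto
      also have "e / (C + 1) * C \<le> e" using C e by (simp add: field_simps)
      finally show "(\<integral>x. incl g x / incl b x \<partial>\<mu>) \<le> inner g b + e" by simp
    qed
  qed
  define k0 where "k0 = kernel_mean \<mu> (\<lambda>x. 1 / incl b x)"
  have ci: "continuous_on UNIV (\<lambda>x. 1 / incl b x)" by (rule continuous_inv_incl[OF b])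
  have ik: "inner h k0 = (\<integral>x. incl h x / incl b x \<partial>\<mu>)" for h
    unfolding k0_def inner_kernel_mean[OF \<mu> ci] by simp
  have k0P: "k0 \<in> pos_cone" unfolding k0_def using pos by (intro kernel_mean_cone \<mu> ci) (simp add: less_imp_le)
  \<comment> \<open>Together with \<open>inner k0 k0 \<le> 1\<close> and \<open>norm b = 1\<close>,
    this makes the squared distance of \<open>k0\<close> and \<open>b\<close> at most
    \<open>1 - 2 + 1 = 0\<close>.\<close>
  have ib: "inner b k0 = 1"
  proof -
    have "(\<lambda>x. incl b x / incl b x) = (\<lambda>x. 1)" using pos by (auto simp: fun_eq_iff less_imp_neq[THEN not_sym])
    then show ?thesis unfolding ik by (simp add: prob_space)
  qed
  have "inner k0 k0 \<le> inner k0 b" using opt[OF k0P] ik[of k0] by simp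
  then have "inner k0 k0 \<le> 1" using ib by (simp add: inner_commute)
  moreover have "inner b b = 1" using n1 by (simp add: power2_norm_eq_inner[symmetric])
  ultimately have "inner (k0 - b) (k0 - b) \<le> 0" using ib by (simp add: inner_simps inner_commute)
  then have "k0 = b" by (metis antisym inner_eq_zero_iff inner_ge_zero right_minus_eq)
  then show ?thesis using that[OF b(1) n1] by (simp add: k0_def)
qed

text \<open>Two solutions satisfy \<open>2 * inner b b' = \<integral> (b/b' + b'/b) \<ge> 2\<close>.\<close>

lemma schroedinger_unique:
  assumes \<mu>: "radon_prob \<mu>" and pos: "\<And>x. 0 < incl b x" "\<And>x. 0 < incl b' x"
    and b: "b = kernel_mean \<mu> (\<lambda>x. 1 / incl b x)" and b': "b' = kernel_mean \<mu> (\<lambda>x. 1 / incl b' x)"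
  shows "b = b'"
proof -
  interpret prob_space \<mu> using \<mu> by (simp add: radon_prob_def)
  have c: "continuous_on UNIV (\<lambda>x. 1 / incl b x)" "continuous_on UNIV (\<lambda>x. 1 / incl b' x)"
    using pos by (intro continuous_intros continuous_incl; metis less_irrefl)+
  have i: "inner h b = (\<integral>x. incl h x / incl b x \<partial>\<mu>)" "inner h b' = (\<integral>x. incl h x / incl b' x \<partial>\<mu>)" for h
    by (subst b, simp add: inner_kernel_mean[OF \<mu> c(1)], subst b', simp add: inner_kernel_mean[OF \<mu> c(2)])
  have "(\<lambda>x. incl b x / incl b x) = (\<lambda>x. 1)" "(\<lambda>x. incl b' x / incl b' x) = (\<lambda>x. 1)"
    using pos by (auto simp: fun_eq_iff less_imp_neq[THEN not_sym])
  then have 1: "inner b b = 1" "inner b' b' = 1" unfolding i by (simp_all add: prob_space)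
  have ci: "integrable \<mu> (\<lambda>x. incl b x / incl b' x)" "integrable \<mu> (\<lambda>x. incl b' x / incl b x)"
    using pos by (intro integrable_continuous \<mu> continuous_intros continuous_incl; metis less_irrefl)+
  have "2 = (\<integral>x. (2::real) \<partial>\<mu>)" by (simp add: prob_space)
  also have "\<dots> \<le> (\<integral>x. incl b x / incl b' x + incl b' x / incl b x \<partial>\<mu>)"
  proof (rule integral_mono)
    show "integrable \<mu> (\<lambda>x. incl b x / incl b' x + incl b' x / incl b x)" using ci by simp
    fix x
    have "incl b x / incl b' x + incl b' x / incl b x - 2 = (incl b x - incl b' x)\<^sup>2 / (incl b x * incl b' x)"
      using pos[of x] by (simp add: field_simps power2_eq_square)
    also have "\<dots> \<ge> 0" using pos[of x] by simp
    finally show "2 \<le> incl b x / incl b' x + incl b' x / incl b x" by simp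
  qed simp
  also have "\<dots> = inner b b' + inner b' b" using ci i by simp
  finally have "inner (b - b') (b - b') \<le> 0" using 1 by (simp add: inner_simps inner_commute)
  then show ?thesis by (metis antisym inner_eq_zero_iff inner_ge_zero right_minus_eq)
qed

text \<open>The substitution \<open>exp (f / \<epsilon>) = 1 / incl b\<close> turns the
  normalization condition into the fixed point equation. Conversely any continuous solution
  \<open>f\<close> defines a positive fixed point \<open>b'\<close> with
  \<open>incl b' = exp (- f / \<epsilon>)\<close>, and \<open>schroedinger_unique\<close> identifies
  it with \<open>b\<close>.\<close>

lemma f_pot_eq:
  assumes \<mu>: "radon_prob \<mu>" and pos: "\<And>x. 0 < incl b x" and b: "b = kernel_mean \<mu> (\<lambda>x. 1 / incl b x)"
  shows "f_pot \<epsilon> c \<mu> = (\<lambda>x. - \<epsilon> * ln (incl b x))"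
  unfolding f_pot_def
proof (rule the_equality)
  have c: "continuous_on UNIV (\<lambda>x. 1 / incl b x)"
    using pos by (intro continuous_intros continuous_incl) (metis less_irrefl)
  have ex: "exp (1 / \<epsilon> * (f x + f y - c x y)) = exp (f y / \<epsilon>) * (exp (f x / \<epsilon>) * k x y)" for f x y
    using eps_pos by (simp add: k_c_def exp_add[symmetric] field_simps)
  have ee: "exp (- \<epsilon> * ln (incl b x) / \<epsilon>) = 1 / incl b x" for x
    using eps_pos pos[of x] by (simp add: exp_minus field_simps)
  show "continuous_on UNIV (\<lambda>x. - \<epsilon> * ln (incl b x)) \<and>
    (\<forall>y. (\<integral>x. exp (1 / \<epsilon> * (- \<epsilon> * ln (incl b x) + - \<epsilon> * ln (incl b y) - c x y)) \<partial>\<mu>) = 1)"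
  proof (intro conjI allI)
    show "continuous_on UNIV (\<lambda>x. - \<epsilon> * ln (incl b x))"
      using pos by (intro continuous_intros continuous_incl) (metis less_irrefl)
    fix y
    have "incl b y = (\<integral>x. 1 / incl b x * k x y \<partial>\<mu>)" by (subst b) (rule incl_kernel_mean[OF \<mu> c])
    then have "1 / incl b y * (\<integral>x. 1 / incl b x * k x y \<partial>\<mu>) = 1" using pos[of y] by (metis less_irrefl nonzero_eq_divide_eq times_divide_eq_left)
    then show "(\<integral>x. exp (1 / \<epsilon> * (- \<epsilon> * ln (incl b x) + - \<epsilon> * ln (incl b y) - c x y)) \<partial>\<mu>) = 1"
      by (simp only: ex[of "\<lambda>x. - \<epsilon> * ln (incl b x)"] ee integral_mult_right_zero)
  qed
  fix f assume f: "continuous_on UNIV f \<and> (\<forall>y. (\<integral>x. exp (1 / \<epsilon> * (f x + f y - c x y)) \<partial>\<mu>) = 1)"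
  have ca: "continuous_on UNIV (\<lambda>x. exp (f x / \<epsilon>))" using f eps_pos by (intro continuous_intros) auto
  define b' where "b' = kernel_mean \<mu> (\<lambda>x. exp (f x / \<epsilon>))"
  have ib: "incl b' y = 1 / exp (f y / \<epsilon>)" for y
  proof -
    have "exp (f y / \<epsilon>) * (\<integral>x. exp (f x / \<epsilon>) * k x y \<partial>\<mu>) = 1" using f unfolding ex by simp
    then show ?thesis unfolding b'_def incl_kernel_mean[OF \<mu> ca] by (simp add: field_simps)
  qed
  have "(\<lambda>x. 1 / incl b' x) = (\<lambda>x. exp (f x / \<epsilon>))" by (simp add: ib)
  then have b': "b' = kernel_mean \<mu> (\<lambda>x. 1 / incl b' x)" by (simp add: b'_def)
  have "b = b'" by (rule schroedinger_unique[OF \<mu> pos _ b b']) (simp add: ib)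
  then have "incl b x = exp (- (f x / \<epsilon>))" for x using ib[of x] by (simp add: exp_minus field_simps)
  then show "f = (\<lambda>x. - \<epsilon> * ln (incl b x))" using eps_pos by (simp add: fun_eq_iff)
qed

abbreviation B :: "'a measure \<Rightarrow> 'h" where "B \<equiv> B_emb \<epsilon> c incl"

lemma B_eqI:
  assumes \<mu>: "radon_prob \<mu>" and pos: "\<And>x. 0 < incl b x" and b: "b = kernel_mean \<mu> (\<lambda>x. 1 / incl b x)"
  shows "B \<mu> = b" "a_fun \<epsilon> c \<mu> x = 1 / incl b x"
proof -
  have a: "a_fun \<epsilon> c \<mu> x = 1 / incl b x" for x
    using eps_pos pos[of x] by (simp add: a_fun_def f_pot_eq[OF assms] exp_minus field_simps)
  then show "a_fun \<epsilon> c \<mu> x = 1 / incl b x" .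
  show "B \<mu> = b" unfolding B_emb_def a kap_def[symmetric] using b by (simp add: kernel_mean_def)
qed

lemma B_facts:
  assumes \<mu>: "radon_prob \<mu>"
  shows "B \<mu> \<in> pos_cone" "norm (B \<mu>) = 1" "a_fun \<epsilon> c \<mu> x = 1 / incl (B \<mu>) x"
    "0 < incl (B \<mu>) x" "bmin \<le> incl (B \<mu>) x" "incl (B \<mu>) x \<le> 1"
    "inner h (B \<mu>) = (\<integral>x. incl h x / incl (B \<mu>) x \<partial>\<mu>)"
    "continuous_on UNIV (\<lambda>x. 1 / incl (B \<mu>) x)"
proof -
  obtain b where b: "b \<in> pos_cone" "norm b = 1" "b = kernel_mean \<mu> (\<lambda>x. 1 / incl b x)" using schroedinger_exists[OF \<mu>] by blast
  have b0: "b \<noteq> 0" using b(2) by auto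
  have pos: "0 < incl b x" for x by (rule pos_cone_incl_pos[OF b(1) b0])
  note e = B_eqI[OF \<mu> pos b(3)]
  show "B \<mu> \<in> pos_cone" "norm (B \<mu>) = 1" "a_fun \<epsilon> c \<mu> x = 1 / incl (B \<mu>) x" "0 < incl (B \<mu>) x"
    using b(1,2) e pos by auto
  show "bmin \<le> incl (B \<mu>) x" "incl (B \<mu>) x \<le> 1"
    using pos_cone_lower[OF b(1), of x] incl_le[of b x] b(2) e by auto
  note ci = continuous_inv_incl[OF b(1) b0]
  then show "continuous_on UNIV (\<lambda>x. 1 / incl (B \<mu>) x)" using e by simp
  have "inner h b = (\<integral>x. incl h x / incl b x \<partial>\<mu>)" by (subst b(3)) (simp add: inner_kernel_mean[OF \<mu> ci])
  then show "inner h (B \<mu>) = (\<integral>x. incl h x / incl (B \<mu>) x \<partial>\<mu>)" using e by simp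
qed

section \<open>The image of the embedding\<close>

text \<open>The RKHS separates points because it approximates the distance from \<open>x\<close>
  uniformly.\<close>

lemma inj_kap: "inj kap"
proof (rule injI)
  fix x y assume eq: "kap x = kap y"
  show "x = y"
  proof (rule ccontr)
    assume "x \<noteq> y"
    then have d: "dist x y / 2 > 0" by simp
    have "continuous_on UNIV (\<lambda>z. dist x z)" by (intro continuous_intros)
    then obtain h where h: "\<And>z. \<bar>incl h z - dist x z\<bar> < dist x y / 2"
      using univ d unfolding universal_def by meson
    have "incl h x = incl h y" by (simp add: incl_eq eq)
    then show False using h[of x] h[of y] unfolding dist_self abs_less_iff by linarith
  qed
qed

text \<open>Inner regularity is taken from the type \<open>'h\<close>, which is complete and second
  countable. The map \<open>kap\<close> is injective and continuous on a compact space, so it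
  carries the measure to \<open>'h\<close> and compact subsets of its range back to compact
  sets.\<close>

lemma radon_probI:
  fixes M :: "'a measure"
  assumes M: "sets M = sets borel" and p: "prob_space M"
  shows "radon_prob M"
  unfolding radon_prob_def
proof (intro conjI M p ballI)
  interpret prob_space M by fact
  have spM: "space M = UNIV" using M sets_eq_imp_space_eq[of M borel] by simp
  fix A :: "'a set" assume A: "A \<in> sets borel"
  have [measurable]: "kap \<in> borel_measurable borel"
    by (rule borel_measurable_continuous_onI[OF continuous_kap])
  then have [measurable]: "kap \<in> borel_measurable M" using M by (simp cong: measurable_cong_sets)
  have im: "compact (kap ` C)" if "closed C" for C
  proof -
    have "compact C" using that compact_X closed_Int_compact[of C UNIV] by simp
    then show ?thesis using continuous_on_subset[OF continuous_kap] by (intro compact_continuous_image) auto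
  qed
  \<comment> \<open>Preimages of Borel sets form a sigma-algebra. It contains every open set,
    because the complement is compact and has a closed image under the injective
    \<open>kap\<close>.\<close>
  have pre: "\<exists>E\<in>sets borel. A = kap -` E" if "A \<in> sets borel" for A
  proof -
    have "A \<in> sigma_sets UNIV {T. open T}"
      using that unfolding borel_def by (subst (asm) sets_measure_of) auto
    then show ?thesis
    proof (induction rule: sigma_sets.induct)
      case (Basic U)
      then have "closed (- U)" by auto
      then have "closed (kap ` (- U))" using im compact_imp_closed by blast
      moreover have "U = kap -` (- (kap ` (- U)))" using inj_kap by (auto dest: injD)
      ultimately show ?case by (intro bexI[of _ "- (kap ` (- U))"]) auto
    next
      case Empty
      then show ?case by (intro bexI[of _ "{}"]) auto
    next
      case (Compl A)
      then obtain E where "E \<in> sets borel" "A = kap -` E" by blast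
      then show ?case by (intro bexI[of _ "- E"]) auto
    next
      case (Union A)
      then obtain E where "\<And>i. E i \<in> sets borel" "\<And>i. A i = kap -` E i" by metis
      then show ?case by (intro bexI[of _ "\<Union>i. E i"]) auto
    qed
  qed
  obtain E where E: "E \<in> sets borel" "A = kap -` E" using pre[OF A] by blast
  define N where "N = distr M borel kap"
  have N: "emeasure N F = emeasure M (kap -` F)" if "F \<in> sets borel" for F
    unfolding N_def using that by (simp add: emeasure_distr spM)
  have rng: "range kap \<in> sets borel" by (rule borel_closed[OF compact_imp_closed[OF im[OF closed_UNIV]]])
  have N1: "emeasure N (space N) \<noteq> \<infinity>"
    using N[of UNIV] emeasure_finite[of UNIV] by (simp add: N_def)
  have "emeasure M A = emeasure N (E \<inter> range kap)"
    using E rng by (subst N) (auto intro!: arg_cong[of _ _ "emeasure M"])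
  also have "\<dots> = (SUP K\<in>{K. K \<subseteq> E \<inter> range kap \<and> compact K}. emeasure N K)"
    by (rule inner_regular) (use E rng N1 in \<open>auto simp: N_def\<close>)
  also have "\<dots> \<le> (SUP K\<in>{K. K \<subseteq> A \<and> compact K}. emeasure M K)"
  proof (rule SUP_mono)
    fix K assume K: "K \<in> {K. K \<subseteq> E \<inter> range kap \<and> compact K}"
    then have "closed K" using compact_imp_closed by blast
    then have "closed (kap -` K)" using continuous_closed_vimage[OF _ , of K kap] continuous_kap
      by (metis UNIV_I continuous_on_eq_continuous_at open_UNIV)
    then have "compact (kap -` K)" using compact_X closed_Int_compact[of "kap -` K" UNIV] by simp
    moreover have "kap -` K \<subseteq> A" using K E by auto
    moreover have "emeasure N K = emeasure M (kap -` K)" using \<open>closed K\<close> by (intro N) auto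
    ultimately show "\<exists>K'\<in>{K. K \<subseteq> A \<and> compact K}. emeasure N K \<le> emeasure M K'" by auto
  qed
  finally show "emeasure M A = (SUP K\<in>{K. K \<subseteq> A \<and> compact K}. emeasure M K)"
    using A M by (intro antisym SUP_least) (auto intro!: emeasure_mono)
qed

text \<open>Since the RKHS is uniformly dense, \<open>\<lambda>h. inner h b\<close> extends to a positive functional on all
  continuous functions.\<close>

lemma positive_extension:
  assumes b: "b \<in> pos_cone"
  obtains L where "\<And>f g. continuous_on UNIV f \<Longrightarrow> continuous_on UNIV g \<Longrightarrow> L (\<lambda>x. f x + g x) = L f + L g"
    "\<And>f r. continuous_on UNIV f \<Longrightarrow> L (\<lambda>x. r * f x) = r * L f"
    "\<And>f. continuous_on UNIV f \<Longrightarrow> (\<And>x. 0 \<le> f x) \<Longrightarrow> 0 \<le> L f"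
    "\<And>h. L (incl h) = inner h b"
proof -
  define D where "D = cone_const * norm b"
  have D0: "0 \<le> D" using cone_const_pos by (simp add: D_def)
  have bd: "\<bar>inner h b\<bar> \<le> D * s" if "\<And>x. \<bar>incl h x\<bar> \<le> s" for h s
    using pos_cone_bound[OF b that] by (simp add: D_def mult.commute mult.left_commute)
  define app where "app f n = (SOME h. \<forall>x. \<bar>incl h x - f x\<bar> < 1 / real (Suc n))" for f n
  have app: "\<bar>incl (app f n) x - f x\<bar> < 1 / real (Suc n)" if "continuous_on UNIV f" for f n x
  proof -
    have "\<exists>h. \<forall>x. \<bar>incl h x - f x\<bar> < 1 / real (Suc n)" using univ that unfolding universal_def by simp
    from someI_ex[OF this] show ?thesis unfolding app_def by blast
  qed
  define L where "L f = lim (\<lambda>n. inner (app f n) b)" for f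
  have near: "\<bar>inner h b - inner (app f n) b\<bar> \<le> D * (s + 1 / real (Suc n))"
    if "continuous_on UNIV f" "\<And>x. \<bar>incl h x - f x\<bar> \<le> s" for f h s n
  proof -
    have "\<bar>inner (h - app f n) b\<bar> \<le> D * (s + 1 / real (Suc n))"
    proof (rule bd)
      fix x
      show "\<bar>incl (h - app f n) x\<bar> \<le> s + 1 / real (Suc n)"
        using app[OF that(1), of n x] that(2)[of x] unfolding incl_simps by linarith
    qed
    then show ?thesis by (simp add: inner_simps)
  qed
  have lim: "(\<lambda>n. inner (app f n) b) \<longlonglongrightarrow> L f" if f: "continuous_on UNIV f" for f
  proof -
    have "Cauchy (\<lambda>n. inner (app f n) b)"
    proof (rule CauchyI)
      fix e :: real assume e: "0 < e"
      have "(\<lambda>n. D * (2 / real (Suc n))) \<longlonglongrightarrow> D * 0"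
        by (intro tendsto_intros LIMSEQ_Suc[OF lim_const_over_n])
      then have "\<forall>\<^sub>F n in sequentially. D * (2 / real (Suc n)) < e" using e by (intro order_tendstoD(2)) auto
      then obtain N where N: "D * (2 / real (Suc N)) < e" by (auto simp: eventually_sequentially)
      have "norm (inner (app f i) b - inner (app f j) b) < e" if ij: "i \<ge> N" "j \<ge> N" for i j
      proof -
        have "\<bar>inner (app f i) b - inner (app f j) b\<bar> \<le> D * (1 / real (Suc i) + 1 / real (Suc j))"
          using app[OF f, of i] by (intro near f) (simp add: less_imp_le)
        also have "\<dots> \<le> D * (1 / real (Suc N) + 1 / real (Suc N))"
          using ij D0 by (intro mult_left_mono add_mono divide_left_mono) simp_all
        also have "\<dots> < e" using N by simp
        finally show ?thesis by simp
      qed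
      then show "\<exists>M. \<forall>m\<ge>M. \<forall>n\<ge>M. norm (inner (app f m) b - inner (app f n) b) < e" by blast
    qed
    then show ?thesis unfolding L_def by (simp add: Cauchy_convergent_iff convergent_LIMSEQ_iff)
  qed
  have Ln: "\<bar>inner h b - L f\<bar> \<le> D * s" if f: "continuous_on UNIV f" and h: "\<And>x. \<bar>incl h x - f x\<bar> \<le> s" for f h s
  proof -
    have "(\<lambda>n. \<bar>inner h b - inner (app f n) b\<bar>) \<longlonglongrightarrow> \<bar>inner h b - L f\<bar>" by (intro tendsto_intros lim f)
    moreover have "(\<lambda>n. D * (s + 1 / real (Suc n))) \<longlonglongrightarrow> D * (s + 0)"
      by (intro tendsto_intros LIMSEQ_Suc[OF lim_const_over_n])
    ultimately have "\<bar>inner h b - L f\<bar> \<le> D * (s + 0)" using near[OF f h] by (intro LIMSEQ_le) auto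
    then show ?thesis by simp
  qed
  have apx: "\<exists>h. \<forall>x. \<bar>incl h x - f x\<bar> \<le> s" if "continuous_on UNIV f" "0 < s" for f s
    using univ that unfolding universal_def by (meson less_imp_le)
  have small: "x = 0" if sm: "\<And>s. 0 < s \<Longrightarrow> \<bar>x\<bar> \<le> D * (C * s)" and C0: "0 \<le> C" for x C :: real
  proof -
    have "\<bar>x\<bar> \<le> 0 + e" if e: "0 < e" for e
    proof -
      have "D * C \<ge> 0" using D0 C0 by simp
      then have "0 < e / (D * C + 1)" using e by simp
      then have "\<bar>x\<bar> \<le> D * (C * (e / (D * C + 1)))" by (rule sm)
      also have "\<dots> = (D * C) / (D * C + 1) * e" by simp
      also have "\<dots> \<le> 1 * e" using \<open>D * C \<ge> 0\<close> e by (intro mult_right_mono) auto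
      finally show ?thesis by simp
    qed
    then have "\<bar>x\<bar> \<le> 0" by (rule field_le_epsilon)
    then show ?thesis by simp
  qed
  show ?thesis
  proof (rule that[of L])
    fix f g :: "'a \<Rightarrow> real" assume f: "continuous_on UNIV f" and g: "continuous_on UNIV g"
    have "L (\<lambda>x. f x + g x) - (L f + L g) = 0"
    proof (rule small[of _ 4])
      fix s :: real assume s: "0 < s"
      obtain h h' where h: "\<And>x. \<bar>incl h x - f x\<bar> \<le> s" "\<And>x. \<bar>incl h' x - g x\<bar> \<le> s" using apx f g s by metis
      have "\<bar>inner (h + h') b - L (\<lambda>x. f x + g x)\<bar> \<le> D * (s + s)"
      proof (rule Ln)
        show "\<bar>incl (h + h') x - (f x + g x)\<bar> \<le> s + s" for x
          using h(1)[of x] h(2)[of x] unfolding incl_simps by linarith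
      qed (intro continuous_intros f g)
      moreover have "\<bar>inner h b - L f\<bar> \<le> D * s" "\<bar>inner h' b - L g\<bar> \<le> D * s" using Ln f g h by auto
      ultimately show "\<bar>L (\<lambda>x. f x + g x) - (L f + L g)\<bar> \<le> D * (4 * s)"
        by (simp add: inner_add_left algebra_simps)
    qed simp
    then show "L (\<lambda>x. f x + g x) = L f + L g" by simp
  next
    fix f :: "'a \<Rightarrow> real" and r assume f: "continuous_on UNIV f"
    have "L (\<lambda>x. r * f x) - r * L f = 0"
    proof (rule small[of _ "2 * \<bar>r\<bar>"])
      fix s :: real assume s: "0 < s"
      obtain h where h: "\<And>x. \<bar>incl h x - f x\<bar> \<le> s" using apx f s by metis
      have 1: "\<bar>inner (r *\<^sub>R h) b - L (\<lambda>x. r * f x)\<bar> \<le> D * (\<bar>r\<bar> * s)"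
      proof (rule Ln)
        show "\<bar>incl (r *\<^sub>R h) x - r * f x\<bar> \<le> \<bar>r\<bar> * s" for x
          using mult_left_mono[OF h[of x], of "\<bar>r\<bar>"] unfolding incl_simps right_diff_distrib[symmetric] abs_mult by simp
      qed (intro continuous_intros f)
      have "\<bar>r * (inner h b - L f)\<bar> \<le> \<bar>r\<bar> * (D * s)" using Ln[OF f h] by (simp add: abs_mult mult_left_mono)
      then have "\<bar>inner (r *\<^sub>R h) b - r * L f\<bar> \<le> D * (\<bar>r\<bar> * s)" by (simp add: algebra_simps)
      with 1 show "\<bar>L (\<lambda>x. r * f x) - r * L f\<bar> \<le> D * (2 * \<bar>r\<bar> * s)" by (simp add: algebra_simps)
    qed simp
    then show "L (\<lambda>x. r * f x) = r * L f" by simp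
  next
    fix f :: "'a \<Rightarrow> real" assume f: "continuous_on UNIV f" and f0: "\<And>x. 0 \<le> f x"
    \<comment> \<open>An approximant \<open>h\<close> of \<open>f\<close> may be slightly negative
      and is lifted by \<open>2 * s * near_one\<close>; the second term of \<open>E\<close> pays for
      the lift, the first for the approximation.\<close>
    define E where "E = D + 2 * \<bar>inner near_one b\<bar>"
    have "- L f \<le> 0 + e" if e: "0 < e" for e
    proof -
      have E0: "0 \<le> E" using D0 by (simp add: E_def)
      define s where "s = e / (E + 1)"
      have s: "0 < s" using e E0 by (simp add: s_def)
      obtain h where h: "\<And>x. \<bar>incl h x - f x\<bar> \<le> s" using apx f s by metis
      have "0 \<le> inner (h + (2 * s) *\<^sub>R near_one) b"
      proof (rule pos_coneD[OF b])
        fix x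
        have "s \<le> 2 * s * incl near_one x" using mult_left_mono[OF near_one[of x], of "2 * s"] s by simp
        then show "0 \<le> incl (h + (2 * s) *\<^sub>R near_one) x" using h[of x] f0[of x] unfolding incl_simps by linarith
      qed
      then have "- inner h b \<le> 2 * s * inner near_one b" by (simp add: inner_simps)
      also have "\<dots> \<le> 2 * s * \<bar>inner near_one b\<bar>" using s by (intro mult_left_mono) auto
      finally have "- L f \<le> E * s" using Ln[OF f h] by (simp add: E_def algebra_simps abs_le_iff)
      also have "\<dots> = E / (E + 1) * e" by (simp add: s_def)
      also have "\<dots> \<le> 1 * e" using E0 e by (intro mult_right_mono) auto
      finally show ?thesis by simp
    qed
    then have "- L f \<le> 0" by (rule field_le_epsilon)
    then show "0 \<le> L f" by simp
  next
    fix h show "L (incl h) = inner h b" using Ln[of "incl h" h 0, OF continuous_incl] by simp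
  qed
qed

text \<open>Riesz' theorem is applied to the weighted functional
  \<open>L (\<lambda>x. incl b x * f x)\<close>, which yields the desired measure rather than
  \<alpha> directly. Its mass is \<open>inner b b = 1\<close>, and dividing by \<open>incl b\<close>
  inside the integral recovers \<open>inner h b\<close>, so \<open>b\<close> solves the fixed point
  equation for it.\<close>

lemma B_surj:
  assumes b: "b \<in> pos_cone" "norm b = 1"
  shows "\<exists>\<mu>. radon_prob \<mu> \<and> B \<mu> = b"
proof -
  obtain L where L: "\<And>f g. continuous_on UNIV f \<Longrightarrow> continuous_on UNIV g \<Longrightarrow> L (\<lambda>x. f x + g x) = L f + L g"
    "\<And>f r. continuous_on UNIV f \<Longrightarrow> L (\<lambda>x. r * f x) = r * L f"
    "\<And>f. continuous_on UNIV f \<Longrightarrow> (\<And>x. 0 \<le> f x) \<Longrightarrow> 0 \<le> L f"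
    "\<And>h. L (incl h) = inner h b" using positive_extension[OF b(1)] by blast
  have b0: "b \<noteq> 0" using b by auto
  have pos: "0 < incl b x" for x by (rule pos_cone_incl_pos[OF b(1) b0])
  obtain M where M: "sets M = sets borel" "finite_measure M"
    "\<And>f. continuous_on UNIV f \<Longrightarrow> integral\<^sup>L M f = L (\<lambda>x. incl b x * f x)"
  proof (rule Riesz_representation_compact[of "\<lambda>f. L (\<lambda>x. incl b x * f x)"])
    show "compact (UNIV :: 'a set)" by (rule compact_X)
    fix f g :: "'a \<Rightarrow> real" and r assume f: "continuous_on UNIV f"
    show "L (\<lambda>x. incl b x * (r * f x)) = r * L (\<lambda>x. incl b x * f x)"
      using L(2)[of "\<lambda>x. incl b x * f x" r] f by (simp add: mult.left_commute continuous_on_mult continuous_incl)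
    show "0 \<le> L (\<lambda>x. incl b x * f x)" if "\<And>x. 0 \<le> f x"
      using that pos f by (intro L(3) continuous_intros continuous_incl mult_nonneg_nonneg) (auto simp: less_imp_le)
    assume g: "continuous_on UNIV g"
    show "L (\<lambda>x. incl b x * (f x + g x)) = L (\<lambda>x. incl b x * f x) + L (\<lambda>x. incl b x * g x)"
      unfolding distrib_left by (intro L(1) continuous_intros continuous_incl f g)
  qed blast
  interpret finite_measure M by (rule M(2))
  have spM: "space M = UNIV" using M(1) sets_eq_imp_space_eq[of M borel] by simp
  have bb: "inner b b = 1" using b(2) by (simp add: power2_norm_eq_inner[symmetric])
  have "measure M UNIV = 1"
    using M(3)[of "\<lambda>x. 1"] L(4)[of b] bb by (simp add: spM)
  then have "prob_space M" by (intro prob_spaceI) (simp add: emeasure_eq_measure spM)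
  then have rM: "radon_prob M" by (rule radon_probI[OF M(1)])
  have ci: "continuous_on UNIV (\<lambda>x. 1 / incl b x)" by (rule continuous_inv_incl[OF b(1) b0])
  have "inner h (kernel_mean M (\<lambda>x. 1 / incl b x)) = inner h b" for h
  proof -
    have "(\<lambda>x. incl b x * (1 / incl b x * incl h x)) = incl h" using pos by (auto simp: fun_eq_iff less_imp_neq[THEN not_sym])
    moreover have "continuous_on UNIV (\<lambda>x. 1 / incl b x * incl h x)" by (rule continuous_on_mult[OF ci continuous_incl])
    ultimately show ?thesis unfolding inner_kernel_mean[OF rM ci] using M(3) L(4) by metis
  qed
  from this[of "kernel_mean M (\<lambda>x. 1 / incl b x) - b"]
  have "inner (kernel_mean M (\<lambda>x. 1 / incl b x) - b) (kernel_mean M (\<lambda>x. 1 / incl b x) - b) = 0"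
    by (simp only: inner_diff_right diff_self)
  then have "kernel_mean M (\<lambda>x. 1 / incl b x) = b" by simp
  then have "B M = b" by (intro B_eqI(1)[OF rM pos]) (rule sym)
  then show ?thesis using rM by blast
qed

section \<open>The metric tensor in the RKHS\<close>

text \<open>\<open>transport_op \<mu>\<close> is \<open>K\<^sub>\<mu>\<close> transported to the RKHS by \<open>b \<mapsto> a\<^sub>\<mu> b\<close>.\<close>

definition transport_op :: "'a measure \<Rightarrow> 'h \<Rightarrow> 'h" where
  "transport_op \<mu> b = kernel_mean \<mu> (\<lambda>x. incl b x / (incl (B \<mu>) x)\<^sup>2)"

lemma continuous_div_B:
  assumes "radon_prob \<mu>" "continuous_on UNIV f"
  shows "continuous_on UNIV (\<lambda>x. f x / incl (B \<mu>) x)" "continuous_on UNIV (\<lambda>x. f x / (incl (B \<mu>) x)\<^sup>2)"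
proof -
  have "incl (B \<mu>) x \<noteq> 0" for x using B_facts(4)[OF assms(1), of x] by simp
  then show "continuous_on UNIV (\<lambda>x. f x / incl (B \<mu>) x)" "continuous_on UNIV (\<lambda>x. f x / (incl (B \<mu>) x)\<^sup>2)"
    by (intro continuous_intros assms continuous_incl; simp)+
qed

lemma inner_transport_op:
  assumes \<mu>: "radon_prob \<mu>"
  shows "inner h (transport_op \<mu> b) = (\<integral>x. incl b x * incl h x / (incl (B \<mu>) x)\<^sup>2 \<partial>\<mu>)"
  unfolding transport_op_def by (subst inner_kernel_mean[OF \<mu> continuous_div_B(2)[OF \<mu> continuous_incl]]) (simp add: mult.commute)

lemma transport_op_sym: "radon_prob \<mu> \<Longrightarrow> inner h (transport_op \<mu> b) = inner (transport_op \<mu> h) b"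
  unfolding inner_commute[of "transport_op \<mu> h" b] by (simp add: inner_transport_op mult.commute)

lemma inner_ext: "(\<And>h. inner h x = inner h y) \<Longrightarrow> x = y" for x y :: 'h
  by (metis inner_diff_right inner_eq_zero_iff right_minus_eq)

lemma transport_op_linear:
  assumes \<mu>: "radon_prob \<mu>"
  shows "transport_op \<mu> (b + b') = transport_op \<mu> b + transport_op \<mu> b'" "transport_op \<mu> (r *\<^sub>R b) = r *\<^sub>R transport_op \<mu> b"
  by (rule inner_ext, simp add: transport_op_sym[OF \<mu>] inner_simps)+

lemma B_eq_kernel_mean: "radon_prob \<mu> \<Longrightarrow> B \<mu> = kernel_mean \<mu> (\<lambda>x. 1 / incl (B \<mu>) x)"
  by (rule inner_ext) (simp add: B_facts(7) inner_kernel_mean B_facts(8))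

lemma transport_op_B:
  assumes \<mu>: "radon_prob \<mu>"
  shows "transport_op \<mu> (B \<mu>) = B \<mu>"
proof -
  have "incl (B \<mu>) x / (incl (B \<mu>) x)\<^sup>2 = 1 / incl (B \<mu>) x" for x
    using B_facts(4)[OF \<mu>, of x] by (simp add: power2_eq_square)
  then show ?thesis using B_eq_kernel_mean[OF \<mu>] by (simp add: transport_op_def)
qed

lemma transport_op_psd: "radon_prob \<mu> \<Longrightarrow> 0 \<le> inner b (transport_op \<mu> b)"
  unfolding inner_transport_op by (intro integral_nonneg_AE AE_I2) (simp add: power2_eq_square[symmetric])

text \<open>Doeblin's argument: the kernel \<open>k\<^sub>\<mu>\<close> is bounded below by \<open>\<delta>\<close>, and integrating
  \<open>(k\<^sub>\<mu> x y - \<delta>) * (\<psi> x - \<psi> y)\<^sup>2 \<ge> 0\<close> for \<open>\<psi> = a\<^sub>\<mu> b\<close> over both variables gives the estimate.\<close>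

lemma transport_op_Doeblin:
  assumes \<mu>: "radon_prob \<mu>" and d: "0 \<le> \<delta>" "\<delta> \<le> kmin"
  shows "(norm (transport_op \<mu> b))\<^sup>2 \<le> (1 - \<delta>) * inner b (transport_op \<mu> b) + \<delta> * (inner b (B \<mu>))\<^sup>2"
proof -
  interpret prob_space \<mu> using \<mu> by (simp add: radon_prob_def)
  let ?\<beta> = "incl (B \<mu>)"
  have pos: "0 < ?\<beta> x" "?\<beta> x \<noteq> 0" for x using B_facts(4)[OF \<mu>, of x] by auto
  define \<psi> where "\<psi> x = incl b x / ?\<beta> x" for x
  have cp: "continuous_on UNIV \<psi>" unfolding \<psi>_def by (intro continuous_div_B \<mu> continuous_incl)
  have cp2: "continuous_on UNIV (\<lambda>x. (\<psi> x)\<^sup>2)" by (intro continuous_intros cp)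
  \<comment> \<open>The term with \<open>(\<psi> x)\<^sup>2\<close> becomes an RKHS function of
    \<open>y\<close>, so its integral over \<open>y\<close> is a pairing with \<open>B \<mu>\<close>
    and equals \<open>P2\<close>.\<close>
  define q where "q = kernel_mean \<mu> (\<lambda>x. (\<psi> x)\<^sup>2 / ?\<beta> x)"
  have Mop: "transport_op \<mu> b = kernel_mean \<mu> (\<lambda>x. \<psi> x / ?\<beta> x)" unfolding transport_op_def \<psi>_def by (simp add: power2_eq_square)
  define P1 where "P1 = (\<integral>x. \<psi> x \<partial>\<mu>)"
  define P2 where "P2 = (\<integral>x. (\<psi> x)\<^sup>2 \<partial>\<mu>)"
  have i: "integrable \<mu> \<psi>" "integrable \<mu> (\<lambda>x. (\<psi> x)\<^sup>2)" by (intro integrable_continuous \<mu> cp cp2)+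
  have P1: "P1 = inner b (B \<mu>)" unfolding P1_def \<psi>_def B_facts(7)[OF \<mu>] ..
  have P2: "P2 = inner b (transport_op \<mu> b)"
    unfolding P2_def \<psi>_def inner_transport_op[OF \<mu>] by (simp add: power2_eq_square)
  have pt: "0 \<le> incl q y / ?\<beta> y - 2 * (\<psi> y * incl (transport_op \<mu> b) y / ?\<beta> y) + (\<psi> y)\<^sup>2 - \<delta> * (P2 - 2 * P1 * \<psi> y + (\<psi> y)\<^sup>2)" for y
  proof -
    have ck: "continuous_on UNIV (\<lambda>x. k x y / ?\<beta> x)" by (intro continuous_div_B \<mu> continuous_k_comp continuous_intros)
    have ix: "integrable \<mu> (\<lambda>x. g x * (k x y / ?\<beta> x))" if "continuous_on UNIV g" for g
      by (intro integrable_continuous \<mu> continuous_on_mult that ck)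
    have v: "(\<integral>x. g x * (k x y / ?\<beta> x) \<partial>\<mu>) = incl (kernel_mean \<mu> (\<lambda>x. g x / ?\<beta> x)) y" if "continuous_on UNIV g" for g
      by (subst incl_kernel_mean[OF \<mu> continuous_div_B(1)[OF \<mu> that]]) simp
    \<comment> \<open>The first factor is nonnegative since \<open>incl (B \<mu>)\<close> is at most
      1, whence dividing by it only increases the kernel above \<open>kmin\<close>.\<close>
    have "0 \<le> (\<integral>x. (k x y / ?\<beta> x / ?\<beta> y - \<delta>) * (\<psi> x - \<psi> y)\<^sup>2 \<partial>\<mu>)"
    proof (intro integral_nonneg_AE AE_I2 mult_nonneg_nonneg)
      fix x
      have "?\<beta> x * ?\<beta> y \<le> 1 * 1" using pos(1)[of x] pos(1)[of y] B_facts(6)[OF \<mu>] by (intro mult_mono) (auto simp: less_imp_le)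
      then have "kmin * (?\<beta> x * ?\<beta> y) \<le> k x y * 1"
        using kmin kmin(3)[of x y] pos(1)[of x] pos(1)[of y] by (intro mult_mono) (auto simp: less_imp_le k_pos)
      moreover have "\<delta> * (?\<beta> x * ?\<beta> y) \<le> kmin * (?\<beta> x * ?\<beta> y)"
        using d pos(1)[of x] pos(1)[of y] by (intro mult_right_mono) (auto simp: less_imp_le)
      ultimately have "\<delta> * (?\<beta> x * ?\<beta> y) \<le> k x y" by simp
      then show "0 \<le> k x y / ?\<beta> x / ?\<beta> y - \<delta>" using pos(1)[of x] pos(1)[of y] by (simp add: field_simps)
    qed simp
    also have "(\<lambda>x. (k x y / ?\<beta> x / ?\<beta> y - \<delta>) * (\<psi> x - \<psi> y)\<^sup>2) =
       (\<lambda>x. (1 / ?\<beta> y) * ((\<psi> x)\<^sup>2 * (k x y / ?\<beta> x)) - (2 * \<psi> y / ?\<beta> y) * (\<psi> x * (k x y / ?\<beta> x))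
         + ((\<psi> y)\<^sup>2 / ?\<beta> y) * (1 * (k x y / ?\<beta> x)) - (\<delta> * (\<psi> x)\<^sup>2 - (2 * \<delta> * \<psi> y) * \<psi> x + \<delta> * (\<psi> y)\<^sup>2))"
      using pos(2) by (simp add: fun_eq_iff power2_eq_square field_simps)
    also have "(\<integral>x. \<dots> x \<partial>\<mu>) = (1 / ?\<beta> y) * incl q y - (2 * \<psi> y / ?\<beta> y) * incl (transport_op \<mu> b) y
        + ((\<psi> y)\<^sup>2 / ?\<beta> y) * incl (B \<mu>) y - (\<delta> * P2 - (2 * \<delta> * \<psi> y) * P1 + \<delta> * (\<psi> y)\<^sup>2)"
    proof -
      have comb: "(\<integral>x. p * f1 x - q' * f2 x + r * f3 x - (s * f4 x - t * f5 x + w) \<partial>\<mu>) =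
          p * (\<integral>x. f1 x \<partial>\<mu>) - q' * (\<integral>x. f2 x \<partial>\<mu>) + r * (\<integral>x. f3 x \<partial>\<mu>) - (s * (\<integral>x. f4 x \<partial>\<mu>) - t * (\<integral>x. f5 x \<partial>\<mu>) + w)"
        if "integrable \<mu> f1" "integrable \<mu> f2" "integrable \<mu> f3" "integrable \<mu> f4" "integrable \<mu> f5"
        for p q' r s t w :: real and f1 f2 f3 f4 f5 :: "'a \<Rightarrow> real"
        using that by (simp add: prob_space)
      show ?thesis
        by (rule trans[OF comb[OF ix[OF cp2] ix[OF cp] ix[OF continuous_on_const[of _ 1]] i(2) i(1)]])
          (simp only: v[OF cp2] v[OF cp] v[OF continuous_on_const[of _ 1]] q_def[symmetric] Mop[symmetric]
            B_eq_kernel_mean[OF \<mu>, symmetric] P1_def[symmetric] P2_def[symmetric])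
    qed
    finally show ?thesis using pos(2)[of y] by (simp add: algebra_simps)
  qed
  have iq: "integrable \<mu> (\<lambda>y. incl q y / ?\<beta> y)" "integrable \<mu> (\<lambda>y. \<psi> y * incl (transport_op \<mu> b) y / ?\<beta> y)"
    by (intro integrable_continuous \<mu> continuous_div_B continuous_incl continuous_on_mult cp)+
  have "0 \<le> (\<integral>y. incl q y / ?\<beta> y - 2 * (\<psi> y * incl (transport_op \<mu> b) y / ?\<beta> y) + (\<psi> y)\<^sup>2 - \<delta> * (P2 - 2 * P1 * \<psi> y + (\<psi> y)\<^sup>2) \<partial>\<mu>)"
    using pt by (intro integral_nonneg_AE) auto
  also have "\<dots> = (\<integral>y. incl q y / ?\<beta> y \<partial>\<mu>) - 2 * (\<integral>y. \<psi> y * incl (transport_op \<mu> b) y / ?\<beta> y \<partial>\<mu>) + P2 - \<delta> * (P2 - 2 * P1 * P1 + P2)"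
  proof -
    have comb: "(\<integral>x. f1 x - 2 * f2 x + f3 x - \<delta> * (p - t * f4 x + f3 x) \<partial>\<mu>) =
        (\<integral>x. f1 x \<partial>\<mu>) - 2 * (\<integral>x. f2 x \<partial>\<mu>) + (\<integral>x. f3 x \<partial>\<mu>) - \<delta> * (p - t * (\<integral>x. f4 x \<partial>\<mu>) + (\<integral>x. f3 x \<partial>\<mu>))"
      if "integrable \<mu> f1" "integrable \<mu> f2" "integrable \<mu> f3" "integrable \<mu> f4"
      for p t :: real and f1 f2 f3 f4 :: "'a \<Rightarrow> real"
      using that by (simp add: prob_space)
    show ?thesis unfolding comb[OF iq i(2) i(1)] P1_def[symmetric] P2_def[symmetric] ..
  qed
  also have "(\<integral>y. incl q y / ?\<beta> y \<partial>\<mu>) = inner (B \<mu>) q"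
    using B_facts(7)[OF \<mu>, of q] by (simp add: inner_commute)
  also have "\<dots> = P2"
    unfolding q_def inner_kernel_mean[OF \<mu> continuous_div_B(1)[OF \<mu> cp2]] P2_def using pos(2) by simp
  also have "(\<integral>y. \<psi> y * incl (transport_op \<mu> b) y / ?\<beta> y \<partial>\<mu>) = (norm (transport_op \<mu> b))\<^sup>2"
    unfolding power2_norm_eq_inner inner_transport_op[OF \<mu>, of "transport_op \<mu> b" b] \<psi>_def by (simp add: power2_eq_square)
  finally show ?thesis unfolding P1[symmetric] P2[symmetric] by (simp add: power2_eq_square algebra_simps)
qed

lemma transport_op_norm_le:
  assumes \<mu>: "radon_prob \<mu>"
  shows "norm (transport_op \<mu> b) \<le> norm b"
proof -
  have "(norm (transport_op \<mu> b))\<^sup>2 \<le> inner b (transport_op \<mu> b)" using transport_op_Doeblin[OF \<mu>, of 0 b] kmin by simp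
  also have "\<dots> \<le> norm b * norm (transport_op \<mu> b)" by (rule norm_cauchy_schwarz)
  finally show ?thesis by (cases "norm (transport_op \<mu> b) = 0") (auto simp: power2_eq_square)
qed

text \<open>Doeblin's estimate with the largest allowed constant \<open>kmin\<close>; orthogonality
  to \<open>B \<mu>\<close> removes its rank-one term.\<close>

lemma transport_op_gap:
  assumes \<mu>: "radon_prob \<mu>" and b: "inner b (B \<mu>) = 0"
  shows "norm (transport_op \<mu> b) \<le> (1 - kmin) * norm b"
proof -
  have "(norm (transport_op \<mu> b))\<^sup>2 \<le> (1 - kmin) * inner b (transport_op \<mu> b)" using transport_op_Doeblin[OF \<mu>, of kmin b] kmin b by simp
  also have "\<dots> \<le> (1 - kmin) * (norm b * norm (transport_op \<mu> b))" using kmin by (intro mult_left_mono norm_cauchy_schwarz) auto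
  finally have "norm (transport_op \<mu> b) * norm (transport_op \<mu> b) \<le> ((1 - kmin) * norm b) * norm (transport_op \<mu> b)" by (simp add: power2_eq_square)
  moreover have "0 \<le> (1 - kmin) * norm b" using kmin by simp
  ultimately show ?thesis
    by (metis linorder_not_le mult_less_cancel_right_pos norm_ge_zero order_le_less)
qed

lemma transport_op_bounded_linear: "radon_prob \<mu> \<Longrightarrow> bounded_linear (transport_op \<mu>)"
  by (rule bounded_linear_intro[of _ 1]) (simp_all add: transport_op_linear transport_op_norm_le)

section \<open>Powers of the transported operator and the Neumann series\<close>

lemma pow_linear:
  assumes \<mu>: "radon_prob \<mu>"
  shows "(transport_op \<mu> ^^ n) (b + b') = (transport_op \<mu> ^^ n) b + (transport_op \<mu> ^^ n) b'" "(transport_op \<mu> ^^ n) (r *\<^sub>R b) = r *\<^sub>R (transport_op \<mu> ^^ n) b"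
  by (induction n) (simp_all add: transport_op_linear[OF \<mu>])

lemma pow_norm_le: "radon_prob \<mu> \<Longrightarrow> norm ((transport_op \<mu> ^^ n) b) \<le> norm b"
  by (induction n) (auto intro: order_trans[OF transport_op_norm_le])

lemma pow_sym: "radon_prob \<mu> \<Longrightarrow> inner h ((transport_op \<mu> ^^ n) b) = inner ((transport_op \<mu> ^^ n) h) b"
proof (induction n arbitrary: b)
  case (Suc n)
  then show ?case by (simp add: transport_op_sym funpow_swap1)
qed simp

text \<open>By symmetry half of the factors move to the other side: an even power gives a squared
  norm, an odd power leaves one positive semidefinite factor in the middle.\<close>

lemma pow_psd:
  assumes \<mu>: "radon_prob \<mu>"
  shows "0 \<le> inner b ((transport_op \<mu> ^^ n) b)"
proof (cases "even n")
  case True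
  then obtain j where "n = j + j" by (metis evenE mult_2)
  then show ?thesis using pow_sym[OF \<mu>, of b j "(transport_op \<mu> ^^ j) b"] by (simp add: funpow_add)
next
  case False
  then obtain j where "n = j + Suc j" by (metis oddE mult_2 Suc_eq_plus1 add_Suc_right)
  then show ?thesis using pow_sym[OF \<mu>, of b j "transport_op \<mu> ((transport_op \<mu> ^^ j) b)"] transport_op_psd[OF \<mu>, of "(transport_op \<mu> ^^ j) b"]
    by (simp add: funpow_add funpow_swap1)
qed

lemma pow_gap:
  assumes \<mu>: "radon_prob \<mu>" and b: "inner b (B \<mu>) = 0"
  shows "inner ((transport_op \<mu> ^^ n) b) (B \<mu>) = 0" "norm ((transport_op \<mu> ^^ n) b) \<le> (1 - kmin) ^ n * norm b"
proof -
  show o: "inner ((transport_op \<mu> ^^ n) b) (B \<mu>) = 0" for n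
    by (induction n) (simp_all add: b transport_op_sym[OF \<mu>, symmetric] transport_op_B[OF \<mu>])
  show "norm ((transport_op \<mu> ^^ n) b) \<le> (1 - kmin) ^ n * norm b"
  proof (induction n)
    case (Suc n)
    have "norm ((transport_op \<mu> ^^ Suc n) b) \<le> (1 - kmin) * norm ((transport_op \<mu> ^^ n) b)" using transport_op_gap[OF \<mu> o[of n]] by simp
    also have "\<dots> \<le> (1 - kmin) * ((1 - kmin) ^ n * norm b)" using Suc kmin by (intro mult_left_mono) auto
    finally show ?case by simp
  qed simp
qed

text \<open>The exponents start at 1 because the pairing of \<open>a\<^sub>\<mu> b\<close> and
  \<open>a\<^sub>\<mu> h\<close> in the L2 space of \<mu> is
  \<open>inner b (transport_op \<mu> h)\<close>, with one more factor than the Neumann series of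
  \<open>h\<close>.\<close>

definition tensor_sum :: "'a measure \<Rightarrow> nat \<Rightarrow> 'h \<Rightarrow> real" where
  "tensor_sum \<mu> N b = (norm b)\<^sup>2 + 2 * (\<Sum>j<N. inner b ((transport_op \<mu> ^^ Suc j) b))"

lemma tensor_sum_ge: "radon_prob \<mu> \<Longrightarrow> (norm b)\<^sup>2 \<le> tensor_sum \<mu> N b"
  unfolding tensor_sum_def using pow_psd by (simp add: sum_nonneg del: funpow.simps)

lemma tensor_sum_nonneg: "radon_prob \<mu> \<Longrightarrow> 0 \<le> tensor_sum \<mu> N b"
  using tensor_sum_ge[of \<mu> b N] by (meson order_trans zero_le_power2)

lemma tensor_sum_mono: "radon_prob \<mu> \<Longrightarrow> N \<le> N' \<Longrightarrow> tensor_sum \<mu> N b \<le> tensor_sum \<mu> N' b"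
  unfolding tensor_sum_def using pow_psd by (simp add: sum_mono2 del: funpow.simps)

lemma tensor_sum_mid:
  assumes \<mu>: "radon_prob \<mu>"
  shows "tensor_sum \<mu> N ((1/2) *\<^sub>R (b + b')) \<le> (1/2) * tensor_sum \<mu> N b + (1/2) * tensor_sum \<mu> N b'"
proof -
  have q: "inner ((1/2) *\<^sub>R (b + b')) ((transport_op \<mu> ^^ n) ((1/2) *\<^sub>R (b + b'))) \<le>
      (1/2) * inner b ((transport_op \<mu> ^^ n) b) + (1/2) * inner b' ((transport_op \<mu> ^^ n) b')" for n
  proof -
    have m: "(transport_op \<mu> ^^ n) (b - b') = (transport_op \<mu> ^^ n) b - (transport_op \<mu> ^^ n) b'"
      using pow_linear(1)[OF \<mu>, of n "b - b'" b'] by simp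
    have "0 \<le> inner (b - b') ((transport_op \<mu> ^^ n) (b - b'))" by (rule pow_psd[OF \<mu>])
    then show ?thesis unfolding m pow_linear[OF \<mu>] by (simp add: inner_simps field_simps)
  qed
  have "tensor_sum \<mu> N ((1/2) *\<^sub>R (b + b')) \<le> ((1/2) * (norm b)\<^sup>2 + (1/2) * (norm b')\<^sup>2) +
      2 * (\<Sum>j<N. (1/2) * inner b ((transport_op \<mu> ^^ Suc j) b) + (1/2) * inner b' ((transport_op \<mu> ^^ Suc j) b'))"
    unfolding tensor_sum_def
  proof (intro add_mono mult_left_mono sum_mono q)
    show "(norm ((1/2) *\<^sub>R (b + b')))\<^sup>2 \<le> (1/2) * (norm b)\<^sup>2 + (1/2) * (norm b')\<^sup>2"
      unfolding power2_norm_eq_inner using q[of 0] by (simp only: funpow_0)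
  qed simp
  also have "\<dots> = (1/2) * tensor_sum \<mu> N b + (1/2) * tensor_sum \<mu> N b'"
    unfolding tensor_sum_def sum.distrib sum_distrib_left[symmetric] by (simp add: algebra_simps)
  finally show ?thesis .
qed

text \<open>The Neumann series \<open>h\<close> gives the explicit representative
  \<open>u0 = a\<^sub>\<mu> h\<close> of the inverse. The representative \<open>u\<close> chosen in
  \<open>g_tensor\<close> may differ from it, but symmetry of \<open>K\<^sub>\<mu>\<close> moves the
  operator from \<open>u0\<close> to \<open>u\<close>, so the pairing with \<psi> agrees for both.
  This avoids classifying all representatives.\<close>

theorem g_tensor_limit:
  assumes \<mu>: "radon_prob \<mu>" and b: "inner b (B \<mu>) = 0"
  shows "(\<lambda>N. \<epsilon> / 2 * tensor_sum \<mu> N b) \<longlonglongrightarrow> g_tensor \<epsilon> c incl \<mu> b"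
    and "g_tensor \<epsilon> c incl \<mu> b \<le> \<epsilon> / 2 * (1 + 2 / kmin) * (norm b)\<^sup>2"
proof -
  interpret prob_space \<mu> using \<mu> by (simp add: radon_prob_def)
  let ?\<beta> = "incl (B \<mu>)"
  have pos: "?\<beta> x \<noteq> 0" for x using B_facts(4)[OF \<mu>, of x] by auto
  have geo: "summable (\<lambda>n. (1 - kmin) ^ n * norm b)" "(\<Sum>n. (1 - kmin) ^ n * norm b) = norm b / kmin"
    using kmin by (auto intro!: summable_mult2 summable_geometric simp: suminf_mult2[symmetric] suminf_geometric)
  have sm: "summable (\<lambda>n. (transport_op \<mu> ^^ n) b)"
    by (rule summable_comparison_test'[OF geo(1), of 0]) (use pow_gap(2)[OF \<mu> b] in auto)
  define h where "h = (\<Sum>n. (transport_op \<mu> ^^ n) b)"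
  have hn: "norm h \<le> norm b / kmin"
  proof -
    have sn: "summable (\<lambda>n. norm ((transport_op \<mu> ^^ n) b))"
      by (rule summable_comparison_test'[OF geo(1), of 0]) (use pow_gap(2)[OF \<mu> b] in auto)
    have "norm h \<le> (\<Sum>n. norm ((transport_op \<mu> ^^ n) b))" unfolding h_def by (rule summable_norm[OF sn])
    also have "\<dots> \<le> (\<Sum>n. (1 - kmin) ^ n * norm b)" by (intro suminf_le pow_gap(2)[OF \<mu> b] sn geo(1))
    finally show ?thesis by (simp add: geo(2))
  qed
  have sM: "(\<lambda>n. (transport_op \<mu> ^^ Suc n) b) sums transport_op \<mu> h"
    using bounded_linear.sums[OF transport_op_bounded_linear[OF \<mu>] summable_sums[OF sm]] by (simp add: h_def)
  have hM: "h = b + transport_op \<mu> h"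
    using suminf_split_head[OF sm] sums_unique[OF sM] by (simp add: h_def)
  have lim: "(\<lambda>N. tensor_sum \<mu> N b) \<longlonglongrightarrow> (norm b)\<^sup>2 + 2 * inner b (transport_op \<mu> h)"
  proof -
    have "(\<lambda>n. inner b ((transport_op \<mu> ^^ Suc n) b)) sums inner b (transport_op \<mu> h)"
      by (rule bounded_linear.sums[OF bounded_linear_inner_right sM])
    then show ?thesis unfolding tensor_sum_def sums_def by (intro tendsto_intros)
  qed
  define \<psi> where "\<psi> = (\<lambda>x. a_fun \<epsilon> c \<mu> x * incl b x)"
  have psi: "\<psi> = (\<lambda>x. incl b x / ?\<beta> x)" by (simp add: \<psi>_def B_facts(3)[OF \<mu>])
  define u0 where "u0 x = incl h x / ?\<beta> x" for x
  have cu0: "continuous_on UNIV u0" unfolding u0_def by (intro continuous_div_B \<mu> continuous_incl)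
  have cpsi: "continuous_on UNIV \<psi>" unfolding psi by (intro continuous_div_B \<mu> continuous_incl)
  \<comment> \<open>For every integrable \<open>u\<close>, even a discontinuous one,
    \<open>Su u\<close> lies in the RKHS and \<open>K_op \<epsilon> c \<mu> u\<close> is its
    quotient by \<open>incl (B \<mu>)\<close>; hence the image of \<open>u\<close> is
    continuous.\<close>
  define Su where "Su u = (\<integral>x. (u x / ?\<beta> x) *\<^sub>R kap x \<partial>\<mu>)" for u
  have Su: "inner g (Su u) = (\<integral>x. u x / ?\<beta> x * incl g x \<partial>\<mu>)" "K_op \<epsilon> c \<mu> u y = incl (Su u) y / ?\<beta> y"
    if u: "integrable \<mu> u" for u g y
  proof -
    have [measurable]: "u \<in> borel_measurable \<mu>" using u by auto
    have [measurable]: "?\<beta> \<in> borel_measurable \<mu>" "kap \<in> borel_measurable \<mu>"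
      by (intro measurable_continuous \<mu> continuous_incl continuous_kap)+
    have "integrable \<mu> (\<lambda>x. (u x / ?\<beta> x) *\<^sub>R kap x)"
    proof (rule Bochner_Integration.integrable_bound)
      show "integrable \<mu> (\<lambda>x. (1 / bmin) * norm (u x))" using u by auto
      show "AE x in \<mu>. norm ((u x / ?\<beta> x) *\<^sub>R kap x) \<le> norm ((1 / bmin) * norm (u x))"
      proof (rule AE_I2)
        fix x
        have "norm ((u x / ?\<beta> x) *\<^sub>R kap x) \<le> norm (u x / ?\<beta> x) * 1"
          using mult_left_mono[OF norm_kap[of x], of "norm (u x / ?\<beta> x)"] by simp
        also have "\<dots> \<le> \<bar>u x\<bar> / bmin"
          using B_facts(5)[OF \<mu>, of x] bmin_pos by (simp add: abs_divide frac_le)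
        finally show "norm ((u x / ?\<beta> x) *\<^sub>R kap x) \<le> norm ((1 / bmin) * norm (u x))" using bmin_pos by simp
      qed
    qed measurable
    then show 1: "inner g (Su u) = (\<integral>x. u x / ?\<beta> x * incl g x \<partial>\<mu>)" for g
      unfolding Su_def by (subst integral_inner_right[symmetric]) (simp_all add: incl_eq)
    have "incl (Su u) y = (\<integral>x. u x / ?\<beta> x * k x y \<partial>\<mu>)"
      using 1[of "kap y"] by (simp add: incl_eq[of "Su u"] inner_commute incl_kap k_sym[of y])
    then show "K_op \<epsilon> c \<mu> u y = incl (Su u) y / ?\<beta> y"
      unfolding K_op_def k_mu_def B_facts(3)[OF \<mu>]
      by (simp add: integral_divide_zero[symmetric] mult.commute mult.left_commute del: integral_divide_zero)
  qed
  have iu0: "integrable \<mu> u0" by (intro integrable_continuous \<mu> cu0)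
  have Su0: "Su u0 = transport_op \<mu> h"
    unfolding Su_def transport_op_def kernel_mean_def u0_def by (simp add: power2_eq_square)
  have u0: "u0 x - K_op \<epsilon> c \<mu> u0 x = \<psi> x" for x
  proof -
    have "u0 x - K_op \<epsilon> c \<mu> u0 x = incl (h - transport_op \<mu> h) x / ?\<beta> x"
      unfolding Su(2)[OF iu0] Su0 by (simp add: u0_def incl_simps diff_divide_distrib)
    also have "h - transport_op \<mu> h = b" using hM by (metis add_diff_cancel_right')
    finally show ?thesis by (simp add: psi)
  qed
  have "u0 \<in> id_minus_K_inv \<epsilon> c \<mu> \<psi>"
    unfolding id_minus_K_inv_def L2_fun_def
    using measurable_continuous[OF \<mu> cu0] integrable_continuous[OF \<mu> continuous_on_power[OF cu0]]
    by (auto intro!: exI[of _ 0] simp: u0)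
  then have "(SOME u. u \<in> id_minus_K_inv \<epsilon> c \<mu> \<psi>) \<in> id_minus_K_inv \<epsilon> c \<mu> \<psi>" by (rule someI[of "\<lambda>u. u \<in> id_minus_K_inv \<epsilon> c \<mu> \<psi>"])
  moreover define u where "u = (SOME u. u \<in> id_minus_K_inv \<epsilon> c \<mu> \<psi>)"
  ultimately obtain r where um[measurable]: "u \<in> borel_measurable \<mu>" and u2: "integrable \<mu> (\<lambda>x. (u x)\<^sup>2)"
    and ur: "AE x in \<mu>. u x - K_op \<epsilon> c \<mu> u x = \<psi> x + r"
    unfolding id_minus_K_inv_def L2_fun_def by auto
  have iu: "integrable \<mu> u"
  proof (rule Bochner_Integration.integrable_bound)
    show "integrable \<mu> (\<lambda>x. 1 + (u x)\<^sup>2)" using u2 by auto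
    have "\<bar>z\<bar> \<le> 1 + z\<^sup>2" for z :: real
      using zero_le_power2[of "\<bar>z\<bar> - 1"] by (simp add: power2_eq_square algebra_simps)
    then show "AE x in \<mu>. norm (u x) \<le> norm (1 + (u x)\<^sup>2)" by (simp add: abs_of_nonneg)
  qed (rule um)
  have cK: "continuous_on UNIV (\<lambda>x. K_op \<epsilon> c \<mu> u x)" unfolding Su(2)[OF iu] by (intro continuous_div_B \<mu> continuous_incl)
  have iK: "integrable \<mu> (\<lambda>x. K_op \<epsilon> c \<mu> u x)" by (intro integrable_continuous \<mu> cK)
  have ipsi: "integrable \<mu> \<psi>" by (intro integrable_continuous \<mu> cpsi)
  have [measurable]: "\<psi> \<in> borel_measurable \<mu>" "u0 \<in> borel_measurable \<mu>" "(\<lambda>x. K_op \<epsilon> c \<mu> u x) \<in> borel_measurable \<mu>"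
    using ipsi iu0 iK by auto
  have ct: "integrable \<mu> (\<lambda>x. f x * u x)" if "continuous_on UNIV f" for f
  proof -
    have "bounded (f ` UNIV)" using that compact_X by (intro compact_imp_bounded compact_continuous_image) auto
    then obtain F where F: "\<And>x. norm (f x) \<le> F" by (auto simp: bounded_iff)
    have [measurable]: "f \<in> borel_measurable \<mu>" by (rule measurable_continuous[OF \<mu> that])
    show ?thesis
    proof (rule Bochner_Integration.integrable_bound)
      show "integrable \<mu> (\<lambda>x. F * norm (u x))" using iu by auto
      have "norm (f x * u x) \<le> norm (F * norm (u x))" for x
        using mult_right_mono[OF F[of x], of "norm (u x)"] by (simp add: abs_mult) (meson abs_ge_self order_trans mult_right_mono abs_ge_zero)
      then show "AE x in \<mu>. norm (f x * u x) \<le> norm (F * norm (u x))" by simp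
    qed measurable
  qed
  \<comment> \<open>Integrate the equation: \<open>K\<^sub>\<mu>\<close> preserves integrals by the
    normalization of the potential, and \<psi> has mean zero because \<open>b\<close> is orthogonal
    to \<open>B \<mu>\<close>.\<close>
  have "r = 0"
  proof -
    have "(\<integral>x. u x - K_op \<epsilon> c \<mu> u x \<partial>\<mu>) = (\<integral>x. \<psi> x + r \<partial>\<mu>)"
      using ur by (intro integral_cong_AE) auto
    then have "(\<integral>x. u x \<partial>\<mu>) - (\<integral>x. K_op \<epsilon> c \<mu> u x \<partial>\<mu>) = (\<integral>x. \<psi> x \<partial>\<mu>) + r"
      using iu iK ipsi by (simp add: prob_space)
    moreover have "(\<integral>x. \<psi> x \<partial>\<mu>) = 0" using b B_facts(7)[OF \<mu>, of b] by (simp add: psi)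
    moreover have "(\<integral>x. K_op \<epsilon> c \<mu> u x \<partial>\<mu>) = (\<integral>x. u x \<partial>\<mu>)"
    proof -
      have "(\<integral>x. K_op \<epsilon> c \<mu> u x \<partial>\<mu>) = inner (B \<mu>) (Su u)"
        unfolding Su(2)[OF iu] B_facts(7)[OF \<mu>, symmetric] by (rule inner_commute)
      also have "\<dots> = (\<integral>x. u x \<partial>\<mu>)" unfolding Su(1)[OF iu] using pos by simp
      finally show ?thesis .
    qed
    ultimately show ?thesis by simp
  qed
  have sym: "(\<integral>x. K_op \<epsilon> c \<mu> u0 x * u x \<partial>\<mu>) = (\<integral>x. u0 x * K_op \<epsilon> c \<mu> u x \<partial>\<mu>)"
  proof -
    have "(\<integral>x. K_op \<epsilon> c \<mu> u0 x * u x \<partial>\<mu>) = inner (transport_op \<mu> h) (Su u)"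
      unfolding Su(2)[OF iu0] Su0 Su(1)[OF iu] by (simp add: mult.commute)
    also have "\<dots> = inner (Su u) (transport_op \<mu> h)" by (rule inner_commute)
    also have "\<dots> = (\<integral>x. u0 x * K_op \<epsilon> c \<mu> u x \<partial>\<mu>)"
      unfolding inner_transport_op[OF \<mu>] Su(2)[OF iu] u0_def by (simp add: power2_eq_square)
    finally show ?thesis .
  qed
  have cK0: "continuous_on UNIV (\<lambda>x. K_op \<epsilon> c \<mu> u0 x)"
    unfolding Su(2)[OF iu0] by (intro continuous_div_B \<mu> continuous_incl)
  have "(\<integral>x. \<psi> x * u x \<partial>\<mu>) = (\<integral>x. u0 x * u x - K_op \<epsilon> c \<mu> u0 x * u x \<partial>\<mu>)"
    by (intro Bochner_Integration.integral_cong) (auto simp: u0[symmetric] algebra_simps)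
  also have "\<dots> = (\<integral>x. u0 x * u x \<partial>\<mu>) - (\<integral>x. u0 x * K_op \<epsilon> c \<mu> u x \<partial>\<mu>)"
    using ct[OF cu0] ct[OF cK0] sym by simp
  also have "\<dots> = (\<integral>x. u0 x * u x - u0 x * K_op \<epsilon> c \<mu> u x \<partial>\<mu>)"
    using ct[OF cu0] integrable_continuous[OF \<mu> continuous_on_mult[OF cu0 cK]] by simp
  also have "\<dots> = (\<integral>x. u0 x * \<psi> x \<partial>\<mu>)"
  proof (rule integral_cong_AE)
    show "AE x in \<mu>. u0 x * u x - u0 x * K_op \<epsilon> c \<mu> u x = u0 x * \<psi> x"
      using ur unfolding \<open>r = 0\<close> by eventually_elim (metis add.right_neutral right_diff_distrib)
  qed measurable
  also have "\<dots> = inner b (transport_op \<mu> h)"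
    unfolding inner_transport_op[OF \<mu>] u0_def psi by (simp add: power2_eq_square)
  finally have main: "(\<integral>x. \<psi> x * u x \<partial>\<mu>) = inner b (transport_op \<mu> h)" .
  have g: "g_tensor \<epsilon> c incl \<mu> b = \<epsilon> / 2 * ((norm b)\<^sup>2 + 2 * inner b (transport_op \<mu> h))"
    unfolding g_tensor_def Let_def \<psi>_def[symmetric] u_def[symmetric] main ..
  show "(\<lambda>N. \<epsilon> / 2 * tensor_sum \<mu> N b) \<longlonglongrightarrow> g_tensor \<epsilon> c incl \<mu> b"
    unfolding g by (intro tendsto_mult_left lim)
  have "inner b (transport_op \<mu> h) \<le> norm b * norm (transport_op \<mu> h)" by (rule norm_cauchy_schwarz)
  also have "\<dots> \<le> norm b * (norm b / kmin)"
    using transport_op_norm_le[OF \<mu>, of h] hn by (intro mult_left_mono) auto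
  finally have "2 * inner b (transport_op \<mu> h) \<le> 2 * (norm b * (norm b / kmin))" by simp
  also have "\<dots> = (2 / kmin) * (norm b)\<^sup>2" by (simp add: power2_eq_square)
  finally have "(norm b)\<^sup>2 + 2 * inner b (transport_op \<mu> h) \<le> (1 + 2 / kmin) * (norm b)\<^sup>2"
    by (simp only: distrib_right mult_1 add_left_mono)
  then show "g_tensor \<epsilon> c incl \<mu> b \<le> \<epsilon> / 2 * (1 + 2 / kmin) * (norm b)\<^sup>2"
    unfolding g using eps_pos by (simp add: mult.assoc mult_left_mono)
qed

section \<open>Dependence of the metric tensor on the measure\<close>

lemma bmin_le_1: "radon_prob \<mu> \<Longrightarrow> bmin \<le> 1" for \<mu> :: "'a measure"
  using B_facts(5,6)[of \<mu> undefined] by simp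

text \<open>Integration against the measure \<alpha> with density \<open>a_fun\<close> relative to
  \<mu>. On RKHS functions it is the pairing with \<open>B \<mu>\<close>, hence the natural object
  to compare for nearby values of \<open>B\<close>.\<close>

definition scaled_integral :: "'a measure \<Rightarrow> ('a \<Rightarrow> real) \<Rightarrow> real" where
  "scaled_integral \<mu> g = (\<integral>x. g x / incl (B \<mu>) x \<partial>\<mu>)"

lemma scaled_integral_bound:
  assumes \<mu>: "radon_prob \<mu>" and g: "continuous_on UNIV g" and s: "\<And>x. \<bar>g x\<bar> \<le> s"
  shows "\<bar>scaled_integral \<mu> g\<bar> \<le> s / bmin"
proof -
  interpret prob_space \<mu> using \<mu> by (simp add: radon_prob_def)
  have i: "integrable \<mu> (\<lambda>x. g x / incl (B \<mu>) x)" by (intro integrable_continuous \<mu> continuous_div_B g)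
  have "\<bar>scaled_integral \<mu> g\<bar> \<le> (\<integral>x. \<bar>g x / incl (B \<mu>) x\<bar> \<partial>\<mu>)" unfolding scaled_integral_def by (rule integral_abs_bound)
  also have "\<dots> \<le> (\<integral>x. s / bmin \<partial>\<mu>)"
  proof (rule integral_mono)
    fix x
    have "0 \<le> s" using s[of x] by linarith
    then show "\<bar>g x / incl (B \<mu>) x\<bar> \<le> s / bmin"
      using s[of x] B_facts(4,5)[OF \<mu>, of x] bmin_pos by (simp add: abs_divide frac_le)
    show "integrable \<mu> (\<lambda>x. \<bar>g x / incl (B \<mu>) x\<bar>)" by (rule Bochner_Integration.integrable_abs[OF i])
  qed simp
  finally show ?thesis by (simp add: prob_space)
qed

lemma scaled_integral_diff:
  assumes \<mu>: "radon_prob \<mu>" and "continuous_on UNIV g" "continuous_on UNIV g'"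
  shows "scaled_integral \<mu> (\<lambda>x. g x - g' x) = scaled_integral \<mu> g - scaled_integral \<mu> g'"
proof -
  have "integrable \<mu> (\<lambda>x. g x / incl (B \<mu>) x)" "integrable \<mu> (\<lambda>x. g' x / incl (B \<mu>) x)"
    by (intro integrable_continuous continuous_div_B assms)+
  then show ?thesis by (simp add: scaled_integral_def diff_divide_distrib)
qed

lemma scaled_integral_incl: "radon_prob \<mu> \<Longrightarrow> scaled_integral \<mu> (incl h) = inner h (B \<mu>)"
  unfolding scaled_integral_def by (simp add: B_facts(7)[of \<mu> h])

text \<open>All Lipschitz functions (for the distance of the kernel functions) are approximated at once by a
  finite-dimensional subspace of the RKHS, on which \<open>scaled_integral \<mu>\<close> depends on \<open>B \<mu>\<close> only.\<close>

lemma scaled_integral_close: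
  assumes e: "0 < e"
  shows "\<exists>d>0. \<forall>\<mu> \<mu>' g G. radon_prob \<mu> \<longrightarrow> radon_prob \<mu>' \<longrightarrow> norm (B \<mu> - B \<mu>') < d \<longrightarrow>
    continuous_on UNIV g \<longrightarrow> (\<forall>x. \<bar>g x\<bar> \<le> G) \<longrightarrow> (\<forall>x y. \<bar>g x - g y\<bar> \<le> G * norm (kap x - kap y)) \<longrightarrow>
    \<bar>scaled_integral \<mu> g - scaled_integral \<mu>' g\<bar> \<le> e * G"
proof -
  \<comment> \<open>The approximation error will be \<open>2 * r * G\<close>, which after division
    by \<open>bmin\<close> is \<open>e * G / 4\<close> for each of the two measures; the other half
    of \<open>e * G\<close> is left for the change of \<open>B\<close>.\<close>
  define r where "r = e * bmin / 8"
  have r: "0 < r" using e bmin_pos by (simp add: r_def)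
  have op: "open {y. norm (kap y - kap x) < r}" for x
    by (intro open_Collect_less continuous_intros continuous_kap)
  obtain F where F: "finite F" "UNIV \<subseteq> (\<Union>x\<in>F. {y. norm (kap y - kap x) < r})"
  proof (rule compactE_image[OF compact_X, of UNIV "\<lambda>x. {y. norm (kap y - kap x) < r}"])
    show "UNIV \<subseteq> (\<Union>x. {y. norm (kap y - kap x) < r})" using r by auto
  qed (use op in auto)
  have "F \<noteq> {}" using F(2) by auto
  then have cF: "0 < card F" using F(1) by (simp add: card_gt_0_iff)
  \<comment> \<open>Tents around a finite net, normalized to the partition of unity
    \<open>pu\<close> and approximated in the RKHS by \<open>h i\<close>. The interpolant
    \<open>H\<close> of \<open>g\<close> is then bounded in norm by \<open>G * R\<close>, with
    \<open>R\<close> independent of \<open>g\<close> and of the measures.\<close>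
  define w where "w i y = max 0 (r - norm (kap y - kap i))" for i y
  have w0: "0 \<le> w i y" for i y by (simp add: w_def)
  have cw: "continuous_on UNIV (w i)" for i unfolding w_def by (intro continuous_intros continuous_kap)
  define W where "W y = (\<Sum>i\<in>F. w i y)" for y
  have Wp: "0 < W y" for y
  proof -
    obtain i where "i \<in> F" "norm (kap y - kap i) < r" using F(2) by blast
    then have "0 < w i y" by (simp add: w_def)
    then show ?thesis unfolding W_def using \<open>i \<in> F\<close> F(1) w0 by (metis sum_pos2)
  qed
  define pu where "pu i y = w i y / W y" for i y
  have cpu: "continuous_on UNIV (pu i)" for i
    unfolding pu_def
  proof (rule continuous_on_divide[OF cw])
    show "continuous_on UNIV W" unfolding W_def by (intro continuous_intros cw)
    show "\<forall>y\<in>UNIV. W y \<noteq> 0" using Wp by (metis less_irrefl)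
  qed
  have pu0: "0 \<le> pu i y" for i y unfolding pu_def using w0[of i y] Wp[of y] by simp
  have pus: "(\<Sum>i\<in>F. pu i y) = 1" for y
    unfolding pu_def sum_divide_distrib[symmetric] W_def[symmetric] using Wp[of y] by simp
  have "\<exists>h. \<forall>x. \<bar>incl h x - pu i x\<bar> < r / real (card F)" for i
    using univ cpu[of i] r cF unfolding universal_def by simp
  then obtain h where h: "\<And>i x. \<bar>incl (h i) x - pu i x\<bar> < r / real (card F)" by metis
  define R where "R = (\<Sum>i\<in>F. norm (h i))"
  have R: "0 \<le> R" unfolding R_def by (simp add: sum_nonneg)
  define d where "d = e / (2 * (R + 1))"
  have d: "0 < d" using e R by (simp add: d_def)
  have main: "\<bar>scaled_integral \<mu> g - scaled_integral \<mu>' g\<bar> \<le> e * G"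
    if \<mu>: "radon_prob \<mu>" and \<mu>': "radon_prob \<mu>'" and close: "norm (B \<mu> - B \<mu>') < d"
      and g: "continuous_on UNIV g" "\<And>x. \<bar>g x\<bar> \<le> G" "\<And>x y. \<bar>g x - g y\<bar> \<le> G * norm (kap x - kap y)"
    for \<mu> \<mu>' :: "'a measure" and g G
  proof -
    have G: "0 \<le> G" using g(2)[of undefined] by linarith
    define H where "H = (\<Sum>i\<in>F. g i *\<^sub>R h i)"
    have inclH: "incl H x = (\<Sum>i\<in>F. g i * incl (h i) x)" for x
      by (simp add: H_def incl_eq inner_sum_left)
    have err: "\<bar>g x - incl H x\<bar> \<le> 2 * r * G" for x
    proof -
      have "g x - incl H x = (\<Sum>i\<in>F. (g x - g i) * pu i x) + (\<Sum>i\<in>F. g i * (pu i x - incl (h i) x))"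
      proof -
        have "g x = (\<Sum>i\<in>F. g x * pu i x)" using pus[of x] by (simp add: sum_distrib_left[symmetric])
        then show ?thesis unfolding inclH
          by (simp add: sum_subtractf[symmetric] sum.distrib[symmetric] algebra_simps)
      qed
      also have "\<bar>\<dots>\<bar> \<le> (\<Sum>i\<in>F. \<bar>(g x - g i) * pu i x\<bar>) + (\<Sum>i\<in>F. \<bar>g i * (pu i x - incl (h i) x)\<bar>)"
        by (rule order_trans[OF abs_triangle_ineq add_mono[OF sum_abs sum_abs]])
      also have "\<dots> \<le> (\<Sum>i\<in>F. G * r * pu i x) + (\<Sum>i\<in>F. G * (r / real (card F)))"
      proof (intro add_mono sum_mono)
        fix i assume "i \<in> F"
        show "\<bar>(g x - g i) * pu i x\<bar> \<le> G * r * pu i x"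
        proof (cases "norm (kap x - kap i) < r")
          case True
          then have "G * norm (kap x - kap i) \<le> G * r" using G by (intro mult_left_mono) auto
          then have "\<bar>g x - g i\<bar> \<le> G * r" using g(3)[of x i] by linarith
          then show ?thesis using pu0[of i x] by (simp add: abs_mult mult_right_mono)
        next
          case False
          then have "pu i x = 0" by (simp add: pu_def w_def)
          then show ?thesis by simp
        qed
        have "\<bar>pu i x - incl (h i) x\<bar> \<le> r / real (card F)" using h[of i x] by linarith
        then show "\<bar>g i * (pu i x - incl (h i) x)\<bar> \<le> G * (r / real (card F))"
          unfolding abs_mult using g(2)[of i] G by (intro mult_mono) auto
      qed
      also have "(\<Sum>i\<in>F. G * r * pu i x) = G * r" using pus[of x] by (simp add: sum_distrib_left[symmetric])
      also have "(\<Sum>i\<in>F. G * (r / real (card F))) = G * r" using cF by simp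
      finally show ?thesis by (simp add: mult.commute)
    qed
    have near: "\<bar>scaled_integral \<nu> g - inner H (B \<nu>)\<bar> \<le> 2 * r * G / bmin" if \<nu>: "radon_prob \<nu>" for \<nu>
    proof -
      have "scaled_integral \<nu> g - inner H (B \<nu>) = scaled_integral \<nu> (\<lambda>x. g x - incl H x)"
        by (simp add: scaled_integral_diff[OF \<nu> g(1) continuous_incl] scaled_integral_incl[OF \<nu>])
      then show ?thesis using scaled_integral_bound[OF \<nu> _ err] g(1) continuous_incl by (simp add: continuous_on_diff)
    qed
    have nH: "norm H \<le> G * R"
    proof -
      have "norm H \<le> (\<Sum>i\<in>F. norm (g i *\<^sub>R h i))" unfolding H_def by (rule norm_sum)
      also have "\<dots> \<le> (\<Sum>i\<in>F. G * norm (h i))" using g(2) by (intro sum_mono) (simp add: mult_right_mono)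
      finally show ?thesis by (simp add: R_def sum_distrib_left)
    qed
    have "\<bar>inner H (B \<mu>) - inner H (B \<mu>')\<bar> \<le> norm H * norm (B \<mu> - B \<mu>')"
      unfolding inner_diff_right[symmetric] by (rule Cauchy_Schwarz_ineq2)
    also have "\<dots> \<le> (G * R) * d" using nH close by (intro mult_mono) (auto intro: mult_nonneg_nonneg G R)
    also have "\<dots> = G * (e / 2) * (R / (R + 1))" using R by (simp add: d_def field_simps)
    also have "\<dots> \<le> G * (e / 2) * 1" using G e R by (intro mult_left_mono) auto
    finally have n3: "\<bar>inner H (B \<mu>) - inner H (B \<mu>')\<bar> \<le> e * G / 2" by (simp add: mult.commute)
    have "2 * r * G / bmin = e * G / 4" using bmin_pos by (simp add: r_def)
    then have n12: "\<bar>scaled_integral \<mu> g - inner H (B \<mu>)\<bar> \<le> e * G / 4" "\<bar>scaled_integral \<mu>' g - inner H (B \<mu>')\<bar> \<le> e * G / 4"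
      using near[OF \<mu>] near[OF \<mu>'] by simp_all
    show ?thesis using n12 n3 unfolding abs_le_iff by linarith
  qed
  show ?thesis using d main by blast
qed

text \<open>Test against the difference \<open>h\<close> of the two images. Then
  \<open>inner h (transport_op \<mu> b)\<close> is the scaled integral of
  \<open>b * h / B \<mu>\<close>, whose Lipschitz constant is a multiple of
  \<open>norm b * norm h\<close>; hence \<open>scaled_integral_close\<close> is uniform in
  \<open>b\<close>. Changing the denominator to the other measure costs a uniform distance.
  Cancelling one factor \<open>norm h\<close> gives closeness in operator norm.\<close>

lemma transport_op_close:
  assumes e: "0 < e"
  shows "\<exists>d>0. \<forall>\<mu> \<mu>' b. radon_prob \<mu> \<longrightarrow> radon_prob \<mu>' \<longrightarrow> norm (B \<mu> - B \<mu>') < d \<longrightarrow>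
    norm (transport_op \<mu> b - transport_op \<mu>' b) \<le> e * norm b"
proof -
  \<comment> \<open>The product of two RKHS functions contributes \<open>2 * N\<close> and the
    reciprocal of \<open>B \<mu>\<close> contributes \<open>N\<close> to
    \<open>G = 3 * N / bmin\<^sup>2\<close>, so \<open>e1 * G\<close> is \<open>e / 2 * N\<close>;
    the choice of \<open>d\<close> gives the other half.\<close>
  define e1 where "e1 = e * bmin\<^sup>2 / 6"
  have e1: "0 < e1" using e bmin_pos by (simp add: e1_def)
  obtain d1 where d1: "0 < d1" and cl: "\<And>\<mu> \<mu>' g G. radon_prob \<mu> \<Longrightarrow> radon_prob \<mu>' \<Longrightarrow> norm (B \<mu> - B \<mu>') < d1 \<Longrightarrow>
    continuous_on UNIV g \<Longrightarrow> (\<And>x. \<bar>g x\<bar> \<le> G) \<Longrightarrow> (\<And>x y. \<bar>g x - g y\<bar> \<le> G * norm (kap x - kap y)) \<Longrightarrow>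
    \<bar>scaled_integral \<mu> g - scaled_integral \<mu>' g\<bar> \<le> e1 * G" using scaled_integral_close[OF e1] by metis
  define d where "d = min d1 (e * bmin ^ 3 / 2)"
  have d: "0 < d" using d1 e bmin_pos by (simp add: d_def)
  have main: "norm (transport_op \<mu> b - transport_op \<mu>' b) \<le> e * norm b"
    if \<mu>: "radon_prob \<mu>" and \<mu>': "radon_prob \<mu>'" and close: "norm (B \<mu> - B \<mu>') < d" for \<mu> \<mu>' :: "'a measure" and b
  proof -
    define h where "h = transport_op \<mu> b - transport_op \<mu>' b"
    define p where "p x = incl b x * incl h x" for x
    define N where "N = norm b * norm h"
    have N: "0 \<le> N" by (simp add: N_def)
    have pb: "\<bar>p x\<bar> \<le> N" for x
      unfolding p_def N_def abs_mult by (intro mult_mono incl_le) auto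
    have lip: "\<bar>incl g x - incl g y\<bar> \<le> norm g * norm (kap x - kap y)" for g x y
      using Cauchy_Schwarz_ineq2[of g "kap x - kap y"] by (simp add: incl_eq inner_diff_right)
    have pl: "\<bar>p x - p y\<bar> \<le> 2 * N * norm (kap x - kap y)" for x y
    proof -
      have "p x - p y = incl b x * (incl h x - incl h y) + (incl b x - incl b y) * incl h y"
        by (simp add: p_def algebra_simps)
      also have "\<bar>\<dots>\<bar> \<le> norm b * (norm h * norm (kap x - kap y)) + (norm b * norm (kap x - kap y)) * norm h"
      proof (rule order_trans[OF abs_triangle_ineq], rule add_mono)
        show "\<bar>incl b x * (incl h x - incl h y)\<bar> \<le> norm b * (norm h * norm (kap x - kap y))"
          unfolding abs_mult by (rule mult_mono[OF incl_le lip]) auto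
        show "\<bar>(incl b x - incl b y) * incl h y\<bar> \<le> (norm b * norm (kap x - kap y)) * norm h"
          unfolding abs_mult by (rule mult_mono[OF lip incl_le]) auto
      qed
      finally show ?thesis by (simp add: N_def algebra_simps)
    qed
    have cp: "continuous_on UNIV p" unfolding p_def by (intro continuous_intros continuous_incl)
    let ?b = "incl (B \<mu>)" and ?b' = "incl (B \<mu>')"
    have bp: "0 < ?b x" "bmin \<le> ?b x" "0 < ?b' x" "bmin \<le> ?b' x" for x
      using B_facts(4,5) \<mu> \<mu>' by auto
    define g where "g x = p x / ?b x" for x
    define g' where "g' x = p x / ?b' x" for x
    have cg: "continuous_on UNIV g" "continuous_on UNIV g'"
      unfolding g_def g'_def by (intro continuous_div_B \<mu> \<mu>' cp)+
    have inv: "\<bar>1 / u - 1 / v\<bar> \<le> \<bar>u - v\<bar> / bmin\<^sup>2" if "bmin \<le> u" "bmin \<le> v" for u v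
    proof -
      have p: "0 < u" "0 < v" using that bmin_pos by auto
      have "1 / u - 1 / v = (v - u) / (u * v)" using p by (simp add: field_simps)
      also have "\<bar>\<dots>\<bar> = \<bar>u - v\<bar> / (u * v)" using p by (simp add: abs_divide abs_minus_commute abs_mult)
      also have "\<dots> \<le> \<bar>u - v\<bar> / (bmin * bmin)"
        using p that bmin_pos by (intro divide_left_mono mult_mono) auto
      finally show ?thesis by (simp add: power2_eq_square)
    qed
    have b1: "bmin\<^sup>2 \<le> bmin" "bmin \<le> 1" using bmin_le_1[OF \<mu>] bmin_pos by (auto simp: power2_eq_square)
    define G where "G = 3 * N / bmin\<^sup>2"
    have gG: "\<bar>g x\<bar> \<le> G" for x
    proof -
      have "\<bar>g x\<bar> \<le> N / bmin" unfolding g_def abs_divide using pb[of x] bp(1,2)[of x] bmin_pos N by (intro frac_le) auto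
      also have "\<dots> \<le> (3 * N) / bmin\<^sup>2" using N b1 bmin_pos by (intro frac_le) auto
      finally show ?thesis by (simp add: G_def)
    qed
    have gl: "\<bar>g x - g y\<bar> \<le> G * norm (kap x - kap y)" for x y
    proof -
      let ?d = "norm (kap x - kap y)"
      have eq: "g x - g y = (p x - p y) / ?b x + p y * (1 / ?b x - 1 / ?b y)"
        by (simp add: g_def diff_divide_distrib algebra_simps)
      have "\<bar>g x - g y\<bar> \<le> (2 * N * ?d) / bmin\<^sup>2 + N * (?d / bmin\<^sup>2)"
        unfolding eq
      proof (rule order_trans[OF abs_triangle_ineq], rule add_mono)
        show "\<bar>(p x - p y) / ?b x\<bar> \<le> 2 * N * ?d / bmin\<^sup>2"
          unfolding abs_divide using pl[of x y] bp(1,2)[of x] b1 bmin_pos N by (intro frac_le) auto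
        have "\<bar>1 / ?b x - 1 / ?b y\<bar> \<le> \<bar>?b x - ?b y\<bar> / bmin\<^sup>2" by (rule inv[OF bp(2) bp(2)])
        also have "\<dots> \<le> ?d / bmin\<^sup>2" using lip[of "B \<mu>" x y] B_facts(2)[OF \<mu>] by (intro divide_right_mono) auto
        finally show "\<bar>p y * (1 / ?b x - 1 / ?b y)\<bar> \<le> N * (?d / bmin\<^sup>2)"
          unfolding abs_mult using pb[of y] by (intro mult_mono N) auto
      qed
      also have "\<dots> = G * ?d"
      proof -
        have "2 * N * ?d / z + N * (?d / z) = 3 * N / z * ?d" for z :: real
          by (cases "z = 0") (simp_all add: divide_simps)
        then show ?thesis by (simp only: G_def)
      qed
      finally show ?thesis .
    qed
    have c1: "\<bar>scaled_integral \<mu> g - scaled_integral \<mu>' g\<bar> \<le> e1 * G"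
      using close by (intro cl \<mu> \<mu>' cg gG gl) (simp add: d_def)
    have c2: "\<bar>scaled_integral \<mu>' (\<lambda>x. g x - g' x)\<bar> \<le> (N * (d / bmin\<^sup>2)) / bmin"
    proof (rule scaled_integral_bound[OF \<mu>'])
      show "continuous_on UNIV (\<lambda>x. g x - g' x)" by (intro continuous_intros cg)
      fix x
      have "g x - g' x = p x * (1 / ?b x - 1 / ?b' x)" by (simp add: g_def g'_def algebra_simps)
      moreover have "\<bar>1 / ?b x - 1 / ?b' x\<bar> \<le> d / bmin\<^sup>2"
      proof -
        have "\<bar>1 / ?b x - 1 / ?b' x\<bar> \<le> \<bar>?b x - ?b' x\<bar> / bmin\<^sup>2" by (rule inv[OF bp(2) bp(4)])
        also have "\<dots> \<le> d / bmin\<^sup>2"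
          using incl_le[of "B \<mu> - B \<mu>'" x] close by (intro divide_right_mono) (auto simp: incl_simps)
        finally show ?thesis .
      qed
      ultimately show "\<bar>g x - g' x\<bar> \<le> N * (d / bmin\<^sup>2)" using pb[of x] N by (simp only: abs_mult) (intro mult_mono, auto)
    qed
    have "inner h (transport_op \<mu> b) = scaled_integral \<mu> g" "inner h (transport_op \<mu>' b) = scaled_integral \<mu>' g'"
      unfolding inner_transport_op[OF \<mu>] inner_transport_op[OF \<mu>'] scaled_integral_def g_def g'_def p_def by (simp_all add: power2_eq_square)
    then have "inner h h = (scaled_integral \<mu> g - scaled_integral \<mu>' g) + scaled_integral \<mu>' (\<lambda>x. g x - g' x)"
      by (subst (2) h_def) (simp add: inner_diff_right scaled_integral_diff[OF \<mu>' cg])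
    also have "\<dots> \<le> e1 * G + (N * (d / bmin\<^sup>2)) / bmin" using c1 c2 by linarith
    also have "e1 * G = e / 2 * N" using bmin_pos by (simp add: e1_def G_def)
    also have "(N * (d / bmin\<^sup>2)) / bmin \<le> e / 2 * N"
    proof -
      have "d / bmin ^ 3 \<le> e / 2" using bmin_pos by (simp add: d_def pos_divide_le_eq)
      from mult_right_mono[OF this N] show ?thesis by (simp add: power2_eq_square power3_eq_cube mult.commute)
    qed
    finally have "norm h * norm h \<le> (e * norm b) * norm h"
      by (simp add: N_def power2_norm_eq_inner[symmetric] power2_eq_square)
    then have "norm h \<le> e * norm b"
      using e by (cases "norm h = 0") auto
    then show ?thesis by (simp add: h_def)
  qed
  show ?thesis using d main by blast
qed

text \<open>Replace one factor at a time: each replacement costs \<open>e\<close>, and the remaining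
  factors are contractions.\<close>

lemma pow_close:
  assumes \<mu>: "radon_prob \<mu>" and \<mu>': "radon_prob \<mu>'" and cl: "\<And>b. norm (transport_op \<mu> b - transport_op \<mu>' b) \<le> e * norm b"
  shows "norm ((transport_op \<mu> ^^ n) b - (transport_op \<mu>' ^^ n) b) \<le> real n * e * norm b"
proof (induction n)
  case (Suc n)
  let ?x = "(transport_op \<mu> ^^ n) b" and ?y = "(transport_op \<mu>' ^^ n) b"
  have lin: "transport_op \<mu>' (?x - ?y) = transport_op \<mu>' ?x - transport_op \<mu>' ?y"
    using transport_op_linear(1)[OF \<mu>', of "?x - ?y" ?y] by simp
  have e: "0 \<le> e * norm b" using cl[of b] norm_ge_zero order_trans by blast
  have "norm ((transport_op \<mu> ^^ Suc n) b - (transport_op \<mu>' ^^ Suc n) b) = norm ((transport_op \<mu> ?x - transport_op \<mu>' ?x) + transport_op \<mu>' (?x - ?y))"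
    unfolding lin by simp
  also have "\<dots> \<le> e * norm ?x + norm (?x - ?y)"
    by (intro norm_triangle_le add_mono cl transport_op_norm_le[OF \<mu>'])
  also have "\<dots> \<le> e * norm b + real n * e * norm b"
  proof (intro add_mono Suc)
    show "e * norm ?x \<le> e * norm b"
    proof (cases "norm b = 0")
      case True
      then show ?thesis using pow_norm_le[OF \<mu>, of n b] by simp
    next
      case False
      then have "0 \<le> e" using e by (simp add: zero_le_mult_iff)
      then show ?thesis using pow_norm_le[OF \<mu>, of n b] by (rule mult_left_mono[rotated])
    qed
  qed
  finally show ?case by (simp add: algebra_simps)
qed simp

lemma tensor_sum_close:
  assumes e: "0 < e"
  shows "\<exists>d>0. \<forall>\<mu> \<mu>' b. radon_prob \<mu> \<longrightarrow> radon_prob \<mu>' \<longrightarrow> norm (B \<mu> - B \<mu>') < d \<longrightarrow>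
    \<bar>tensor_sum \<mu> N b - tensor_sum \<mu>' N b\<bar> \<le> e * (norm b)\<^sup>2"
proof -
  define e1 where "e1 = e / (2 * (real N * real N + 1))"
  have D: "0 < 2 * (real N * real N + 1)" by (simp add: add_nonneg_pos)
  have e1: "0 < e1" using e D by (simp add: e1_def)
  obtain d where d: "0 < d" "\<And>\<mu> \<mu>' b. radon_prob \<mu> \<Longrightarrow> radon_prob \<mu>' \<Longrightarrow> norm (B \<mu> - B \<mu>') < d \<Longrightarrow>
    norm (transport_op \<mu> b - transport_op \<mu>' b) \<le> e1 * norm b" using transport_op_close[OF e1] by metis
  have main: "\<bar>tensor_sum \<mu> N b - tensor_sum \<mu>' N b\<bar> \<le> e * (norm b)\<^sup>2"
    if \<mu>: "radon_prob \<mu>" and \<mu>': "radon_prob \<mu>'" and close: "norm (B \<mu> - B \<mu>') < d" for \<mu> \<mu>' :: "'a measure" and b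
  proof -
    have "\<bar>inner b ((transport_op \<mu> ^^ Suc j) b) - inner b ((transport_op \<mu>' ^^ Suc j) b)\<bar> \<le> real N * e1 * (norm b)\<^sup>2" if "j < N" for j
    proof -
      have "\<bar>inner b ((transport_op \<mu> ^^ Suc j) b) - inner b ((transport_op \<mu>' ^^ Suc j) b)\<bar> \<le> norm b * norm ((transport_op \<mu> ^^ Suc j) b - (transport_op \<mu>' ^^ Suc j) b)"
        unfolding inner_diff_right[symmetric] by (rule Cauchy_Schwarz_ineq2)
      also have "\<dots> \<le> norm b * (real (Suc j) * e1 * norm b)"
        using d(2)[OF \<mu> \<mu>' close] by (intro mult_left_mono pow_close \<mu> \<mu>') auto
      also have "\<dots> \<le> norm b * (real N * e1 * norm b)"
        using that e1 by (intro mult_left_mono mult_right_mono) auto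
      finally show ?thesis by (simp add: power2_eq_square mult.commute mult.left_commute)
    qed
    then have "\<bar>\<Sum>j<N. inner b ((transport_op \<mu> ^^ Suc j) b) - inner b ((transport_op \<mu>' ^^ Suc j) b)\<bar> \<le> (\<Sum>j<N. real N * e1 * (norm b)\<^sup>2)"
      by (intro order_trans[OF sum_abs] sum_mono) auto
    moreover have "tensor_sum \<mu> N b - tensor_sum \<mu>' N b = 2 * (\<Sum>j<N. inner b ((transport_op \<mu> ^^ Suc j) b) - inner b ((transport_op \<mu>' ^^ Suc j) b))"
      unfolding tensor_sum_def sum_subtractf by simp
    ultimately have "\<bar>tensor_sum \<mu> N b - tensor_sum \<mu>' N b\<bar> \<le> (2 * (real N * real N) * e1) * (norm b)\<^sup>2"
      by (simp add: abs_mult)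
    also have "\<dots> \<le> e * (norm b)\<^sup>2"
    proof (rule mult_right_mono)
      have "2 * (real N * real N) * e1 \<le> 2 * (real N * real N + 1) * e1" using e1 by simp
      also have "\<dots> = e" using D by (simp add: e1_def)
      finally show "2 * (real N * real N) * e1 \<le> e" .
    qed simp
    finally show ?thesis .
  qed
  show ?thesis using d(1) main by blast
qed

text \<open>An arbitrary filter is allowed because \<open>tensor_sum_tendsto\<close> is used both
  for continuity at a point of a product set, in the measurability proof, and along
  sequences.\<close>

lemma transport_op_tendsto:
  assumes \<mu>: "radon_prob \<mu>" and ev: "\<forall>\<^sub>F x in F. radon_prob (m x)"
    and B: "((\<lambda>x. B (m x)) \<longlongrightarrow> B \<mu>) F" and b: "(b \<longlongrightarrow> l) F"
  shows "((\<lambda>x. transport_op (m x) (b x)) \<longlongrightarrow> transport_op \<mu> l) F"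
proof (rule tendstoI)
  fix e :: real assume e: "0 < e"
  define e1 where "e1 = e / (2 * (norm l + 1))"
  have e1: "0 < e1" using e by (simp add: e1_def add_nonneg_pos)
  obtain d where d: "0 < d" "\<And>\<mu> \<mu>' b. radon_prob \<mu> \<Longrightarrow> radon_prob \<mu>' \<Longrightarrow> norm (B \<mu> - B \<mu>') < d \<Longrightarrow>
    norm (transport_op \<mu> b - transport_op \<mu>' b) \<le> e1 * norm b" using transport_op_close[OF e1] by metis
  have "\<forall>\<^sub>F x in F. dist (B (m x)) (B \<mu>) < d" "\<forall>\<^sub>F x in F. dist (b x) l < e / 2"
    using tendstoD[OF B d(1)] tendstoD[OF b, of "e / 2"] e by auto
  with ev show "\<forall>\<^sub>F x in F. dist (transport_op (m x) (b x)) (transport_op \<mu> l) < e"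
  proof eventually_elim
    case (elim x)
    have lin: "transport_op (m x) (b x - l) = transport_op (m x) (b x) - transport_op (m x) l"
      using transport_op_linear(1)[OF elim(1), of "b x - l" l] by simp
    have "norm (transport_op (m x) l - transport_op \<mu> l) \<le> e1 * norm l" using elim d(2)[OF elim(1) \<mu>] by (simp add: dist_norm)
    also have "\<dots> \<le> e1 * (norm l + 1)" using e1 by simp
    also have "\<dots> = e / 2"
    proof -
      have "e / (2 * z) * z = e / 2" if "0 < z" for z :: real using that by simp
      from this[of "norm l + 1"] show ?thesis by (simp add: e1_def add_nonneg_pos)
    qed
    finally have 1: "norm (transport_op (m x) l - transport_op \<mu> l) \<le> e / 2" .
    have 2: "norm (transport_op (m x) (b x - l)) < e / 2" using transport_op_norm_le[OF elim(1), of "b x - l"] elim(3) by (simp add: dist_norm)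
    have "dist (transport_op (m x) (b x)) (transport_op \<mu> l) = norm (transport_op (m x) (b x - l) + (transport_op (m x) l - transport_op \<mu> l))"
      unfolding lin by (simp add: dist_norm)
    also have "\<dots> < e" using norm_triangle_ineq[of "transport_op (m x) (b x - l)" "transport_op (m x) l - transport_op \<mu> l"] 1 2 by simp
    finally show ?case .
  qed
qed

lemma tensor_sum_tendsto:
  assumes \<mu>: "radon_prob \<mu>" and ev: "\<forall>\<^sub>F x in F. radon_prob (m x)"
    and B: "((\<lambda>x. B (m x)) \<longlongrightarrow> B \<mu>) F" and b: "(b \<longlongrightarrow> l) F"
  shows "((\<lambda>x. tensor_sum (m x) N (b x)) \<longlongrightarrow> tensor_sum \<mu> N l) F"
proof -
  have "((\<lambda>x. (transport_op (m x) ^^ n) (b x)) \<longlongrightarrow> (transport_op \<mu> ^^ n) l) F" for n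
    by (induction n) (auto intro: b transport_op_tendsto[OF \<mu> ev B])
  then show ?thesis unfolding tensor_sum_def by (intro tendsto_intros b)
qed

section \<open>Compactness of paths\<close>

text \<open>The squared distance is the difference of the pairings of \<open>b - b'\<close> with two
  cone elements, and each pairing is bounded by the uniform norm of \<open>b - b'\<close>.\<close>

lemma pos_cone_dist_le:
  assumes b: "b \<in> pos_cone" "norm b = 1" and b': "b' \<in> pos_cone" "norm b' = 1" and s: "\<And>x. \<bar>incl (b - b') x\<bar> \<le> s"
  shows "(norm (b - b'))\<^sup>2 \<le> 2 * cone_const * s"
proof -
  have "(norm (b - b'))\<^sup>2 = inner (b - b') b - inner (b - b') b'"
    by (simp add: power2_norm_eq_inner inner_diff_right)
  also have "\<dots> \<le> 2 * cone_const * s" using pos_cone_bound[OF b(1) s] pos_cone_bound[OF b'(1) s] b b' by simp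
  finally show ?thesis .
qed

text \<open>All functions of the unit sphere are 1-Lipschitz for the kernel distance, so convergence
  on a dense set of points is uniform by a finite net argument, and \<open>pos_cone_dist_le\<close>
  turns it into norm convergence.\<close>

lemma pos_cone_Cauchy:
  assumes b: "\<And>n. b n \<in> pos_cone" "\<And>n. norm (b n) = 1"
    and T: "range kap \<subseteq> closure T" and c: "\<And>p. p \<in> T \<Longrightarrow> convergent (\<lambda>n. inner (b n) p)"
  shows "Cauchy b"
proof (rule CauchyI)
  fix e :: real assume e: "0 < e"
  \<comment> \<open>The net argument bounds the difference by \<open>3 * s\<close>, so the squared
    norm is at most \<open>6 * cone_const * s = e\<^sup>2 / 2\<close>.\<close>
  define s where "s = e\<^sup>2 / (12 * cone_const)"
  have s: "0 < s" using e cone_const_pos by (simp add: s_def)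
  have "range kap \<subseteq> (\<Union>p\<in>T. ball p s)"
  proof
    fix z assume "z \<in> range kap"
    then have "z \<in> closure T" using T by blast
    then obtain p where "p \<in> T" "dist p z < s" using s by (meson closure_approachable)
    then show "z \<in> (\<Union>p\<in>T. ball p s)" by auto
  qed
  moreover have "compact (range kap)" by (intro compact_continuous_image continuous_kap compact_X)
  ultimately obtain T0 where T0: "T0 \<subseteq> T" "finite T0" "range kap \<subseteq> (\<Union>p\<in>T0. ball p s)"
    using compactE_image[of "range kap" T "\<lambda>p. ball p s"] by (metis open_ball)
  have "\<exists>M. \<forall>m\<ge>M. \<forall>n\<ge>M. \<bar>inner (b m) p - inner (b n) p\<bar> < s" if "p \<in> T0" for p
    using c[of p] that T0(1) s unfolding Cauchy_convergent_iff[symmetric] Cauchy_def dist_real_def by blast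
  then obtain M where M: "\<And>p m n. p \<in> T0 \<Longrightarrow> m \<ge> M p \<Longrightarrow> n \<ge> M p \<Longrightarrow> \<bar>inner (b m) p - inner (b n) p\<bar> < s" by metis
  define K where "K = Max (insert 0 (M ` T0))"
  have MK: "M p \<le> K" if "p \<in> T0" for p unfolding K_def using that T0(2) by (intro Max_ge) auto
  have "norm (b m - b n) < e" if mn: "m \<ge> K" "n \<ge> K" for m n
  proof -
    have "\<bar>incl (b m - b n) x\<bar> \<le> 3 * s" for x
    proof -
      obtain p where p: "p \<in> T0" "dist p (kap x) < s"
        using subsetD[OF T0(3), of "kap x"] by auto
      have "incl (b m - b n) x = (inner (b m) p - inner (b n) p) + inner (b m - b n) (kap x - p)"
        by (simp add: incl_eq inner_simps)
      moreover have "\<bar>inner (b m) p - inner (b n) p\<bar> < s" using M[OF p(1)] MK[OF p(1)] mn by simp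
      moreover have "\<bar>inner (b m - b n) (kap x - p)\<bar> \<le> 2 * s"
      proof -
        have "\<bar>inner (b m - b n) (kap x - p)\<bar> \<le> norm (b m - b n) * norm (kap x - p)" by (rule Cauchy_Schwarz_ineq2)
        also have "\<dots> \<le> 2 * s"
          using norm_triangle_ineq4[of "b m" "b n"] b(2) p(2) by (intro mult_mono) (auto simp: dist_norm norm_minus_commute)
        finally show ?thesis .
      qed
      ultimately show ?thesis by linarith
    qed
    from pos_cone_dist_le[OF b(1) b(2) b(1) b(2) this]
    have "(norm (b m - b n))\<^sup>2 \<le> e\<^sup>2 / 2" using cone_const_pos by (simp add: s_def)
    also have "\<dots> < e\<^sup>2" using e by simp
    finally show ?thesis using e by (simp add: power2_less_imp_less)
  qed
  then show "\<exists>M. \<forall>m\<ge>M. \<forall>n\<ge>M. norm (b m - b n) < e" by blast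
qed

text \<open>An Arzela-Ascoli argument: the diagonal subsequence makes the values converge at
  rational times and on a countable dense set of kernel functions, \<open>pos_cone_Cauchy\<close>
  upgrades this to norm convergence at each rational time, and the Hoelder bound makes it uniform in
  time.\<close>

lemma path_compactness:
  fixes b :: "nat \<Rightarrow> real \<Rightarrow> 'h"
  assumes b: "\<And>n t. t \<in> {0..1} \<Longrightarrow> b n t \<in> pos_cone" "\<And>n t. t \<in> {0..1} \<Longrightarrow> norm (b n t) = 1"
    and H: "\<And>n s t. 0 \<le> s \<Longrightarrow> s \<le> t \<Longrightarrow> t \<le> 1 \<Longrightarrow> (norm (b n t - b n s))\<^sup>2 \<le> (t - s) * C"
  obtains r l where "strict_mono (r :: nat \<Rightarrow> nat)"
    "\<And>e. e > 0 \<Longrightarrow> \<exists>N. \<forall>n\<ge>N. \<forall>t\<in>{0..1}. norm (b (r n) t - l t) < e"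
proof -
  have C0: "0 \<le> C" using order_trans[OF zero_le_power2 H[of 0 1 0]] by simp
  obtain T :: "'h set" where T: "countable T" "T \<subseteq> range kap" "range kap \<subseteq> closure T"
    using separable[of "range kap"] by blast
  have Tne: "T \<noteq> {}" using T(3) by auto
  define \<tau> where "\<tau> = from_nat_into T"
  have \<tau>: "range \<tau> = T" unfolding \<tau>_def by (rule range_from_nat_into[OF Tne T(1)])
  define R where "R = \<rat> \<inter> {0..1::real}"
  have R: "countable R" "R \<noteq> {}" unfolding R_def using countable_rat by (auto intro: exI[of _ 0])
  define \<rho> where "\<rho> = from_nat_into R"
  have \<rho>: "range \<rho> = R" unfolding \<rho>_def by (rule range_from_nat_into[OF R(2) R(1)])
  define f where "f n i = inner (b n (\<rho> (fst (prod_decode i)))) (\<tau> (snd (prod_decode i)))" for n i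
  have "\<bar>f n i\<bar> \<le> 1" for n i
  proof -
    have "\<rho> (fst (prod_decode i)) \<in> {0..1}" using \<rho> by (auto simp: R_def)
    moreover obtain x where "\<tau> (snd (prod_decode i)) = kap x" using \<tau> T(2) by blast
    ultimately show ?thesis using incl_le[of "b n (\<rho> (fst (prod_decode i)))" x] b(2) by (simp add: f_def incl_eq)
  qed
  then obtain r where r: "strict_mono (r :: nat \<Rightarrow> nat)" "\<And>i. convergent (\<lambda>n. f (r n) i)"
    using diagonal_convergent_subsequence by blast
  have rat: "Cauchy (\<lambda>n. b (r n) t)" if "t \<in> R" for t
  proof (rule pos_cone_Cauchy[OF _ _ T(3)])
    have t: "t \<in> {0..1}" using that by (auto simp: R_def)
    show "b (r n) t \<in> pos_cone" "norm (b (r n) t) = 1" for n using b t by auto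
    fix p assume "p \<in> T"
    then have "p \<in> range \<tau>" "t \<in> range \<rho>" using \<tau> \<rho> that by simp_all
    then obtain i j where "\<tau> j = p" "\<rho> i = t" by blast
    then show "convergent (\<lambda>n. inner (b (r n) t) p)" using r(2)[of "prod_encode (i, j)"] by (simp add: f_def)
  qed
  have uc: "\<exists>M. \<forall>m\<ge>M. \<forall>n\<ge>M. \<forall>t\<in>{0..1}. dist (b (r m) t) (b (r n) t) < e" if e: "0 < e" for e
  proof -
    \<comment> \<open>A time grid of mesh \<open>1 / K\<close> with
      \<open>C / K < (e / 3)\<^sup>2\<close>, so that moving to the grid point on the left changes
      every path by less than \<open>e / 3\<close>.\<close>
    obtain K :: nat where K: "K > 0" "C * 9 < e\<^sup>2 * real K"
    proof -
      obtain n :: nat where "C * 9 < real n * e\<^sup>2" using reals_Archimedean3[of "e\<^sup>2"] e by auto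
      then show ?thesis using that[of "Suc n"] by (simp add: algebra_simps) (smt (verit) zero_le_power2)
    qed
    have gr: "real i / real K \<in> R" if "i \<le> K" for i unfolding R_def using that K(1) by auto
    have "\<exists>M. \<forall>m\<ge>M. \<forall>n\<ge>M. norm (b (r m) (real i / real K) - b (r n) (real i / real K)) < e / 3" if "i \<le> K" for i
      using CauchyD[OF rat[OF gr[OF that]], of "e / 3"] e by simp
    then obtain M where M: "\<And>i m n. i \<le> K \<Longrightarrow> m \<ge> M i \<Longrightarrow> n \<ge> M i \<Longrightarrow>
        norm (b (r m) (real i / real K) - b (r n) (real i / real K)) < e / 3" by metis
    define L where "L = Max (M ` {..K})"
    have MleL: "M i \<le> L" if "i \<le> K" for i unfolding L_def using that by (intro Max_ge) auto
    have "dist (b (r m) t) (b (r n) t) < e" if mn: "m \<ge> L" "n \<ge> L" and t: "t \<in> {0..1}" for m n t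
    proof -
      define i where "i = nat \<lfloor>t * real K\<rfloor>"
      have i: "real i \<le> t * real K" "t * real K < real i + 1" unfolding i_def using t by (auto simp: of_nat_nat)
      have iK: "i \<le> K"
      proof -
        have "t * real K \<le> real K" using t by (simp add: mult_left_le_one_le)
        then show ?thesis using i(1) by linarith
      qed
      define s where "s = real i / real K"
      have s: "0 \<le> s" "s \<le> t" "t - s \<le> 1 / real K"
      proof -
        have "(t - s) * real K \<le> 1" using i(2) K(1) by (simp add: s_def algebra_simps)
        then show "t - s \<le> 1 / real K" using K(1) by (simp add: pos_le_divide_eq)
      qed (use i K(1) in \<open>auto simp: s_def pos_divide_le_eq\<close>)
      have near: "norm (b n t - b n s) < e / 3" for n
      proof -
        have "(norm (b n t - b n s))\<^sup>2 \<le> (t - s) * C" using H s t by simp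
        also have "\<dots> \<le> 1 / real K * C" using s C0 by (intro mult_right_mono) auto
        also have "\<dots> < (e / 3)\<^sup>2" using K by (simp add: field_simps power2_eq_square)
        finally show ?thesis by (rule power2_less_imp_less) (use e in simp)
      qed
      have "norm (b (r m) s - b (r n) s) < e / 3" unfolding s_def using M[OF iK] MleL[OF iK] mn by simp
      moreover have eq: "b (r m) t - b (r n) t = (b (r m) t - b (r m) s) + (b (r m) s - b (r n) s) - (b (r n) t - b (r n) s)" by simp
      ultimately show ?thesis using near[of "r m"] near[of "r n"] unfolding dist_norm eq
        using norm_triangle_ineq4[of "(b (r m) t - b (r m) s) + (b (r m) s - b (r n) s)" "b (r n) t - b (r n) s"]
          norm_triangle_ineq[of "b (r m) t - b (r m) s" "b (r m) s - b (r n) s"] by linarith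
    qed
    then show ?thesis by blast
  qed
  define l where "l t = lim (\<lambda>n. b (r n) t)" for t
  have "\<exists>N. \<forall>n\<ge>N. \<forall>t\<in>{0..1}. norm (b (r n) t - l t) < e" if e: "0 < e" for e
  proof -
    obtain M where M: "\<And>m n t. m \<ge> M \<Longrightarrow> n \<ge> M \<Longrightarrow> t \<in> {0..1} \<Longrightarrow> dist (b (r m) t) (b (r n) t) < e / 2"
      using uc[of "e / 2"] e by (meson half_gt_zero)
    have "norm (b (r n) t - l t) < e" if n: "n \<ge> M" and t: "t \<in> {0..1}" for n t
    proof -
      have "Cauchy (\<lambda>n. b (r n) t)" using uc t unfolding Cauchy_def by meson
      then have "(\<lambda>k. b (r k) t) \<longlonglongrightarrow> l t" unfolding l_def by (simp add: Cauchy_convergent_iff convergent_LIMSEQ_iff)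
      then have "(\<lambda>k. norm (b (r n) t - b (r k) t)) \<longlonglongrightarrow> norm (b (r n) t - l t)" by (intro tendsto_intros)
      then have "norm (b (r n) t - l t) \<le> e / 2"
        using M[OF n _ t] by (intro LIMSEQ_le_const2) (auto simp: dist_norm less_imp_le intro!: exI[of _ M])
      then show ?thesis using e by simp
    qed
    then show ?thesis by blast
  qed
  with r(1) show ?thesis by (rule that)
qed

section \<open>Energy of admissible paths\<close>

abbreviation admissible :: "(real \<Rightarrow> 'a measure) \<Rightarrow> bool" where "admissible \<equiv> admissible_path \<epsilon> c incl"

definition vel :: "(real \<Rightarrow> 'a measure) \<Rightarrow> real \<Rightarrow> 'h" where
  "vel \<gamma> t = indicator {0<..<1} t *\<^sub>R weak_deriv (\<lambda>s. B (\<gamma> s)) t"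

lemma admissibleD:
  assumes "admissible \<gamma>"
  shows "t \<in> {0..1} \<Longrightarrow> radon_prob (\<gamma> t)" "H1_path (\<lambda>t. B (\<gamma> t))" "continuous_on {0..1} (\<lambda>t. B (\<gamma> t))"
    "L2_zero (vel \<gamma>)" "primitive (\<lambda>t. B (\<gamma> t)) (vel \<gamma>)" "AE t in lborel. inner (B (\<gamma> t)) (vel \<gamma> t) = 0"
proof -
  show r: "radon_prob (\<gamma> t)" if "t \<in> {0..1}" for t using assms that by (auto simp: admissible_path_def)
  show h: "H1_path (\<lambda>t. B (\<gamma> t))" and c: "continuous_on {0..1} (\<lambda>t. B (\<gamma> t))"
    using assms by (auto simp: admissible_path_def)
  show l: "L2_zero (vel \<gamma>)" and p: "primitive (\<lambda>t. B (\<gamma> t)) (vel \<gamma>)"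
    unfolding vel_def[abs_def] by (rule weak_deriv_primitive[OF h c])+
  show "AE t in lborel. inner (B (\<gamma> t)) (vel \<gamma> t) = 0"
    by (rule unit_path_orthogonal[OF p l c]) (rule B_facts(2)[OF r])
qed

lemma energy_eq:
  "energy \<epsilon> c incl \<gamma> = (\<integral>\<^sup>+t. ennreal (g_tensor \<epsilon> c incl (\<gamma> t) (vel \<gamma> t)) * indicator {0<..<1} t \<partial>lborel)"
  unfolding energy_def by (intro nn_integral_cong) (auto simp: vel_def indicator_def)

text \<open>The partial sums \<open>tensor_sum N\<close> of the Neumann series give energies that depend continuously on the
  path and are convex in the velocity.\<close>

definition partial_energy :: "(real \<Rightarrow> 'a measure) \<Rightarrow> nat \<Rightarrow> (real \<Rightarrow> 'h) \<Rightarrow> ennreal" where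
  "partial_energy \<gamma> N w = (\<integral>\<^sup>+t. ennreal (\<epsilon> / 2 * tensor_sum (\<gamma> t) N (w t)) * indicator {0<..<1} t \<partial>lborel)"

text \<open>The form is jointly continuous in time and vector on the open set \<open>A\<close>,
  since it depends on the measure continuously through \<open>B\<close>; it is then composed with
  the Borel map \<open>t \<mapsto> (t, w t)\<close>. No measurability of the path of measures itself
  is involved.\<close>

lemma measurable_tensor_sum:
  fixes \<gamma> :: "real \<Rightarrow> 'a measure"
  assumes r: "\<And>t. t \<in> {0..1} \<Longrightarrow> radon_prob (\<gamma> t)" and c: "continuous_on {0..1} (\<lambda>t. B (\<gamma> t))"
    and w: "w \<in> borel_measurable borel"
  shows "(\<lambda>t. ennreal (\<epsilon> / 2 * tensor_sum (\<gamma> t) N (w t)) * indicator {0<..<1} t) \<in> borel_measurable lborel"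
proof -
  define A where "A = {0<..<1::real} \<times> (UNIV :: 'h set)"
  have "open A" unfolding A_def by (intro open_Times) auto
  have "continuous_on A (\<lambda>p. B (\<gamma> (fst p)))"
    by (rule continuous_on_compose2[OF c]) (auto simp: A_def intro!: continuous_intros)
  then have "continuous_on A (\<lambda>p. tensor_sum (\<gamma> (fst p)) N (snd p))"
    unfolding continuous_on_def
  proof (intro ballI)
    fix p assume p: "p \<in> A" and "\<forall>x\<in>A. ((\<lambda>p. B (\<gamma> (fst p))) \<longlongrightarrow> B (\<gamma> (fst x))) (at x within A)"
    then have 1: "((\<lambda>p. B (\<gamma> (fst p))) \<longlongrightarrow> B (\<gamma> (fst p))) (at p within A)" by blast
    have "\<forall>\<^sub>F q in at p within A. radon_prob (\<gamma> (fst q))"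
      unfolding eventually_at_filter using r by (intro always_eventually) (auto simp: A_def)
    then show "((\<lambda>p. tensor_sum (\<gamma> (fst p)) N (snd p)) \<longlongrightarrow> tensor_sum (\<gamma> (fst p)) N (snd p)) (at p within A)"
      using p by (intro tensor_sum_tendsto 1 r tendsto_intros) (auto simp: A_def)
  qed
  then have m: "(\<lambda>p. indicator A p *\<^sub>R tensor_sum (\<gamma> (fst p)) N (snd p)) \<in> borel_measurable borel"
    using \<open>open A\<close> by (intro borel_measurable_continuous_on_indicator) auto
  have "(\<lambda>t. (t, w t)) \<in> borel_measurable borel" using w by (intro borel_measurable_Pair) auto
  from measurable_compose[OF this m]
  have "(\<lambda>t. indicator A (t, w t) *\<^sub>R tensor_sum (\<gamma> t) N (w t)) \<in> borel_measurable borel" by simp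
  then have "(\<lambda>t. ennreal (\<epsilon> / 2 * (indicator A (t, w t) *\<^sub>R tensor_sum (\<gamma> t) N (w t)))) \<in> borel_measurable borel" by measurable
  moreover have "ennreal (\<epsilon> / 2 * (indicator A (t, w t) *\<^sub>R tensor_sum (\<gamma> t) N (w t))) = ennreal (\<epsilon> / 2 * tensor_sum (\<gamma> t) N (w t)) * indicator {0<..<1} t" for t
    by (auto simp: A_def indicator_def)
  ultimately show ?thesis by simp
qed

lemma partial_energy_le_energy:
  assumes a: "admissible \<gamma>"
  shows "partial_energy \<gamma> N (vel \<gamma>) \<le> energy \<epsilon> c incl \<gamma>"
  unfolding partial_energy_def energy_eq
proof (rule nn_integral_mono_AE)
  show "AE t in lborel. ennreal (\<epsilon> / 2 * tensor_sum (\<gamma> t) N (vel \<gamma> t)) * indicator {0<..<1} t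
      \<le> ennreal (g_tensor \<epsilon> c incl (\<gamma> t) (vel \<gamma> t)) * indicator {0<..<1} t"
    using admissibleD(6)[OF a]
  proof eventually_elim
    case (elim t)
    show ?case
    proof (cases "t \<in> {0<..<1}")
      case True
      then have r: "radon_prob (\<gamma> t)" using admissibleD(1)[OF a] by auto
      have o: "inner (vel \<gamma> t) (B (\<gamma> t)) = 0" using elim by (simp add: inner_commute)
      have "\<epsilon> / 2 * tensor_sum (\<gamma> t) N (vel \<gamma> t) \<le> g_tensor \<epsilon> c incl (\<gamma> t) (vel \<gamma> t)"
      proof (rule LIMSEQ_le_const[OF g_tensor_limit(1)[OF r o]])
        show "\<exists>M. \<forall>n\<ge>M. \<epsilon> / 2 * tensor_sum (\<gamma> t) N (vel \<gamma> t) \<le> \<epsilon> / 2 * tensor_sum (\<gamma> t) n (vel \<gamma> t)"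
          using eps_pos tensor_sum_mono[OF r] by (intro exI[of _ N]) auto
      qed
      then show ?thesis using True by (simp add: ennreal_leI)
    qed simp
  qed
qed

text \<open>Fatou's lemma in \<open>N\<close>. Any Borel representative \<open>w\<close> of the
  velocity is allowed, because the limit velocity of a minimizing sequence agrees with the one
  chosen in \<open>vel\<close> only almost everywhere.\<close>

lemma energy_le_of_partial_energy:
  assumes a: "admissible \<gamma>" and v: "w \<in> borel_measurable borel" "AE t in lborel. w t = vel \<gamma> t"
    and K: "\<And>N. partial_energy \<gamma> N w \<le> K"
  shows "energy \<epsilon> c incl \<gamma> \<le> K"
  unfolding energy_eq
proof (rule nn_integral_le_of_AE_tendsto)
  show "(\<lambda>t. ennreal (\<epsilon> / 2 * tensor_sum (\<gamma> t) N (w t)) * indicator {0<..<1} t) \<in> borel_measurable lborel" for N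
    by (intro measurable_tensor_sum admissibleD[OF a] v)
  show "AE t in lborel. (\<lambda>N. ennreal (\<epsilon> / 2 * tensor_sum (\<gamma> t) N (w t)) * indicator {0<..<1} t)
      \<longlonglongrightarrow> ennreal (g_tensor \<epsilon> c incl (\<gamma> t) (vel \<gamma> t)) * indicator {0<..<1} t"
    using admissibleD(6)[OF a] v(2)
  proof eventually_elim
    case (elim t)
    show ?case
    proof (cases "t \<in> {0<..<1}")
      case True
      then have r: "radon_prob (\<gamma> t)" using admissibleD(1)[OF a] by auto
      have o: "inner (vel \<gamma> t) (B (\<gamma> t)) = 0" using elim by (simp add: inner_commute)
      show ?thesis using True g_tensor_limit(1)[OF r o] elim(2) by (simp add: tendsto_ennrealI)
    qed simp
  qed
  show "\<forall>\<^sub>F N in sequentially. (\<integral>\<^sup>+t. ennreal (\<epsilon> / 2 * tensor_sum (\<gamma> t) N (w t)) * indicator {0<..<1} t \<partial>lborel) \<le> K"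
    using K by (intro always_eventually) (auto simp: partial_energy_def)
qed

text \<open>The partial energy with \<open>N = 0\<close> is the plain kinetic energy; this is the
  coercivity behind the Hoelder bound.\<close>

lemma sq_norm_vel_le_energy:
  assumes a: "admissible \<gamma>"
  shows "ennreal (\<epsilon> / 2 * sq_norm (vel \<gamma>)) \<le> energy \<epsilon> c incl \<gamma>"
proof -
  have [measurable]: "vel \<gamma> \<in> borel_measurable borel" using admissibleD(4)[OF a] by (rule L2_zero_measurable)
  have "ennreal (\<epsilon> / 2 * sq_norm (vel \<gamma>)) = ennreal (\<epsilon> / 2) * (\<integral>\<^sup>+t. ennreal ((norm (vel \<gamma> t))\<^sup>2) \<partial>lborel)"
    unfolding nn_integral_sq_norm[OF admissibleD(4)[OF a]]
    by (rule ennreal_mult) (use eps_pos sq_norm_nonneg in auto)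
  also have "\<dots> = (\<integral>\<^sup>+t. ennreal (\<epsilon> / 2) * ennreal ((norm (vel \<gamma> t))\<^sup>2) \<partial>lborel)"
    by (rule nn_integral_cmult[symmetric]) measurable
  also have "\<dots> = partial_energy \<gamma> 0 (vel \<gamma>)"
    unfolding partial_energy_def tensor_sum_def
  proof (rule nn_integral_cong)
    fix t
    have "ennreal (\<epsilon> / 2) * ennreal ((norm (vel \<gamma> t))\<^sup>2) = ennreal (\<epsilon> / 2 * (norm (vel \<gamma> t))\<^sup>2)"
      by (rule ennreal_mult[symmetric]) (use eps_pos in auto)
    then show "ennreal (\<epsilon> / 2) * ennreal ((norm (vel \<gamma> t))\<^sup>2) = ennreal (\<epsilon> / 2 * ((norm (vel \<gamma> t))\<^sup>2 +
        2 * (\<Sum>j<0. inner (vel \<gamma> t) ((transport_op (\<gamma> t) ^^ Suc j) (vel \<gamma> t))))) * indicator {0<..<1} t"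
      by (cases "t \<in> {0<..<1}") (simp_all add: vel_def)
  qed
  also have "\<dots> \<le> energy \<epsilon> c incl \<gamma>" by (rule partial_energy_le_energy[OF a])
  finally show ?thesis .
qed

lemma energy_finite:
  assumes a: "admissible \<gamma>"
  shows "energy \<epsilon> c incl \<gamma> < \<infinity>"
proof -
  have [measurable]: "vel \<gamma> \<in> borel_measurable borel" using admissibleD(4)[OF a] by (rule L2_zero_measurable)
  define K where "K = \<epsilon> / 2 * (1 + 2 / kmin)"
  have K: "0 \<le> K" using eps_pos kmin by (simp add: K_def)
  have "energy \<epsilon> c incl \<gamma> \<le> (\<integral>\<^sup>+t. ennreal K * ennreal ((norm (vel \<gamma> t))\<^sup>2) \<partial>lborel)"
    unfolding energy_eq
  proof (rule nn_integral_mono_AE)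
    show "AE t in lborel. ennreal (g_tensor \<epsilon> c incl (\<gamma> t) (vel \<gamma> t)) * indicator {0<..<1} t
        \<le> ennreal K * ennreal ((norm (vel \<gamma> t))\<^sup>2)"
      using admissibleD(6)[OF a]
    proof eventually_elim
      case (elim t)
      show ?case
      proof (cases "t \<in> {0<..<1}")
        case True
        then have r: "radon_prob (\<gamma> t)" using admissibleD(1)[OF a] by auto
        have o: "inner (vel \<gamma> t) (B (\<gamma> t)) = 0" using elim by (simp add: inner_commute)
        have "g_tensor \<epsilon> c incl (\<gamma> t) (vel \<gamma> t) \<le> K * (norm (vel \<gamma> t))\<^sup>2"
          unfolding K_def by (rule g_tensor_limit(2)[OF r o])
        then have "ennreal (g_tensor \<epsilon> c incl (\<gamma> t) (vel \<gamma> t)) \<le> ennreal (K * (norm (vel \<gamma> t))\<^sup>2)" by (rule ennreal_leI)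
        also have "\<dots> = ennreal K * ennreal ((norm (vel \<gamma> t))\<^sup>2)" by (rule ennreal_mult) (use K in auto)
        finally show ?thesis using True by simp
      qed simp
    qed
  qed
  also have "\<dots> = ennreal K * ennreal (sq_norm (vel \<gamma>))"
    by (subst nn_integral_cmult) (simp_all add: nn_integral_sq_norm[OF admissibleD(4)[OF a]])
  also have "\<dots> < \<infinity>" by (simp add: ennreal_mult_less_top)
  finally show ?thesis .
qed

text \<open>Preimages under \<open>B\<close> are chosen pointwise in time, as admissibility
  constrains only the images; at times 0 and 1 the choice is overwritten by the prescribed measures,
  which have the same images.\<close>

lemma lift_path:
  fixes u :: "real \<Rightarrow> 'h"
  assumes u: "\<And>t. t \<in> {0..1} \<Longrightarrow> u t \<in> pos_cone" "\<And>t. t \<in> {0..1} \<Longrightarrow> norm (u t) = 1"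
    and e: "radon_prob \<mu>0" "radon_prob \<mu>1" "u 0 = B \<mu>0" "u 1 = B \<mu>1"
  obtains \<gamma> where "\<And>t. t \<in> {0..1} \<Longrightarrow> radon_prob (\<gamma> t)" "\<And>t. t \<in> {0..1} \<Longrightarrow> B (\<gamma> t) = u t" "\<gamma> 0 = \<mu>0" "\<gamma> 1 = \<mu>1"
proof -
  have "\<forall>t\<in>{0..1}. \<exists>\<mu>. radon_prob \<mu> \<and> B \<mu> = u t" using B_surj u by blast
  then obtain m where m: "\<And>t. t \<in> {0..1} \<Longrightarrow> radon_prob (m t)" "\<And>t. t \<in> {0..1} \<Longrightarrow> B (m t) = u t" by metis
  show ?thesis
    by (rule that[of "\<lambda>t. if t = 0 then \<mu>0 else if t = 1 then \<mu>1 else m t"]) (use m e in auto)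
qed

text \<open>The normalized segment from \<open>B \<mu>0\<close> to \<open>B \<mu>1\<close> stays in the image of \<open>B\<close>, which is the unit
  sphere of the cone \<open>pos_cone\<close>.\<close>

lemma paths_nonempty:
  assumes \<mu>: "radon_prob \<mu>0" "radon_prob \<mu>1"
  shows "paths_between \<epsilon> c incl \<mu>0 \<mu>1 \<noteq> {}"
proof -
  define b0 b1 where "b0 = B \<mu>0" and "b1 = B \<mu>1"
  have b: "b0 \<in> pos_cone" "b1 \<in> pos_cone" "norm b0 = 1" "norm b1 = 1" using B_facts \<mu> by (auto simp: b0_def b1_def)
  define p where "p t = (1 - t) *\<^sub>R b0 + t *\<^sub>R b1" for t :: real
  have pP: "p t \<in> pos_cone" if "t \<in> {0..1}" for t unfolding p_def using that b by (intro pos_cone_add pos_cone_scale) auto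
  \<comment> \<open>The segment avoids the origin because its points are strictly positive
    functions.\<close>
  have p0: "p t \<noteq> 0" if t: "t \<in> {0..1}" for t
  proof
    assume z: "p t = 0"
    have pos: "0 < incl b0 undefined" "0 < incl b1 undefined"
      using B_facts(4) \<mu> by (auto simp: b0_def b1_def)
    have "0 < (1 - t) * incl b0 undefined + t * incl b1 undefined"
    proof (cases "t = 1")
      case False
      then show ?thesis using t pos by (intro add_pos_nonneg mult_pos_pos mult_nonneg_nonneg) auto
    qed (use pos in simp)
    also have "\<dots> = incl (p t) undefined" by (simp add: p_def incl_simps)
    finally show False using z by (simp add: incl_simps)
  qed
  define q where "q t = inner (p t) (p t)" for t
  have q: "0 < q t" "sqrt (q t) = norm (p t)" if "t \<in> {0..1}" for t
    using p0[OF that] by (auto simp: q_def norm_eq_sqrt_inner)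
  define u where "u t = inverse (sqrt (q t)) *\<^sub>R p t" for t
  have un: "norm (u t) = 1" if "t \<in> {0..1}" for t using p0[OF that] q(2)[OF that] by (simp add: u_def)
  have uP: "u t \<in> pos_cone" if "t \<in> {0..1}" for t unfolding u_def q(2)[OF that] by (intro pos_cone_scale pP that) auto
  have "u 0 = B \<mu>0" "u 1 = B \<mu>1"
    using b by (auto simp: u_def q_def p_def b0_def b1_def power2_norm_eq_inner[symmetric])
  from lift_path[OF uP un \<mu> this]
  obtain \<gamma> where \<gamma>: "\<And>t. t \<in> {0..1} \<Longrightarrow> radon_prob (\<gamma> t)" "\<And>t. t \<in> {0..1} \<Longrightarrow> B (\<gamma> t) = u t" "\<gamma> 0 = \<mu>0" "\<gamma> 1 = \<mu>1" by blast
  have dp: "(p has_vector_derivative (b1 - b0)) (at t within T)" for t T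
    unfolding p_def by (auto intro!: derivative_eq_intros)
  have dq: "(q has_real_derivative (2 * inner (p t) (b1 - b0))) (at t within T)" for t T
  proof -
    have "((\<lambda>t. inner (p t) (p t)) has_vector_derivative (inner (p t) (b1 - b0) + inner (b1 - b0) (p t))) (at t within T)"
      using bounded_bilinear.has_vector_derivative[OF bounded_bilinear_inner dp dp] .
    then show ?thesis unfolding q_def[abs_def] has_real_derivative_iff_has_vector_derivative by (simp add: inner_commute)
  qed
  define s' where "s' t = - (inverse (sqrt (q t)) * (2 * inner (p t) (b1 - b0) * (inverse (sqrt (q t)) / 2)) * inverse (sqrt (q t)))" for t
  have du: "(u has_vector_derivative (inverse (sqrt (q t)) *\<^sub>R (b1 - b0) + s' t *\<^sub>R p t)) (at t within {0..1})" if t: "t \<in> {0..1}" for t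
    unfolding u_def[abs_def]
  proof (rule has_vector_derivative_scaleR[OF _ dp])
    have "((\<lambda>t. sqrt (q t)) has_real_derivative (2 * inner (p t) (b1 - b0) * (inverse (sqrt (q t)) / 2))) (at t within {0..1})"
      using DERIV_chain2[OF DERIV_real_sqrt[OF q(1)[OF t]] dq] by (simp add: mult.commute)
    from DERIV_inverse'[OF this]
    show "((\<lambda>t. inverse (sqrt (q t))) has_real_derivative s' t) (at t within {0..1})"
      unfolding s'_def using q(1)[OF t] by simp
  qed
  have cp: "continuous_on {0..1} p" unfolding p_def by (intro continuous_intros)
  have cq: "continuous_on {0..1} q" unfolding q_def by (intro continuous_intros cp)
  have qn: "\<forall>t\<in>{0..1}. sqrt (q t) \<noteq> 0" using q(1) by (metis less_irrefl real_sqrt_gt_0_iff)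
  have cv: "continuous_on {0..1} (\<lambda>t. inverse (sqrt (q t)) *\<^sub>R (b1 - b0) + s' t *\<^sub>R p t)"
    unfolding s'_def by (intro continuous_intros cp cq qn) simp
  have "((\<lambda>t. B (\<gamma> t)) has_vector_derivative (inverse (sqrt (q t)) *\<^sub>R (b1 - b0) + s' t *\<^sub>R p t)) (at t within {0..1})"
    if t: "t \<in> {0..1}" for t
    by (rule has_vector_derivative_transform[OF t _ du[OF t]]) (simp add: \<gamma>(2))
  from C1_path[OF this cv] have "admissible \<gamma>" using \<gamma>(1) by (auto simp: admissible_path_def)
  then have "\<gamma> \<in> paths_between \<epsilon> c incl \<mu>0 \<mu>1" using \<gamma> by (auto simp: paths_between_def)
  then show ?thesis by blast
qed

section \<open>Existence of a minimizer\<close>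

text \<open>Sublevel sets are closed under midpoints, which is what an induction over
  \<open>tail_hull\<close> needs.\<close>

lemma partial_energy_mid:
  assumes r: "\<And>t. t \<in> {0..1} \<Longrightarrow> radon_prob (\<gamma> t)" and c: "continuous_on {0..1} (\<lambda>t. B (\<gamma> t))"
    and w: "w \<in> borel_measurable borel" "w' \<in> borel_measurable borel" and K: "partial_energy \<gamma> N w \<le> K" "partial_energy \<gamma> N w' \<le> K"
  shows "partial_energy \<gamma> N (mid w w') \<le> K"
proof -
  let ?f = "\<lambda>w t. ennreal (\<epsilon> / 2 * tensor_sum (\<gamma> t) N (w t)) * indicator {0<..<1} t"
  have m: "?f w \<in> borel_measurable lborel" "?f w' \<in> borel_measurable lborel" using measurable_tensor_sum[OF r c w(1)] measurable_tensor_sum[OF r c w(2)] by simp_all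
  have "partial_energy \<gamma> N (mid w w') \<le> (\<integral>\<^sup>+t. ennreal (1/2) * ?f w t + ennreal (1/2) * ?f w' t \<partial>lborel)"
    unfolding partial_energy_def
  proof (rule nn_integral_mono)
    fix t
    show "?f (mid w w') t \<le> ennreal (1/2) * ?f w t + ennreal (1/2) * ?f w' t"
    proof (cases "t \<in> {0<..<1}")
      case True
      then have rt: "radon_prob (\<gamma> t)" using r by auto
      have nn: "0 \<le> \<epsilon> / 2 * tensor_sum (\<gamma> t) N z" for z using eps_pos tensor_sum_nonneg[OF rt] by simp
      have "\<epsilon> / 2 * tensor_sum (\<gamma> t) N (mid w w' t) \<le> \<epsilon> / 2 * ((1/2) * tensor_sum (\<gamma> t) N (w t) + (1/2) * tensor_sum (\<gamma> t) N (w' t))"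
        using eps_pos by (intro mult_left_mono tensor_sum_mid[OF rt]) auto
      also have "\<dots> = (1/2) * (\<epsilon> / 2 * tensor_sum (\<gamma> t) N (w t)) + (1/2) * (\<epsilon> / 2 * tensor_sum (\<gamma> t) N (w' t))" by (simp add: algebra_simps)
      finally have "ennreal (\<epsilon> / 2 * tensor_sum (\<gamma> t) N (mid w w' t)) \<le>
          ennreal ((1/2) * (\<epsilon> / 2 * tensor_sum (\<gamma> t) N (w t)) + (1/2) * (\<epsilon> / 2 * tensor_sum (\<gamma> t) N (w' t)))" by (rule ennreal_leI)
      also have "\<dots> = ennreal (1/2) * ennreal (\<epsilon> / 2 * tensor_sum (\<gamma> t) N (w t)) + ennreal (1/2) * ennreal (\<epsilon> / 2 * tensor_sum (\<gamma> t) N (w' t))"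
      proof -
        have "ennreal (1/2 * z) = ennreal (1/2) * ennreal z" if "0 \<le> z" for z :: real
          by (rule ennreal_mult) (use that in auto)
        moreover have "0 \<le> 1/2 * (\<epsilon> / 2 * tensor_sum (\<gamma> t) N z)" for z using mult_left_mono[OF nn[of z], of "1/2"] by simp
        ultimately show ?thesis by (metis (no_types, lifting) ennreal_plus nn)
      qed
      finally show ?thesis using True by simp
    qed simp
  qed
  also have "\<dots> = ennreal (1/2) * partial_energy \<gamma> N w + ennreal (1/2) * partial_energy \<gamma> N w'"
    unfolding partial_energy_def using m by (subst nn_integral_add) (auto simp: nn_integral_cmult)
  also have "\<dots> \<le> ennreal (1/2) * K + ennreal (1/2) * K" using K by (intro add_mono mult_left_mono) auto
  also have "\<dots> = (ennreal (1/2) + ennreal (1/2)) * K" by (rule distrib_right[symmetric])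
  also have "ennreal (1/2) + ennreal (1/2) = 1" by (subst ennreal_plus[symmetric]) auto
  finally show ?thesis by simp
qed

text \<open>Only the base path is exchanged while the velocity stays that of
  \<open>\<gamma>'\<close>. The velocity of \<open>\<gamma>'\<close> need not be tangent along
  \<gamma>, but the truncated forms are defined on the whole RKHS.\<close>

lemma partial_energy_close:
  assumes r: "\<And>t. t \<in> {0..1} \<Longrightarrow> radon_prob (\<gamma> t)" and a: "admissible \<gamma>'" and e: "0 \<le> e"
    and cl: "\<And>t b. t \<in> {0<..<1} \<Longrightarrow> \<bar>tensor_sum (\<gamma> t) N b - tensor_sum (\<gamma>' t) N b\<bar> \<le> e * (norm b)\<^sup>2"
  shows "partial_energy \<gamma> N (vel \<gamma>') \<le> energy \<epsilon> c incl \<gamma>' + ennreal (\<epsilon> / 2 * e * sq_norm (vel \<gamma>'))"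
proof -
  have L2: "L2_zero (vel \<gamma>')" by (rule admissibleD(4)[OF a])
  have [measurable]: "vel \<gamma>' \<in> borel_measurable borel" using L2 by (rule L2_zero_measurable)
  let ?f = "\<lambda>t. ennreal (\<epsilon> / 2 * tensor_sum (\<gamma>' t) N (vel \<gamma>' t)) * indicator {0<..<1} t"
  have m: "?f \<in> borel_measurable lborel" by (intro measurable_tensor_sum admissibleD[OF a]) measurable
  have "partial_energy \<gamma> N (vel \<gamma>') \<le> (\<integral>\<^sup>+t. ?f t + ennreal (\<epsilon> / 2 * e) * ennreal ((norm (vel \<gamma>' t))\<^sup>2) \<partial>lborel)"
    unfolding partial_energy_def
  proof (rule nn_integral_mono)
    fix t
    show "ennreal (\<epsilon> / 2 * tensor_sum (\<gamma> t) N (vel \<gamma>' t)) * indicator {0<..<1} t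
        \<le> ?f t + ennreal (\<epsilon> / 2 * e) * ennreal ((norm (vel \<gamma>' t))\<^sup>2)"
    proof (cases "t \<in> {0<..<1}")
      case True
      then have rt: "radon_prob (\<gamma>' t)" using admissibleD(1)[OF a] by auto
      have "tensor_sum (\<gamma> t) N (vel \<gamma>' t) \<le> tensor_sum (\<gamma>' t) N (vel \<gamma>' t) + e * (norm (vel \<gamma>' t))\<^sup>2"
        using cl[OF True, of "vel \<gamma>' t"] by (simp add: abs_le_iff)
      then have "\<epsilon> / 2 * tensor_sum (\<gamma> t) N (vel \<gamma>' t) \<le> \<epsilon> / 2 * (tensor_sum (\<gamma>' t) N (vel \<gamma>' t) + e * (norm (vel \<gamma>' t))\<^sup>2)"
        using eps_pos by (intro mult_left_mono) auto
      also have "\<dots> = \<epsilon> / 2 * tensor_sum (\<gamma>' t) N (vel \<gamma>' t) + (\<epsilon> / 2 * e) * (norm (vel \<gamma>' t))\<^sup>2" by (simp add: algebra_simps)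
      finally have "ennreal (\<epsilon> / 2 * tensor_sum (\<gamma> t) N (vel \<gamma>' t)) \<le> ennreal (\<epsilon> / 2 * tensor_sum (\<gamma>' t) N (vel \<gamma>' t) + (\<epsilon> / 2 * e) * (norm (vel \<gamma>' t))\<^sup>2)"
        by (rule ennreal_leI)
      also have "\<dots> = ennreal (\<epsilon> / 2 * tensor_sum (\<gamma>' t) N (vel \<gamma>' t)) + ennreal (\<epsilon> / 2 * e) * ennreal ((norm (vel \<gamma>' t))\<^sup>2)"
      proof -
        have "ennreal (\<epsilon> / 2 * e * (norm (vel \<gamma>' t))\<^sup>2) = ennreal (\<epsilon> / 2 * e) * ennreal ((norm (vel \<gamma>' t))\<^sup>2)"
          by (rule ennreal_mult) (use eps_pos e in auto)
        then show ?thesis using eps_pos e tensor_sum_nonneg[OF rt] by (subst ennreal_plus) auto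
      qed
      finally show ?thesis using True by simp
    qed simp
  qed
  also have "\<dots> = partial_energy \<gamma>' N (vel \<gamma>') + ennreal (\<epsilon> / 2 * e) * ennreal (sq_norm (vel \<gamma>'))"
    unfolding partial_energy_def using m by (subst nn_integral_add) (simp_all add: nn_integral_cmult nn_integral_sq_norm[OF L2])
  also have "\<dots> \<le> energy \<epsilon> c incl \<gamma>' + ennreal (\<epsilon> / 2 * e * sq_norm (vel \<gamma>'))"
    using eps_pos e by (intro add_mono partial_energy_le_energy[OF a]) (simp add: ennreal_mult'[symmetric] sq_norm_nonneg)
  finally show ?thesis .
qed

theorem minimizer_exists:
  assumes \<mu>: "radon_prob \<mu>0" "radon_prob \<mu>1"
  defines "P \<equiv> paths_between \<epsilon> c incl \<mu>0 \<mu>1"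
  shows "\<exists>\<gamma>\<in>P. energy \<epsilon> c incl \<gamma> \<le> (INF \<gamma>\<in>P. energy \<epsilon> c incl \<gamma>)" "(INF \<gamma>\<in>P. energy \<epsilon> c incl \<gamma>) < \<infinity>"
proof -
  let ?E = "energy \<epsilon> c incl"
  define m where "m = (INF \<gamma>\<in>P. ?E \<gamma>)"
  have Pa: "admissible \<gamma>" "\<gamma> 0 = \<mu>0" "\<gamma> 1 = \<mu>1" if "\<gamma> \<in> P" for \<gamma>
    using that by (auto simp: P_def paths_between_def)
  obtain \<gamma>' where "\<gamma>' \<in> P" using paths_nonempty[OF \<mu>] by (auto simp: P_def)
  then have "m \<le> ?E \<gamma>'" unfolding m_def by (rule INF_lower)
  then have mfin: "m < \<infinity>" using energy_finite[OF Pa(1)[OF \<open>\<gamma>' \<in> P\<close>]] by (rule le_less_trans)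
  then show "(INF \<gamma>\<in>P. ?E \<gamma>) < \<infinity>" by (simp add: m_def)
  have "\<exists>\<gamma>\<in>P. ?E \<gamma> < m + ennreal (1 / real (Suc n))" for n
  proof -
    have "m < m + ennreal (1 / real (Suc n))"
      using mfin by (simp add: ennreal_add_left_cancel_less[of _ 0, simplified])
    then show ?thesis unfolding m_def by (subst (asm) INF_less_iff) auto
  qed
  then obtain g where g: "\<And>n. g n \<in> P" "\<And>n. ?E (g n) < m + ennreal (1 / real (Suc n))" by metis
  have a: "admissible (g n)" for n using Pa(1)[OF g(1)] .
  define C where "C = 2 / \<epsilon> * (enn2real m + 1)"
  have C: "sq_norm (vel (g n)) \<le> C" for n
  proof -
    have "ennreal (\<epsilon> / 2 * sq_norm (vel (g n))) \<le> m + ennreal (1 / real (Suc n))"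
      using sq_norm_vel_le_energy[OF a, of n] g(2)[of n] by (meson less_imp_le order_trans)
    also have "\<dots> \<le> m + ennreal 1" by (intro add_left_mono ennreal_leI) auto
    also have "\<dots> = ennreal (enn2real m + 1)" using mfin by (simp add: ennreal_plus)
    finally have "\<epsilon> / 2 * sq_norm (vel (g n)) \<le> enn2real m + 1"
      by (rule ennreal_le_iff[THEN iffD1, rotated]) simp
    then show ?thesis using eps_pos by (simp add: C_def field_simps)
  qed
  have C0: "0 \<le> C" using C[of 0] sq_norm_nonneg order_trans by blast
  obtain r l where r: "strict_mono (r :: nat \<Rightarrow> nat)"
    and l: "\<And>e. e > 0 \<Longrightarrow> \<exists>N. \<forall>n\<ge>N. \<forall>t\<in>{0..1}. norm (B (g (r n) t) - l t) < e"
  proof (rule path_compactness[of "\<lambda>n t. B (g n t)" C])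
    fix n and t :: real assume "t \<in> {0..1}"
    then show "B (g n t) \<in> pos_cone" "norm (B (g n t)) = 1" using B_facts(1,2) admissibleD(1)[OF a] by auto
  next
    fix n and s t :: real assume st: "0 \<le> s" "s \<le> t" "t \<le> 1"
    have "(norm (B (g n t) - B (g n s)))\<^sup>2 \<le> (t - s) * sq_norm (vel (g n))"
      unfolding sq_norm_def by (rule primitive_Hoelder[OF admissibleD(5)[OF a] admissibleD(4)[OF a] st])
    also have "\<dots> \<le> (t - s) * C" using st C by (intro mult_left_mono) auto
    finally show "(norm (B (g n t) - B (g n s)))\<^sup>2 \<le> (t - s) * C" .
  qed blast
  have lim: "(\<lambda>n. B (g (r n) t)) \<longlonglongrightarrow> l t" if t: "t \<in> {0..1}" for t
    by (rule LIMSEQ_I) (use l t in blast)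
  have lP: "l t \<in> pos_cone" "norm (l t) = 1" if t: "t \<in> {0..1}" for t
  proof -
    have rt: "radon_prob (g (r n) t)" for n using admissibleD(1)[OF a t] .
    show "l t \<in> pos_cone" by (rule pos_cone_closed[OF _ lim[OF t]]) (rule B_facts(1)[OF rt])
    have "(\<lambda>n. norm (B (g (r n) t))) \<longlonglongrightarrow> norm (l t)" by (intro tendsto_intros lim t)
    then show "norm (l t) = 1" by (simp add: B_facts(2)[OF rt] LIMSEQ_const_iff)
  qed
  have "l 0 = B \<mu>0" "l 1 = B \<mu>1"
    using lim[of 0] lim[of 1] Pa(2,3)[OF g(1)] by (simp_all add: LIMSEQ_const_iff)
  from lift_path[OF lP \<mu> this]
  obtain \<gamma> where \<gamma>: "\<And>t. t \<in> {0..1} \<Longrightarrow> radon_prob (\<gamma> t)" "\<And>t. t \<in> {0..1} \<Longrightarrow> B (\<gamma> t) = l t" "\<gamma> 0 = \<mu>0" "\<gamma> 1 = \<mu>1" by blast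
  have ub: "\<exists>N. \<forall>n\<ge>N. \<forall>t\<in>{0..1}. norm (B (g (r n) t) - B (\<gamma> t)) < e" if "e > 0" for e
    using l[OF that] \<gamma>(2) by simp
  have cl: "continuous_on {0..1} (\<lambda>t. B (\<gamma> t))"
  proof (rule uniform_limit_theorem)
    show "uniform_limit {0..1} (\<lambda>n t. B (g (r n) t)) (\<lambda>t. B (\<gamma> t)) sequentially"
      unfolding uniform_limit_sequentially_iff dist_norm using ub by blast
    show "\<forall>\<^sub>F n in sequentially. continuous_on {0..1} (\<lambda>t. B (g (r n) t))"
      using admissibleD(3)[OF a] by simp
  qed simp
  define V where "V n = vel (g (r n))" for n
  have V: "L2_zero (V n)" "sq_norm (V n) \<le> C" for n unfolding V_def using admissibleD(4)[OF a] C by auto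
  obtain w v where w: "\<And>N. tail_hull V N (w N)" "\<And>N. L2_zero (w N)" and v: "L2_zero v"
    and wv: "AE t in lborel. (\<lambda>n. w n t) \<longlonglongrightarrow> v t" "(\<lambda>n. \<integral>t. norm (w n t - v t) \<partial>lborel) \<longlonglongrightarrow> 0"
    by (rule tail_hull_limit[of V C, OF V]; rule that; assumption)
  have wd: "is_weak_deriv (\<lambda>t. B (\<gamma> t)) v"
  proof (rule weak_deriv_of_hull_limit[OF w v wv(2) V(1) _ _ cl ub])
    show "continuous_on {0..1} (\<lambda>t. B (g (r n) t))" for n using admissibleD(3)[OF a] .
    fix n \<phi> assume "test_function \<phi>"
    moreover have "is_weak_deriv (\<lambda>t. B (g (r n) t)) (weak_deriv (\<lambda>t. B (g (r n) t)))"
      using admissibleD(2)[OF a, of "r n"] unfolding H1_path_def weak_deriv_def by (metis (mono_tags, lifting) someI_ex)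
    ultimately have "(LINT t:{0<..<1}|lborel. deriv \<phi> t *\<^sub>R B (g (r n) t)) =
        - (LINT t:{0<..<1}|lborel. \<phi> t *\<^sub>R weak_deriv (\<lambda>t. B (g (r n) t)) t)" by (auto simp: is_weak_deriv_def)
    then show "(LINT t:{0<..<1}|lborel. deriv \<phi> t *\<^sub>R B (g (r n) t)) = - (\<integral>t. \<phi> t *\<^sub>R V n t \<partial>lborel)"
      by (simp add: set_lebesgue_integral_def V_def vel_def mult.commute)
  qed
  have H1: "H1_path (\<lambda>t. B (\<gamma> t))"
    unfolding H1_path_def using L2_path_of_continuous[OF cl] L2_path_of_L2_zero[OF v] wd by blast
  have ag: "admissible \<gamma>" using \<gamma>(1) H1 cl by (auto simp: admissible_path_def)
  have gP: "\<gamma> \<in> P" using ag \<gamma> by (auto simp: P_def paths_between_def)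
  \<comment> \<open>Both functions are square-integrable densities of the increments of one
    path.\<close>
  have vv: "AE t in lborel. v t = vel \<gamma> t"
    by (rule primitive_unique[OF primitive_of_is_weak_deriv[OF v wd cl] admissibleD(5)[OF ag] v admissibleD(4)[OF ag]])
  \<comment> \<open>For fixed \<open>N\<close> the base path is the limit path \<gamma>.
    Near-minimality contributes \<open>e\<close>, and the exchange of base paths contributes
    \<open>\<epsilon> / 2 * e * C\<close>.\<close>
  have bound: "partial_energy \<gamma> N v \<le> m + ennreal (e * (1 + \<epsilon> / 2 * C))" if e: "0 < e" for N e
  proof -
    define K where "K = m + ennreal (e * (1 + \<epsilon> / 2 * C))"
    obtain d where d: "0 < d" "\<And>\<mu> \<mu>' b. radon_prob \<mu> \<Longrightarrow> radon_prob \<mu>' \<Longrightarrow> norm (B \<mu> - B \<mu>') < d \<Longrightarrow>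
      \<bar>tensor_sum \<mu> N b - tensor_sum \<mu>' N b\<bar> \<le> e * (norm b)\<^sup>2" using tensor_sum_close[OF e, of N] by metis
    obtain M1 where M1: "\<And>n t. n \<ge> M1 \<Longrightarrow> t \<in> {0..1} \<Longrightarrow> norm (B (g (r n) t) - B (\<gamma> t)) < d"
      using ub[OF d(1)] by blast
    obtain M2 where M2: "1 / real (Suc M2) < e" using e nat_approx_posE by blast
    have base: "partial_energy \<gamma> N (V n) \<le> K" if n: "n \<ge> max M1 M2" for n
    proof -
      have "1 / real (Suc (r n)) \<le> 1 / real (Suc M2)"
        using n seq_suble[OF r, of n] by (intro divide_left_mono) auto
      then have "1 / real (Suc (r n)) \<le> e" using M2 by linarith
      then have en: "?E (g (r n)) \<le> m + ennreal e"
        using g(2)[of "r n"] by (meson add_left_mono ennreal_leI less_imp_le order_trans)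
      have "partial_energy \<gamma> N (V n) \<le> ?E (g (r n)) + ennreal (\<epsilon> / 2 * e * sq_norm (vel (g (r n))))"
        unfolding V_def
      proof (rule partial_energy_close[OF \<gamma>(1) a])
        fix t b assume t: "t \<in> {0<..<1::real}"
        then have t': "t \<in> {0..1}" by auto
        have "norm (B (\<gamma> t) - B (g (r n) t)) < d" using M1[OF _ t', of n] n by (simp add: norm_minus_commute)
        then show "\<bar>tensor_sum (\<gamma> t) N b - tensor_sum (g (r n) t) N b\<bar> \<le> e * (norm b)\<^sup>2"
          by (intro d(2) \<gamma>(1) t' admissibleD(1)[OF a])
      qed (use e in auto)
      also have "\<dots> \<le> (m + ennreal e) + ennreal (\<epsilon> / 2 * e * C)"
        using en C eps_pos e by (intro add_mono ennreal_leI mult_left_mono) auto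
      also have "\<dots> = K"
        unfolding K_def add.assoc using eps_pos e C0 by (subst ennreal_plus[symmetric]) (auto simp: algebra_simps)
      finally show ?thesis .
    qed
    \<comment> \<open>The bound for late \<open>V n\<close> is inherited by their midpoint
      combinations, hence by the almost everywhere convergent sequence \<open>w\<close>; the
      original velocities need not converge pointwise.\<close>
    have hull: "L2_zero x \<and> partial_energy \<gamma> N x \<le> K" if "tail_hull V (max M1 M2) x" for x
      using that
    proof (induction rule: tail_hull.induct)
      case (base n)
      then show ?case using \<open>\<And>n. n \<ge> max M1 M2 \<Longrightarrow> partial_energy \<gamma> N (V n) \<le> K\<close> V(1) by blast
    next
      case (mid x y)
      then show ?case
        using partial_energy_mid[OF \<gamma>(1) cl, of x y N K] L2_zero_mid_diff(1)[of x y] L2_zero_measurable by blast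
    qed
    have "partial_energy \<gamma> N v \<le> K"
      unfolding partial_energy_def
    proof (rule nn_integral_le_of_AE_tendsto)
      show "(\<lambda>t. ennreal (\<epsilon> / 2 * tensor_sum (\<gamma> t) N (w n t)) * indicator {0<..<1} t) \<in> borel_measurable lborel" for n
        by (intro measurable_tensor_sum \<gamma>(1) cl L2_zero_measurable w)
      show "AE t in lborel. (\<lambda>n. ennreal (\<epsilon> / 2 * tensor_sum (\<gamma> t) N (w n t)) * indicator {0<..<1} t)
          \<longlonglongrightarrow> ennreal (\<epsilon> / 2 * tensor_sum (\<gamma> t) N (v t)) * indicator {0<..<1} t"
        using wv(1)
      proof eventually_elim
        case (elim t)
        show ?case
        proof (cases "t \<in> {0<..<1}")
          case True
          then have rt: "radon_prob (\<gamma> t)" using \<gamma>(1) by auto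
          have "(\<lambda>n. tensor_sum (\<gamma> t) N (w n t)) \<longlonglongrightarrow> tensor_sum (\<gamma> t) N (v t)"
            by (rule tensor_sum_tendsto[OF rt _ tendsto_const elim]) (simp add: rt)
          then have "(\<lambda>n. ennreal (\<epsilon> / 2 * tensor_sum (\<gamma> t) N (w n t))) \<longlonglongrightarrow> ennreal (\<epsilon> / 2 * tensor_sum (\<gamma> t) N (v t))"
            by (intro tendsto_ennrealI tendsto_mult_left)
          then show ?thesis using True by simp
        qed simp
      qed
      have "partial_energy \<gamma> N (w n) \<le> K" if "n \<ge> max M1 M2" for n
        using hull tail_hull_antimono[OF w(1) that] by blast
      then show "\<forall>\<^sub>F n in sequentially. (\<integral>\<^sup>+t. ennreal (\<epsilon> / 2 * tensor_sum (\<gamma> t) N (w n t)) * indicator {0<..<1} t \<partial>lborel) \<le> K"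
        unfolding partial_energy_def eventually_sequentially by blast
    qed
    then show ?thesis by (simp add: K_def)
  qed
  have "partial_energy \<gamma> N v \<le> m" for N
  proof (rule ennreal_le_epsilon)
    fix e :: real assume e: "0 < e"
    have p: "0 < 1 + \<epsilon> / 2 * C" using eps_pos C0 by (intro add_pos_nonneg) auto
    then have "partial_energy \<gamma> N v \<le> m + ennreal (e / (1 + \<epsilon> / 2 * C) * (1 + \<epsilon> / 2 * C))" using e by (intro bound) auto
    also have "e / (1 + \<epsilon> / 2 * C) * (1 + \<epsilon> / 2 * C) = e" using p by simp
    finally show "partial_energy \<gamma> N v \<le> m + ennreal e" .
  qed
  then have "?E \<gamma> \<le> m" by (rule energy_le_of_partial_energy[OF ag L2_zero_measurable[OF v] vv])
  then show "\<exists>\<gamma>\<in>P. ?E \<gamma> \<le> (INF \<gamma>\<in>P. ?E \<gamma>)" using gP by (auto simp: m_def)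
qed

end

theorem theorem5p4:
  fixes \<epsilon> :: real
    and c :: "'a::metric_space \<Rightarrow> 'a \<Rightarrow> real"
    and incl :: "'h::{real_inner,banach,second_countable_topology} \<Rightarrow> 'a \<Rightarrow> real"
    and \<mu>0 \<mu>1 :: "'a measure"
  assumes "compact (UNIV :: 'a set)"
    and "\<epsilon> > 0"
    and "continuous_on UNIV (\<lambda>p. c (fst p) (snd p))"
    and "\<And>x y. 0 \<le> c x y"
    and "\<And>x y. c x y = c y x"
    and "pos_def_kernel (k_c \<epsilon> c)"
    and "is_rkhs (k_c \<epsilon> c) incl"
    and "universal incl"
    and "radon_prob \<mu>0"
    and "radon_prob \<mu>1"
  shows "\<exists>\<gamma>\<in>paths_between \<epsilon> c incl \<mu>0 \<mu>1.
           energy \<epsilon> c incl \<gamma> = ennreal ((d_S \<epsilon> c incl \<mu>0 \<mu>1)\<^sup>2) \<and>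
           (\<forall>\<gamma>'\<in>paths_between \<epsilon> c incl \<mu>0 \<mu>1. energy \<epsilon> c incl \<gamma> \<le> energy \<epsilon> c incl \<gamma>')"
proof -
  interpret kernel_space \<epsilon> c incl
    by unfold_locales (fact assms)+
  define m where "m = (INF \<gamma>\<in>paths_between \<epsilon> c incl \<mu>0 \<mu>1. energy \<epsilon> c incl \<gamma>)"
  obtain \<gamma> where \<gamma>: "\<gamma> \<in> paths_between \<epsilon> c incl \<mu>0 \<mu>1" "energy \<epsilon> c incl \<gamma> \<le> m"
    using minimizer_exists(1)[OF assms(9,10)] unfolding m_def by blast
  have fin: "m < \<infinity>" using minimizer_exists(2)[OF assms(9,10)] unfolding m_def .
  have low: "m \<le> energy \<epsilon> c incl \<gamma>'" if "\<gamma>' \<in> paths_between \<epsilon> c incl \<mu>0 \<mu>1" for \<gamma>'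
    unfolding m_def using that by (rule INF_lower)
  have "energy \<epsilon> c incl \<gamma> = m" using \<gamma> low by (intro antisym)
  \<comment> \<open>Finiteness of the infimum makes the conversion by \<open>enn2real\<close> inside
    \<open>d_S\<close> lossless, so squaring the distance returns the infimum.\<close>
  moreover have "ennreal ((d_S \<epsilon> c incl \<mu>0 \<mu>1)\<^sup>2) = m"
    unfolding d_S_def m_def[symmetric] using fin by (simp add: enn2real_nonneg)
  ultimately show ?thesis using \<gamma>(1) low by auto
qed

end
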